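(* Let $\Omega\subseteq\mathbb{R}^n$ be a domain and let $X(\Omega)$ be a Banach function space on $\Omega$ such that: (i) $X(\Omega)$ has the Fatou property; (ii) the norm of $X(\Omega)$ is absolutely continuous; (iii) $X(\Omega)$ satisfies the strong Muckenhoupt condition on $\Omega$. Then $H^1_X(\Omega)=W^1_X(\Omega)$.
   Context: A domain $\Omega\subseteq\mathbb{R}^n$ is an open connected set (not necessarily bounded). $L^0(\Omega)$ denotes the Lebesgue measurable functions on $\Omega$ (identified if equal a.e.). Cubes have sides parallel to the coordinate axes, and $⨍_Q f\,dy=|Q|^{-1}\int_Q f\,dy$. Banach function space: a vector subspace $X(\Omega)\subseteq L^0(\Omega)$ equipped with a norm $\|\cdot\|_{X(\Omega)}$, complete in this norm, and satisfying: (ideal property) if $f\in X(\Omega)$, $g\in L^0(\Omega)$ and $|g|\le|f|$, then $g\in X(\Omega)$ and $\|g\|_{X(\Omega)}\le\|f\|_{X(\Omega)}$; (saturation property) for every measurable $E\subseteq\Omega$ of positive measure there is a measurable $F\subseteq E$ of positive measure with $\chi_F\in X(\Omega)$. Associate space: $X'(\Omega)$ is the set of $g\in L^0(\Omega)$ with $fg\in L^1(\Omega)$ for all $f\in X(\Omega)$, with $\|g\|_{X'(\Omega)}=\sup\{\int_\Omega|fg|\,dx: f\in X(\Omega),\ \|f\|_{X(\Omega)}=1\}$. Fatou property: if $0\le f_1\le f_2\le\cdots$ are in $X(\Omega)$, $\sup_k\|f_k\|_{X(\Omega)}<\infty$ and $f_k\uparrow f$ pointwise, then $f\in X(\Omega)$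 and $\|f\|_{X(\Omega)}=\lim_k\|f_k\|_{X(\Omega)}$. Absolutely continuous norm: for every $f\in X(\Omega)$ and every sequence of measurable sets $E_1\supset E_2\supset\cdots$ in $\Omega$ with $\bigcap_k E_k=\emptyset$, $\lim_{k}\|f\chi_{E_k}\|_{X(\Omega)}=0$. Strong Muckenhoupt condition: for every cube $Q\subset\Omega$, $\chi_Q\in X(\Omega)$ and $\chi_Q\in X'(\Omega)$, and $[X(\Omega)]_{A^s(\Omega)}=\sup_{\mathcal{Q}}\|A_{\mathcal{Q}}\|<\infty$, where the supremum is over all collections $\mathcal{Q}$ of pairwise disjoint cubes contained in $\Omega$, $A_{\mathcal{Q}}f(x)=\sum_{Q\in\mathcal{Q}}\left(|Q|^{-1}\int_Q f(y)\,dy\right)\chi_Q(x)$, and $\|A_{\mathcal{Q}}\|$ is the operator norm on $X(\Omega)$. Sobolev spaces: $W^{1,1}_{loc}(\Omega)$ is the set of $f\in L^1_{loc}(\Omega)$ whose distributional partial derivatives $\partial_jf$, $j=1,\dots,n$, exist and lie in $L^1_{loc}(\Omega)$; $\nabla f=(\partial_1f,\dots,\partial_nf)$. $W^1_X(\Omega)$ is the set of $f\in W^{1,1}_{loc}(\Omega)$ (identified with the pairs $(f,\nabla f)$) with $f$ and all $\partial_j f$ in $X(\Omega)$, i.e. $\|f\|_{W^1_X(\Omega)}=\|f\|_{X(\Omega)}+\|\nabla f\|_{X(\Omega)}<\infty$, where $\|\nabla f\|_{X(\Omega)}=\|\,|\nabla f|\,\|_{X(\Omega)}$. $\mathrm{Lip}(\Omega)$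 is the set of locally Lipschitz functions on $\Omega$. $H^1_X(\Omega)$ is the formal closure of $\mathrm{Lip}(\Omega)\cap W^1_X(\Omega)$ in the $W^1_X(\Omega)$ norm: the equivalence classes of Cauchy sequences $(f_k,\nabla f_k)$ with $f_k\in\mathrm{Lip}(\Omega)\cap W^1_X(\Omega)$ (two sequences being equivalent if their difference tends to $0$ in norm), each class being identified with the pair $(f,\mathbf{g})\in X(\Omega)\oplus X(\Omega)^n$ to which the sequence converges. The equality $H^1_X(\Omega)=W^1_X(\Omega)$ is understood through the identification $f\leftrightarrow(f,\nabla f)$. *)

theory Defs
  imports "HOL-Analysis.Analysis"
begin

section \<open>Banach function spaces\<close>

text \<open>
  Elements of \<open>L\<^sup>0(\<Omega>)\<close> are represented by total functions that are Lebesgue measurable on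
  \<open>\<Omega>\<close>; their values outside \<open>\<Omega>\<close> are irrelevant. A function space is a carrier \<open>X\<close> of such
  representatives together with a norm \<open>N\<close>. Since pointwise relations are read almost
  everywhere, the ideal property makes \<open>X\<close> and \<open>N\<close> invariant under a.e. equality on \<open>\<Omega>\<close>.
\<close>

definition domain :: "(real^'n) set \<Rightarrow> bool" where
  "domain \<Omega> \<longleftrightarrow> open \<Omega> \<and> connected \<Omega>"

locale banach_function_space =
  fixes \<Omega> :: "(real^'n) set"
    and X :: "(real^'n \<Rightarrow> real) set"
    and N :: "(real^'n \<Rightarrow> real) \<Rightarrow> real"
  assumes measurable: "X \<subseteq> borel_measurable (lebesgue_on \<Omega>)"
    and zero: "(\<lambda>x. 0) \<in> X"
    and add: "\<And>f g. f \<in> X \<Longrightarrow> g \<in> X \<Longrightarrow> (\<lambda>x. f x + g x) \<in> X"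
    and scale: "\<And>c f. f \<in> X \<Longrightarrow> (\<lambda>x. c * f x) \<in> X"
    and norm_nonneg: "\<And>f. f \<in> X \<Longrightarrow> 0 \<le> N f"
    and norm_eq_0: "\<And>f. f \<in> X \<Longrightarrow> N f = 0 \<longleftrightarrow> (AE x in lebesgue_on \<Omega>. f x = 0)"
    and norm_scale: "\<And>c f. f \<in> X \<Longrightarrow> N (\<lambda>x. c * f x) = \<bar>c\<bar> * N f"
    and norm_triangle: "\<And>f g. f \<in> X \<Longrightarrow> g \<in> X \<Longrightarrow> N (\<lambda>x. f x + g x) \<le> N f + N g"
    and complete: "\<And>u :: nat \<Rightarrow> real^'n \<Rightarrow> real.
      (\<And>k. u k \<in> X) \<Longrightarrow>
      (\<And>e. e > 0 \<Longrightarrow> \<exists>M. \<forall>k\<ge>M. \<forall>l\<ge>M. N (\<lambda>x. u k x - u l x) < e) \<Longrightarrow>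
      \<exists>f\<in>X. (\<lambda>k. N (\<lambda>x. u k x - f x)) \<longlonglongrightarrow> 0"
    and ideal: "\<And>f g. f \<in> X \<Longrightarrow> g \<in> borel_measurable (lebesgue_on \<Omega>) \<Longrightarrow>
      (AE x in lebesgue_on \<Omega>. \<bar>g x\<bar> \<le> \<bar>f x\<bar>) \<Longrightarrow> g \<in> X \<and> N g \<le> N f"
    and saturation: "\<And>E. E \<in> sets lebesgue \<Longrightarrow> E \<subseteq> \<Omega> \<Longrightarrow> emeasure lebesgue E > 0 \<Longrightarrow>
      \<exists>F. F \<in> sets lebesgue \<and> F \<subseteq> E \<and> emeasure lebesgue F > 0 \<and> indicat_real F \<in> X"

definition associate_space ::
  "(real^'n) set \<Rightarrow> (real^'n \<Rightarrow> real) set \<Rightarrow> (real^'n \<Rightarrow> real) set" where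
  "associate_space \<Omega> X =
    {g \<in> borel_measurable (lebesgue_on \<Omega>).
      \<forall>f\<in>X. integrable (lebesgue_on \<Omega>) (\<lambda>x. f x * g x)}"

text \<open>
  The limit \<open>f\<close> is finite-valued, as an element of \<open>L\<^sup>0(\<Omega>)\<close>. Allowing the value \<open>\<infinity>\<close> would
  give nothing different: by saturation a norm-bounded increasing sequence cannot tend to
  \<open>\<infinity>\<close> on a set of positive measure.
\<close>

definition fatou_property ::
  "(real^'n) set \<Rightarrow> (real^'n \<Rightarrow> real) set \<Rightarrow> ((real^'n \<Rightarrow> real) \<Rightarrow> real) \<Rightarrow> bool" where
  "fatou_property \<Omega> X N \<longleftrightarrow>
    (\<forall>(u :: nat \<Rightarrow> real^'n \<Rightarrow> real) f.
      (\<forall>k. u k \<in> X) \<and>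
      (AE x in lebesgue_on \<Omega>. 0 \<le> u 0 x \<and> incseq (\<lambda>k. u k x)) \<and>
      bdd_above (range (\<lambda>k. N (u k))) \<and>
      (AE x in lebesgue_on \<Omega>. (\<lambda>k. u k x) \<longlonglongrightarrow> f x)
      \<longrightarrow> f \<in> X \<and> (\<lambda>k. N (u k)) \<longlonglongrightarrow> N f)"

definition absolutely_continuous_norm ::
  "(real^'n) set \<Rightarrow> (real^'n \<Rightarrow> real) set \<Rightarrow> ((real^'n \<Rightarrow> real) \<Rightarrow> real) \<Rightarrow> bool" where
  "absolutely_continuous_norm \<Omega> X N \<longleftrightarrow>
    (\<forall>f\<in>X. \<forall>E :: nat \<Rightarrow> (real^'n) set.
      (\<forall>k. E k \<in> sets lebesgue \<and> E k \<subseteq> \<Omega>) \<and> decseq E \<and> (\<Inter>k. E k) = {}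
      \<longrightarrow> (\<lambda>k. N (\<lambda>x. f x * indicat_real (E k) x)) \<longlonglongrightarrow> 0)"


section \<open>The strong Muckenhoupt condition\<close>

text \<open>
  Cubes are closed and nondegenerate. This is the least demanding convention: replacing closed
  cubes by their interiors (or by half-open cubes) changes neither characteristic functions nor
  averages up to null sets, and keeps them disjoint and inside \<open>\<Omega>\<close>, so the condition for open
  or half-open cubes implies the one used here.
\<close>

definition is_cube :: "(real^'n) set \<Rightarrow> bool" where
  "is_cube Q \<longleftrightarrow> (\<exists>a l. l > 0 \<and> Q = cbox a (a + (\<chi> i. l)))"

definition disjoint_cube_families :: "(real^'n) set \<Rightarrow> (real^'n) set set set" where
  "disjoint_cube_families \<Omega> = {\<Q>. (\<forall>Q\<in>\<Q>. is_cube Q \<and> Q \<subseteq> \<Omega>) \<and> disjoint \<Q>}"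

text \<open>By disjointness at most one summand is nonzero at each point, so the sum is always defined.\<close>

definition averaging_operator ::
  "(real^'n) set set \<Rightarrow> (real^'n \<Rightarrow> real) \<Rightarrow> real^'n \<Rightarrow> real" where
  "averaging_operator \<Q> f x =
    (\<Sum>\<^sub>\<infinity>Q\<in>\<Q>. (1 / measure lebesgue Q * (LINT y|lebesgue_on Q. f y)) * indicat_real Q x)"

text \<open>The norm is \<open>\<infinity>\<close> for functions outside \<open>X\<close>, so a finite operator norm includes \<open>T ` X \<subseteq> X\<close>.\<close>

definition extended_norm ::
  "(real^'n \<Rightarrow> real) set \<Rightarrow> ((real^'n \<Rightarrow> real) \<Rightarrow> real) \<Rightarrow> (real^'n \<Rightarrow> real) \<Rightarrow> ennreal" where
  "extended_norm X N f = (if f \<in> X then ennreal (N f) else \<infinity>)"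

definition operator_norm ::
  "(real^'n \<Rightarrow> real) set \<Rightarrow> ((real^'n \<Rightarrow> real) \<Rightarrow> real) \<Rightarrow>
   ((real^'n \<Rightarrow> real) \<Rightarrow> real^'n \<Rightarrow> real) \<Rightarrow> ennreal" where
  "operator_norm X N T = (SUP f\<in>{f \<in> X. N f \<le> 1}. extended_norm X N (T f))"

definition strong_Muckenhoupt_constant ::
  "(real^'n) set \<Rightarrow> (real^'n \<Rightarrow> real) set \<Rightarrow> ((real^'n \<Rightarrow> real) \<Rightarrow> real) \<Rightarrow> ennreal" where
  "strong_Muckenhoupt_constant \<Omega> X N =
    (SUP \<Q>\<in>disjoint_cube_families \<Omega>. operator_norm X N (averaging_operator \<Q>))"

definition strong_Muckenhoupt ::
  "(real^'n) set \<Rightarrow> (real^'n \<Rightarrow> real) set \<Rightarrow> ((real^'n \<Rightarrow> real) \<Rightarrow> real) \<Rightarrow> bool" where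
  "strong_Muckenhoupt \<Omega> X N \<longleftrightarrow>
    (\<forall>Q. is_cube Q \<and> Q \<subseteq> \<Omega> \<longrightarrow> indicat_real Q \<in> X \<and> indicat_real Q \<in> associate_space \<Omega> X) \<and>
    strong_Muckenhoupt_constant \<Omega> X N < \<infinity>"


section \<open>Sobolev spaces\<close>

definition partial_derivative ::
  "'n \<Rightarrow> (real^'n \<Rightarrow> real) \<Rightarrow> real^'n \<Rightarrow> real" where
  "partial_derivative j \<phi> x = frechet_derivative \<phi> (at x) (axis j 1)"

primrec continuously_differentiable :: "nat \<Rightarrow> (real^'n \<Rightarrow> real) \<Rightarrow> bool" where
  "continuously_differentiable 0 \<phi> \<longleftrightarrow> continuous_on UNIV \<phi>"
| "continuously_differentiable (Suc k) \<phi> \<longleftrightarrow>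
    \<phi> differentiable_on UNIV \<and> (\<forall>j. continuously_differentiable k (partial_derivative j \<phi>))"

definition test_functions :: "(real^'n) set \<Rightarrow> (real^'n \<Rightarrow> real) set" where
  "test_functions \<Omega> =
    {\<phi>. (\<forall>k. continuously_differentiable k \<phi>) \<and>
        compact (closure {x. \<phi> x \<noteq> 0}) \<and> closure {x. \<phi> x \<noteq> 0} \<subseteq> \<Omega>}"

definition L1_loc :: "(real^'n) set \<Rightarrow> (real^'n \<Rightarrow> real) set" where
  "L1_loc \<Omega> =
    {f \<in> borel_measurable (lebesgue_on \<Omega>).
      \<forall>K. compact K \<and> K \<subseteq> \<Omega> \<longrightarrow> integrable (lebesgue_on K) f}"

text \<open>
  \<open>weak_gradient \<Omega> f G\<close> says that \<open>f \<in> W\<^bsup>1,1\<^esup>\<^bsub>loc\<^esub>(\<Omega>)\<close> and that \<open>\<nabla>f = G\<close> almost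
  everywhere. The gradient is determined only up to null sets, hence a relation.
\<close>

definition weak_gradient ::
  "(real^'n) set \<Rightarrow> (real^'n \<Rightarrow> real) \<Rightarrow> (real^'n \<Rightarrow> real^'n) \<Rightarrow> bool" where
  "weak_gradient \<Omega> f G \<longleftrightarrow>
    f \<in> L1_loc \<Omega> \<and>
    (\<forall>j. (\<lambda>x. G x $ j) \<in> L1_loc \<Omega> \<and>
      (\<forall>\<phi>\<in>test_functions \<Omega>.
        (LINT x|lebesgue_on \<Omega>. f x * partial_derivative j \<phi> x) =
        - (LINT x|lebesgue_on \<Omega>. G x $ j * \<phi> x)))"

text \<open>
  Both Sobolev spaces are sets of pairs \<open>(f, G)\<close>, closed under a.e. equality in each component,
  with norm \<open>\<parallel>f\<parallel> + \<parallel>|G|\<parallel>\<close>, where \<open>|G|\<close> is the Euclidean length.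
\<close>

definition W1X ::
  "(real^'n) set \<Rightarrow> (real^'n \<Rightarrow> real) set \<Rightarrow> ((real^'n \<Rightarrow> real) \<times> (real^'n \<Rightarrow> real^'n)) set" where
  "W1X \<Omega> X = {(f, G). weak_gradient \<Omega> f G \<and> f \<in> X \<and> (\<forall>j. (\<lambda>x. G x $ j) \<in> X)}"

definition W1X_norm ::
  "((real^'n \<Rightarrow> real) \<Rightarrow> real) \<Rightarrow> (real^'n \<Rightarrow> real) \<Rightarrow> (real^'n \<Rightarrow> real^'n) \<Rightarrow> real" where
  "W1X_norm N f G = N f + N (\<lambda>x. norm (G x))"

definition locally_Lipschitz :: "(real^'n) set \<Rightarrow> (real^'n \<Rightarrow> real) set" where
  "locally_Lipschitz \<Omega> = {f. \<forall>x\<in>\<Omega>. \<exists>r>0. \<exists>L. L-lipschitz_on (ball x r \<inter> \<Omega>) f}"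

text \<open>
  A class of equivalent Cauchy sequences is represented by the pair in \<open>X \<oplus> X\<^sup>n\<close> to which its
  members converge. Such a pair \<open>(f, G)\<close> is not assumed to satisfy \<open>G = \<nabla>f\<close>.
\<close>

definition H1X ::
  "(real^'n) set \<Rightarrow> (real^'n \<Rightarrow> real) set \<Rightarrow> ((real^'n \<Rightarrow> real) \<Rightarrow> real) \<Rightarrow>
   ((real^'n \<Rightarrow> real) \<times> (real^'n \<Rightarrow> real^'n)) set" where
  "H1X \<Omega> X N =
    {(f, G). f \<in> X \<and> (\<forall>j. (\<lambda>x. G x $ j) \<in> X) \<and>
      (\<exists>(u :: nat \<Rightarrow> real^'n \<Rightarrow> real) (V :: nat \<Rightarrow> real^'n \<Rightarrow> real^'n).
        (\<forall>k. u k \<in> locally_Lipschitz \<Omega> \<and> (u k, V k) \<in> W1X \<Omega> X) \<and>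
        (\<forall>e>0. \<exists>M. \<forall>k\<ge>M. \<forall>l\<ge>M.
          W1X_norm N (\<lambda>x. u k x - u l x) (\<lambda>x. V k x - V l x) < e) \<and>
        (\<lambda>k. W1X_norm N (\<lambda>x. u k x - f x) (\<lambda>x. V k x - G x)) \<longlonglongrightarrow> 0)}"

end

theory Submission
  imports Defs "HOL-Computational_Algebra.Polynomial"
begin

text \<open>
  \<open>H \<subseteq> W\<close>: testing the strong Muckenhoupt condition on a single cube bounds \<open>\<integral>\<^sub>K |h|\<close> by a multiple
  of the norm of \<open>h\<close> for every compact \<open>K\<close>, so the weak derivative identity passes to limits.

  \<open>W \<subseteq> H\<close> follows Meyers and Serrin. Mollification at scale \<open>e\<close> is dominated by finitely many
  averaging operators over disjoint cubes of side \<open>3e\<close>, hence is bounded on functions with support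
  in a fixed compact set, uniformly in \<open>e\<close>. Absolute continuity of the norm gives dominated
  convergence in \<open>X\<close>, hence density of continuous functions, and so mollifications converge in \<open>X\<close>.
  The pieces of a function cut by a smooth partition of unity are mollified separately, and the
  Fatou property sums the errors. Since only Lipschitz approximants are needed, the mollifier is
  a Lipschitz tent; smoothness matters only for the partition of unity.
\<close>

section \<open>Smooth cutoff functions\<close>

text \<open>A general X is not translation invariant, so no convolution inequality of Young type is
  at hand. The averaging operators replace it, but they control only cubes lying in \<Omega>; this
  is why every mollified function has compact support in \<Omega> and why the admissible scales
  depend on that support. Bounds for mollification do not by themselves give convergence. Bounded
  functions supported in a compact set are dominated by multiples of an indicator in X, and absolute
  continuity turns their pointwise convergence into convergence in norm. The tent is not
  differentiable everywhere, so the gradient of a mollification is never computed pointwise.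
  Approximants are carried as pairs, and the pair inherits the integration by parts formula by
  moving the mollifier onto the test function, whose translates are again test functions on the
  whole space.\<close>

abbreviation smooth :: "(real^'n \<Rightarrow> real) \<Rightarrow> bool" where
  "smooth \<phi> \<equiv> \<forall>k. continuously_differentiable k \<phi>"

section \<open>Closure properties of functions of class C^k\<close>

lemma partial_derivative_eqI:
  "(f has_derivative f') (at x) \<Longrightarrow> partial_derivative j f x = f' (axis j 1)"
  by (simp add: partial_derivative_def flip: frechet_derivative_at)

text \<open>Only the bottom level of the definition mentions continuity. The product and quotient
  rules leave one factor undifferentiated, so their inductions need order k from order k +
  1.\<close>

lemma continuously_differentiable_pred:
  "continuously_differentiable (Suc k) \<phi> \<Longrightarrow> continuously_differentiable k \<phi>"
proof (induction k arbitrary: \<phi>)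
  case 0
  then show ?case by (simp add: differentiable_imp_continuous_on)
next
  case (Suc k)
  then show ?case by auto
qed

lemma continuously_differentiable_imp_continuous:
  "continuously_differentiable k \<phi> \<Longrightarrow> continuous_on UNIV \<phi>"
  by (cases k) (auto simp: differentiable_imp_continuous_on)

lemma has_derivative_frechet:
  assumes "f differentiable_on UNIV"
  shows "(f has_derivative frechet_derivative f (at x)) (at x)"
  using assms by (simp add: differentiable_on_def frechet_derivative_works)

lemma continuously_differentiable_const: "continuously_differentiable k (\<lambda>x::real^'n. c)"
proof (induction k arbitrary: c)
  case (Suc k)
  have "partial_derivative j (\<lambda>x::real^'n. c) = (\<lambda>x. 0)" for j
    by (rule ext, rule partial_derivative_eqI) (auto intro: derivative_eq_intros)
  then show ?case using Suc by simp
qed simp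

lemma partial_derivative_add:
  assumes "f differentiable_on UNIV" "g differentiable_on UNIV"
  shows "partial_derivative j (\<lambda>x. f x + g x) = (\<lambda>x. partial_derivative j f x + partial_derivative j g x)"
proof
  fix x
  show "partial_derivative j (\<lambda>x. f x + g x) x = partial_derivative j f x + partial_derivative j g x"
    unfolding partial_derivative_def[of j f] partial_derivative_def[of j g]
    by (rule partial_derivative_eqI)
       (intro has_derivative_add has_derivative_frechet assms)
qed

lemma continuously_differentiable_add:
  "continuously_differentiable k f \<Longrightarrow> continuously_differentiable k g \<Longrightarrow>
   continuously_differentiable k (\<lambda>x. f x + g x)"
proof (induction k arbitrary: f g)
  case 0
  then show ?case by (simp add: continuous_on_add)
next
  case (Suc k)
  then show ?case by (simp add: partial_derivative_add)
qed

lemma partial_derivative_mult: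
  assumes "f differentiable_on UNIV" "g differentiable_on UNIV"
  shows "partial_derivative j (\<lambda>x. f x * g x) = (\<lambda>x. f x * partial_derivative j g x + partial_derivative j f x * g x)"
proof
  fix x
  show "partial_derivative j (\<lambda>x. f x * g x) x = f x * partial_derivative j g x + partial_derivative j f x * g x"
    unfolding partial_derivative_def[of j f] partial_derivative_def[of j g]
    by (rule partial_derivative_eqI)
       (intro has_derivative_mult has_derivative_frechet assms)
qed

lemma continuously_differentiable_mult:
  "continuously_differentiable k f \<Longrightarrow> continuously_differentiable k g \<Longrightarrow>
   continuously_differentiable k (\<lambda>x. f x * g x)"
proof (induction k arbitrary: f g)
  case 0
  then show ?case by (simp add: continuous_on_mult)
next
  case (Suc k)
  have "continuously_differentiable k f" "continuously_differentiable k g"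
    using Suc.prems continuously_differentiable_pred by blast+
  with Suc show ?case
    by (auto simp: partial_derivative_mult intro: continuously_differentiable_add)
qed

lemma continuously_differentiable_diff:
  assumes "continuously_differentiable k f" "continuously_differentiable k g"
  shows "continuously_differentiable k (\<lambda>x. f x - g x)"
  using continuously_differentiable_add[OF assms(1)
      continuously_differentiable_mult[OF continuously_differentiable_const[of _ "-1"] assms(2)]]
  by simp

lemma continuously_differentiable_sum:
  "(\<And>i. i \<in> I \<Longrightarrow> continuously_differentiable k (f i)) \<Longrightarrow>
   continuously_differentiable k (\<lambda>x. \<Sum>i\<in>I. f i x)"
  by (induction I rule: infinite_finite_induct)
     (simp_all add: continuously_differentiable_const continuously_differentiable_add)

lemma continuously_differentiable_component:
  "continuously_differentiable k (\<lambda>x::real^'n. x $ i)"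
proof (cases k)
  case 0
  then show ?thesis by (simp add: continuous_intros)
next
  case (Suc m)
  have d: "((\<lambda>x::real^'n. x $ i) has_derivative (\<lambda>x. x $ i)) (at x)" for x
    by (simp add: bounded_linear_imp_has_derivative bounded_linear_vec_nth)
  have "partial_derivative j (\<lambda>x::real^'n. x $ i) = (\<lambda>x. axis j 1 $ i)" for j
    by (rule ext, rule partial_derivative_eqI[OF d])
  moreover have "(\<lambda>x::real^'n. x $ i) differentiable_on UNIV"
    by (simp add: bounded_linear_imp_differentiable_on bounded_linear_vec_nth)
  ultimately show ?thesis
    using Suc by (simp add: continuously_differentiable_const)
qed

text \<open>The derivative is again a quotient, with nonvanishing denominator
  \<open>g x * g x\<close>, so the induction closes once both f and g are arbitrary.\<close>

lemma continuously_differentiable_divide: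
  "continuously_differentiable k f \<Longrightarrow> continuously_differentiable k g \<Longrightarrow> (\<And>x. g x \<noteq> 0) \<Longrightarrow>
   continuously_differentiable k (\<lambda>x. f x / g x)"
proof (induction k arbitrary: f g)
  case 0
  then show ?case by (simp add: continuous_on_divide)
next
  case (Suc k)
  note nz = Suc.prems(3)
  have ck: "continuously_differentiable k f" "continuously_differentiable k g"
    using Suc.prems continuously_differentiable_pred by blast+
  have df: "f differentiable_on UNIV" "g differentiable_on UNIV" using Suc.prems by auto
  have d: "((\<lambda>x. f x / g x) has_derivative
      (\<lambda>h. - f x * (inverse (g x) * frechet_derivative g (at x) h * inverse (g x)) + frechet_derivative f (at x) h / g x)) (at x)" for x
    by (rule has_derivative_divide[OF has_derivative_frechet[OF df(1)] has_derivative_frechet[OF df(2)] nz])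
  have p: "partial_derivative j (\<lambda>x. f x / g x) =
      (\<lambda>x. (partial_derivative j f x * g x - f x * partial_derivative j g x) / (g x * g x))" for j
    apply (rule ext)
    apply (subst partial_derivative_eqI[OF d])
    using nz by (simp add: partial_derivative_def field_simps)
  have "continuously_differentiable k (\<lambda>x. (partial_derivative j f x * g x - f x * partial_derivative j g x) / (g x * g x))" for j
    using Suc.prems(1,2) ck nz
    by (intro Suc.IH continuously_differentiable_diff continuously_differentiable_mult) auto
  moreover have "(\<lambda>x. f x / g x) differentiable_on UNIV"
    using d by (auto simp: differentiable_on_def differentiable_def)
  ultimately show ?case by (simp add: p)
qed

lemma partial_derivative_translate:
  assumes "f differentiable_on UNIV"
  shows "partial_derivative j (\<lambda>x. f (x + a)) = (\<lambda>x. partial_derivative j f (x + a))"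
    and "(\<lambda>x. f (x + a)) differentiable_on UNIV"
proof -
  have d: "((\<lambda>x. f (x + a)) has_derivative frechet_derivative f (at (x + a))) (at x)" for x
    using has_derivative_compose[of "\<lambda>x. x + a" "\<lambda>x. x" x UNIV f "frechet_derivative f (at (x + a))"]
      has_derivative_frechet[OF assms, of "x + a"]
    by (simp add: has_derivative_add_const)
  show "partial_derivative j (\<lambda>x. f (x + a)) = (\<lambda>x. partial_derivative j f (x + a))"
    by (rule ext, subst partial_derivative_eqI[OF d]) (simp add: partial_derivative_def)
  show "(\<lambda>x. f (x + a)) differentiable_on UNIV"
    using d by (auto simp: differentiable_on_def differentiable_def)
qed

lemma continuously_differentiable_translate:
  "continuously_differentiable k f \<Longrightarrow> continuously_differentiable k (\<lambda>x. f (x + a))"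
proof (induction k arbitrary: f)
  case 0
  then show ?case
    by (auto intro!: continuous_on_compose2[of UNIV f] continuous_intros)
next
  case (Suc k)
  then show ?case by (simp add: partial_derivative_translate)
qed

section \<open>The flat function exp(-1/t), its derivatives, and smooth cutoffs\<close>

definition flat :: "real poly \<Rightarrow> real \<Rightarrow> real" where
  "flat p t = (if t > 0 then poly p (1 / t) * exp (- (1 / t)) else 0)"

text \<open>The substitution x = 1/t turns this into the decay of p(x) / exp x at infinity.\<close>

lemma flat_tendsto_0: "(flat p \<longlongrightarrow> 0) (at_right 0)"
proof -
  have "((\<lambda>x. poly p x / exp x) \<longlongrightarrow> 0) at_top"
  proof -
    have "((\<lambda>x. \<Sum>i\<le>degree p. coeff p i * (x ^ i / exp x)) \<longlongrightarrow> (\<Sum>i\<le>degree p. coeff p i * 0)) at_top"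
      by (intro tendsto_sum tendsto_mult tendsto_const tendsto_power_div_exp_0)
    then show ?thesis by (simp add: poly_altdef sum_divide_distrib)
  qed
  then have "((\<lambda>t. poly p (inverse t) / exp (inverse t)) \<longlongrightarrow> 0) (at_right 0)"
    by (rule filterlim_compose[OF _ filterlim_inverse_at_top_right])
  then show ?thesis
  proof (rule Lim_transform_eventually)
    show "\<forall>\<^sub>F t in at_right 0. poly p (inverse t) / exp (inverse t) = flat p t"
      by (rule eventually_at_right_less[THEN eventually_mono])
         (auto simp: flat_def exp_minus inverse_eq_divide field_simps)
  qed
qed

text \<open>With s = 1/t the derivative of p(s) exp(-s) is s^2 (p(s) - p'(s)) exp(-s), and
  \<open>[:0,0,1:]\<close> is the polynomial s^2. Carrying a polynomial factor thus makes the family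
  closed under differentiation.\<close>

lemma flat_has_derivative:
  "(flat p has_field_derivative flat ([:0,0,1:] * (p - pderiv p)) t) (at t)"
proof -
  consider "t > 0" | "t < 0" | "t = 0" by linarith
  then show ?thesis
  proof cases
    case 1
    have "((\<lambda>t. poly p (1 / t) * exp (- (1 / t))) has_field_derivative
        flat ([:0,0,1:] * (p - pderiv p)) t) (at t)"
      using 1 by (auto intro!: derivative_eq_intros poly_DERIV[THEN DERIV_chain2]
          simp: flat_def field_simps power2_eq_square)
    then show ?thesis
      by (rule DERIV_cong_ev[THEN iffD1, rotated 3, OF _ refl _ refl])
         (use 1 in \<open>auto simp: flat_def eventually_nhds intro!: exI[of _ "{0<..}"]\<close>)
  next
    case 2
    have "((\<lambda>t. 0) has_field_derivative flat ([:0,0,1:] * (p - pderiv p)) t) (at t)"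
      using 2 by (simp add: flat_def)
    then show ?thesis
      by (rule DERIV_cong_ev[THEN iffD1, rotated 3, OF _ refl _ refl])
         (use 2 in \<open>auto simp: flat_def eventually_nhds intro!: exI[of _ "{..<0}"]\<close>)
  next
    case 3
    \<comment> \<open>For h > 0 the quotient \<open>flat p h / h\<close> is
      \<open>flat ([:0,1:] * p) h\<close>, so the limit of flat functions at 0 also settles the
      difference quotient.\<close>
    have r: "((\<lambda>h. flat p h / h) \<longlongrightarrow> 0) (at_right 0)"
      by (rule Lim_transform_eventually[OF flat_tendsto_0[of "[:0,1:] * p"]],
          rule eventually_at_right_less[THEN eventually_mono])
         (auto simp: flat_def)
    have l: "((\<lambda>h. flat p h / h) \<longlongrightarrow> 0) (at_left 0)"
      by (rule Lim_transform_eventually[OF tendsto_const],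
          rule eventually_at_leftI[of "-1"]) (auto simp: flat_def)
    have "((\<lambda>h. flat p h / h) \<longlongrightarrow> 0) (at 0)"
      using l r by (simp add: filterlim_split_at)
    then show ?thesis using 3 by (simp add: DERIV_def flat_def)
  qed
qed

text \<open>Each derivative replaces p by \<open>?q\<close> and multiplies by a derivative of g,
  hence the induction over arbitrary p and g.\<close>

lemma continuously_differentiable_flat:
  "continuously_differentiable k g \<Longrightarrow> continuously_differentiable k (\<lambda>x. flat p (g x))"
proof (induction k arbitrary: p g)
  case 0
  have "continuous_on UNIV (flat p)"
    using flat_has_derivative by (auto intro: DERIV_continuous_on has_field_derivative_at_within)
  with 0 show ?case
    by (auto intro: continuous_on_compose2)
next
  case (Suc k)
  let ?q = "[:0,0,1:] * (p - pderiv p)"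
  have d: "((\<lambda>x. flat p (g x)) has_derivative (\<lambda>h. frechet_derivative g (at x) h * flat ?q (g x))) (at x)" for x
    using has_derivative_frechet[of g x] Suc.prems
      DERIV_compose_FDERIV[OF flat_has_derivative, of g _ x UNIV p] by auto
  have "partial_derivative j (\<lambda>x. flat p (g x)) = (\<lambda>x. partial_derivative j g x * flat ?q (g x))" for j
    by (rule ext, subst partial_derivative_eqI[OF d]) (simp add: partial_derivative_def)
  moreover have "(\<lambda>x. flat p (g x)) differentiable_on UNIV"
    using d by (auto simp: differentiable_on_def differentiable_def)
  moreover have "continuously_differentiable k g" using Suc.prems continuously_differentiable_pred by blast
  ultimately show ?case
    using Suc by (simp add: continuously_differentiable_mult del: mult_pCons_left)
qed

text \<open>Finitely many smooth bumps on balls add up to a function that is positive exactly on a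
  neighbourhood of K; a smooth step then flattens it to 1 on K.\<close>

lemma smooth_cutoff:
  fixes K :: "(real^'n) set"
  assumes "compact K" "open U" "K \<subseteq> U"
  obtains \<theta> where "\<theta> \<in> test_functions U" "\<And>x. 0 \<le> \<theta> x" "\<And>x. \<theta> x \<le> 1" "\<And>x. x \<in> K \<Longrightarrow> \<theta> x = 1"
proof -
  have "\<exists>r>0. cball x r \<subseteq> U" if "x \<in> K" for x
    using that assms open_contains_cball by blast
  then obtain r where r: "\<And>x. x \<in> K \<Longrightarrow> r x > 0" "\<And>x. x \<in> K \<Longrightarrow> cball x (r x) \<subseteq> U"
    by metis
  have "K \<subseteq> (\<Union>x\<in>K. ball x (r x))" using r by force
  then obtain A where A: "A \<subseteq> K" "finite A" "K \<subseteq> (\<Union>x\<in>A. ball x (r x))"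
    by (rule compactE_image[OF assms(1), of K "\<lambda>x. ball x (r x)", rotated]) auto
  \<comment> \<open>Squared distances are polynomials in the coordinates, so each bump is smooth
    also at its centre.\<close>
  define s where "s x = (\<Sum>a\<in>A. flat 1 ((r a)\<^sup>2 - (\<Sum>i\<in>UNIV. (x $ i - a $ i) * (x $ i - a $ i))))" for x
  have nrm: "(\<Sum>i\<in>UNIV. (x $ i - a $ i) * (x $ i - a $ i)) = (dist a x)\<^sup>2" for x a :: "real^'n"
    by (simp add: dist_norm norm_vec_def L2_set_def sum_nonneg flip: power2_eq_square)
       (simp add: power2_commute)
  have f0: "flat 1 t \<ge> 0" "flat 1 t > 0 \<longleftrightarrow> t > 0" for t by (auto simp: flat_def)
  have s0: "s x \<ge> 0" for x unfolding s_def by (intro sum_nonneg f0)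
  have spos: "s x > 0 \<longleftrightarrow> x \<in> (\<Union>a\<in>A. ball a (r a))" for x
  proof -
    have "s x > 0 \<longleftrightarrow> (\<exists>a\<in>A. flat 1 ((r a)\<^sup>2 - (dist a x)\<^sup>2) > 0)"
      unfolding s_def nrm using A(2) f0(1)
      by (metis (no_types, lifting) less_le sum_nonneg_eq_0_iff sum_nonneg)
    also have "\<dots> \<longleftrightarrow> (\<exists>a\<in>A. dist a x < r a)"
      using r(1) A(1) unfolding f0
      by (metis diff_gt_0_iff_gt less_imp_le power_less_imp_less_base power_strict_mono subsetD zero_le_dist zero_less_numeral)
    finally show ?thesis by auto
  qed
  have cs: "continuously_differentiable k s" for k
    unfolding s_def[abs_def]
    by (intro continuously_differentiable_sum continuously_differentiable_flat continuously_differentiable_diff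
        continuously_differentiable_const continuously_differentiable_mult continuously_differentiable_component)
  \<comment> \<open>By compactness s stays above some c > 0 on K, so \<open>s x / c\<close> is at
    least 1 there.\<close>
  obtain c where c: "c > 0" "\<And>x. x \<in> K \<Longrightarrow> c \<le> s x"
  proof (cases "K = {}")
    case True
    then show ?thesis using that[of 1] by auto
  next
    case False
    have "continuous_on K s" using continuously_differentiable_imp_continuous[OF cs] continuous_on_subset by blast
    from continuous_attains_inf[OF assms(1) False this] obtain x where "x \<in> K" "\<forall>y\<in>K. s x \<le> s y" by blast
    then show ?thesis using that[of "s x"] spos A(3) by blast
  qed
  \<comment> \<open>With t = \<open>s x / c\<close> this is the smooth step from 0 for t \<le> 0 to
    1 for t \<ge> 1. Its denominator is positive because t and 1 - t are never both
    nonpositive.\<close>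
  define \<theta> where "\<theta> x = flat 1 (s x / c) / (flat 1 (s x / c) + flat 1 (1 - s x / c))" for x
  have den: "flat 1 t + flat 1 (1 - t) > 0" for t
    using f0[of t] f0[of "1-t"] by (cases "t > 0") (auto intro: add_pos_nonneg add_nonneg_pos)
  have nz: "\<theta> x \<noteq> 0 \<longleftrightarrow> x \<in> (\<Union>a\<in>A. ball a (r a))" for x
  proof -
    have "\<theta> x \<noteq> 0 \<longleftrightarrow> flat 1 (s x / c) \<noteq> 0" unfolding \<theta>_def using den[of "s x / c"] by auto
    also have "\<dots> \<longleftrightarrow> s x > 0" using f0[of "s x / c"] c(1) s0[of x] by (auto simp: zero_less_divide_iff less_le)
    finally show ?thesis using spos by simp
  qed
  have "closure {x. \<theta> x \<noteq> 0} \<subseteq> (\<Union>a\<in>A. cball a (r a))"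
    by (rule closure_minimal) (use A(2) nz in \<open>auto intro!: closed_UN\<close>)
  moreover have "(\<Union>a\<in>A. cball a (r a)) \<subseteq> U" using r A by blast
  moreover have "compact (\<Union>a\<in>A. cball a (r a))" using A by (auto intro: compact_UN)
  ultimately have "compact (closure {x. \<theta> x \<noteq> 0})" "closure {x. \<theta> x \<noteq> 0} \<subseteq> U"
    by (simp add: compact_closure, meson bounded_subset closure_subset compact_imp_bounded subset_trans, blast)
  moreover have "continuously_differentiable k \<theta>" for k
  proof -
    have *: "\<theta> = (\<lambda>x. flat 1 (s x * (1/c)) / (flat 1 (s x * (1/c)) + flat 1 (1 - s x * (1/c))))"
      by (auto simp: \<theta>_def)
    have "flat 1 t + flat 1 (1 - t) \<noteq> 0" for t using den[of t] by simp
    then show ?thesis unfolding *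
      by (intro continuously_differentiable_divide continuously_differentiable_add continuously_differentiable_flat continuously_differentiable_diff
        continuously_differentiable_const continuously_differentiable_mult cs)
  qed
  ultimately have "\<theta> \<in> test_functions U" by (simp add: test_functions_def)
  moreover have "0 \<le> \<theta> x" "\<theta> x \<le> 1" for x
    using den[of "s x / c"] f0[of "s x / c"] f0[of "1 - s x / c"] by (auto simp: \<theta>_def)
  moreover have "\<theta> x = 1" if "x \<in> K" for x
    using den[of "s x / c"] c(1) c(2)[OF that] by (auto simp: \<theta>_def flat_def[of _ "1 - s x / c"])
  ultimately show thesis using that by blast
qed

section \<open>Operations on test functions\<close>

lemma test_functions_mult:
  assumes "\<theta> \<in> test_functions U" "smooth \<psi>"
  shows "(\<lambda>x. \<theta> x * \<psi> x) \<in> test_functions U"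
proof -
  have "closure {x. \<theta> x * \<psi> x \<noteq> 0} \<subseteq> closure {x. \<theta> x \<noteq> 0}" by (rule closure_mono) auto
  moreover have "compact (closure {x. \<theta> x * \<psi> x \<noteq> 0})"
    using assms(1) unfolding test_functions_def mem_Collect_eq compact_closure
    by (auto elim: bounded_subset)
  ultimately show ?thesis
    using assms by (auto simp: test_functions_def continuously_differentiable_mult)
qed

lemma partial_derivative_smooth: "smooth \<phi> \<Longrightarrow> smooth (partial_derivative j \<phi>)"
  by (metis continuously_differentiable.simps(2))

lemma smooth_imp_differentiable: "smooth \<phi> \<Longrightarrow> \<phi> differentiable_on UNIV"
  by (metis continuously_differentiable.simps(2))

lemma partial_derivative_locally_zero:
  assumes "open S" "x \<in> S" "\<And>y. y \<in> S \<Longrightarrow> \<phi> y = c"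
  shows "partial_derivative j \<phi> x = 0"
proof -
  have "(\<phi> has_derivative (\<lambda>h. 0)) (at x)"
    by (rule has_derivative_transform_within_open[OF has_derivative_const[of c] assms(1,2)]) (use assms in simp)
  then show ?thesis by (rule partial_derivative_eqI)
qed

lemma partial_derivative_outside_support:
  assumes "x \<notin> closure {x. \<phi> x \<noteq> 0}"
  shows "partial_derivative j \<phi> x = 0"
proof (rule partial_derivative_locally_zero)
  show "open (- closure {x. \<phi> x \<noteq> 0})" by (intro open_Compl closed_closure)
  show "x \<in> - closure {x. \<phi> x \<noteq> 0}" using assms by simp
  show "\<phi> y = 0" if "y \<in> - closure {x. \<phi> x \<noteq> 0}" for y
    using that closure_subset[of "{x. \<phi> x \<noteq> 0}"] by blast
qed

section \<open>Banach function spaces with the strong Muckenhoupt condition\<close>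

lemma integrable_lebesgue_on:
  "K \<in> sets lebesgue \<Longrightarrow>
    integrable (lebesgue_on K) f \<longleftrightarrow> integrable lebesgue (\<lambda>x. indicat_real K x * f x)"
  by (simp add: integrable_restrict_space)

lemma integral_lebesgue_on:
  "K \<in> sets lebesgue \<Longrightarrow>
    integral\<^sup>L (lebesgue_on K) f = (LINT x|lebesgue. indicat_real K x * f x)"
  by (simp add: integral_restrict_space)

lemma is_cube_lebesgue: "is_cube Q \<Longrightarrow> Q \<in> sets lebesgue"
  by (auto simp: is_cube_def)

section \<open>Cubes and averaging operators\<close>

lemma measure_lebesgue_cube:
  fixes a :: "real^'n"
  assumes "l \<ge> 0"
  shows "measure lebesgue (cbox a (a + (\<chi> i. l))) = l ^ CARD('n)"
proof -
  have "a \<in> cbox a (a + (\<chi> i. l))" using assms by (simp add: mem_box_cart)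
  then have "cbox a (a + (\<chi> i. l)) \<noteq> {}" by blast
  from content_cbox_cart[OF this] show ?thesis by simp
qed

lemma is_cube_measure_pos:
  fixes Q :: "(real^'n) set"
  assumes "is_cube Q"
  shows "measure lebesgue Q > 0"
proof -
  obtain a l where "l > 0" "Q = cbox a (a + (\<chi> i. l))" using assms by (auto simp: is_cube_def)
  then show ?thesis using measure_lebesgue_cube[of l a] by simp
qed

lemma cube_around:
  fixes x :: "real^'n"
  assumes "e > 0"
  obtains Q where "is_cube Q" "Q \<subseteq> cball x e" "x \<in> interior Q"
proof
  \<comment> \<open>The Euclidean norm is at most the sum of the n absolute coordinates, so
    half-side e / n keeps the cube inside the ball.\<close>
  define l where "l = e / real CARD('n)"
  have l: "l > 0" using assms by (simp add: l_def)
  let ?Q = "cbox (x - (\<chi> i. l)) (x - (\<chi> i. l) + (\<chi> i. 2 * l))"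
  show "is_cube ?Q" unfolding is_cube_def using l by (intro exI[of _ "x - (\<chi> i. l)"] exI[of _ "2*l"]) auto
  show "?Q \<subseteq> cball x e"
  proof
    fix y assume "y \<in> ?Q"
    then have *: "\<bar>(y - x) $ i\<bar> \<le> l" for i
      by (auto simp: mem_box_cart abs_le_iff algebra_simps dest!: spec[of _ i])
    have "norm (y - x) \<le> (\<Sum>i\<in>UNIV. \<bar>(y - x) $ i\<bar>)" by (rule norm_le_l1_cart)
    also have "\<dots> \<le> (\<Sum>i\<in>(UNIV::'n set). l)" by (intro sum_mono *)
    also have "\<dots> = e" by (simp add: l_def)
    finally show "y \<in> cball x e" by (simp add: dist_norm norm_minus_commute)
  qed
  show "x \<in> interior ?Q" using l by (simp add: interior_cbox mem_box_cart)
qed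

text \<open>The cubes may overlap: the cover only serves for upper bounds by sums over its members,
  to each of which the Muckenhoupt condition applies separately.\<close>

lemma compact_cube_cover:
  fixes K :: "(real^'n) set"
  assumes "compact K" "open U" "K \<subseteq> U"
  obtains \<Q> where "finite \<Q>" "\<And>Q. Q \<in> \<Q> \<Longrightarrow> is_cube Q \<and> Q \<subseteq> U" "K \<subseteq> \<Union>\<Q>"
proof -
  have "\<exists>Q. is_cube Q \<and> Q \<subseteq> U \<and> x \<in> interior Q" if "x \<in> K" for x
  proof -
    from that assms(3) have "x \<in> U" by blast
    then obtain e where "e > 0" "cball x e \<subseteq> U" using open_contains_cball[of U] assms(2) by auto
    then show ?thesis by (meson cube_around[of e x] order_trans)
  qed
  then have "\<forall>x\<in>K. \<exists>Q. is_cube Q \<and> Q \<subseteq> U \<and> x \<in> interior Q" by simp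
  from bchoice[OF this] obtain q where q: "\<forall>x\<in>K. is_cube (q x) \<and> q x \<subseteq> U \<and> x \<in> interior (q x)" ..
  obtain A where A: "A \<subseteq> K" "finite A" "K \<subseteq> (\<Union>x\<in>A. interior (q x))"
    by (rule compactE_image[OF assms(1), of K "\<lambda>x. interior (q x)", rotated]) (use q in auto)
  show thesis
  proof (rule that[of "q ` A"])
    show "K \<subseteq> \<Union>(q ` A)" using A(3) interior_subset by fastforce
  qed (use A q in auto)
qed

lemma averaging_operator_at:
  assumes "disjoint \<Q>" "Q \<in> \<Q>" "x \<in> Q"
  shows "averaging_operator \<Q> f x = 1 / measure lebesgue Q * (LINT y|lebesgue_on Q. f y)"
proof -
  have "averaging_operator \<Q> f x = (\<Sum>\<^sub>\<infinity>R\<in>{Q}. (1 / measure lebesgue R * (LINT y|lebesgue_on R. f y)) * indicat_real R x)"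
    unfolding averaging_operator_def
  proof (rule infsum_cong_neutral)
    fix R assume "R \<in> \<Q> - {Q}"
    then have "x \<notin> R" using assms by (auto simp: disjoint_def)
    then show "1 / measure lebesgue R * (LINT y|lebesgue_on R. f y) * indicat_real R x = 0" by simp
  qed (use assms in auto)
  then show ?thesis using assms by simp
qed

lemma averaging_operator_outside:
  assumes "x \<notin> \<Union>\<Q>"
  shows "averaging_operator \<Q> f x = 0"
  unfolding averaging_operator_def using assms by (intro infsum_0) auto

text \<open>Homogeneity lets the operator norm, a supremum over the unit ball, be used for functions
  of any norm.\<close>

lemma averaging_operator_scale:
  "averaging_operator \<Q> (\<lambda>x. c * f x) = (\<lambda>x. c * averaging_operator \<Q> f x)"
  unfolding averaging_operator_def
  by (rule ext) (simp flip: infsum_cmult_right' add: mult_ac)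

section \<open>Basic estimates in X and dominated convergence\<close>

locale muckenhoupt_space = banach_function_space \<Omega> X N
  for \<Omega> :: "(real^'n) set" and X N +
  assumes open_domain: "open \<Omega>"
    and fatou: "fatou_property \<Omega> X N"
    and abs_cont: "absolutely_continuous_norm \<Omega> X N"
    and muckenhoupt: "strong_Muckenhoupt \<Omega> X N"
begin

lemma sets_domain [measurable]: "\<Omega> \<in> sets lebesgue"
  using open_domain by simp

lemma X_measurable [measurable_dest]: "f \<in> X \<Longrightarrow> f \<in> borel_measurable (lebesgue_on \<Omega>)"
  using measurable by blast

lemma X_dominated:
  assumes "f \<in> X" "g \<in> borel_measurable (lebesgue_on \<Omega>)" "AE x in lebesgue_on \<Omega>. \<bar>g x\<bar> \<le> f x"
  shows "g \<in> X" "N g \<le> N f"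
proof -
  have "AE x in lebesgue_on \<Omega>. \<bar>g x\<bar> \<le> \<bar>f x\<bar>" using assms(3) by eventually_elim simp
  then show "g \<in> X" "N g \<le> N f" using ideal[OF assms(1,2)] by simp_all
qed

lemma X_abs: "f \<in> X \<Longrightarrow> (\<lambda>x. \<bar>f x\<bar>) \<in> X" "f \<in> X \<Longrightarrow> N (\<lambda>x. \<bar>f x\<bar>) = N f"
proof -
  assume f: "f \<in> X"
  have m: "(\<lambda>x. \<bar>f x\<bar>) \<in> borel_measurable (lebesgue_on \<Omega>)" using f by measurable
  show *: "(\<lambda>x. \<bar>f x\<bar>) \<in> X" using ideal[OF f m] by simp
  show "N (\<lambda>x. \<bar>f x\<bar>) = N f" using ideal[OF f m] ideal[OF * X_measurable[OF f]] by auto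
qed

lemma X_diff: "f \<in> X \<Longrightarrow> g \<in> X \<Longrightarrow> (\<lambda>x. f x - g x) \<in> X"
  using add[of f "\<lambda>x. -1 * g x"] scale[of g "-1"] by simp

lemma N_diff_triangle:
  assumes "f \<in> X" "g \<in> X" "h \<in> X"
  shows "N (\<lambda>x. f x - h x) \<le> N (\<lambda>x. f x - g x) + N (\<lambda>x. g x - h x)"
  using norm_triangle[OF X_diff[OF assms(1,2)] X_diff[OF assms(2,3)]] by simp

lemma N_diff_commute:
  assumes "f \<in> X" "g \<in> X"
  shows "N (\<lambda>x. f x - g x) = N (\<lambda>x. g x - f x)"
  using norm_scale[OF X_diff[OF assms], of "-1"] by simp

lemma N_zero: "N (\<lambda>x. 0) = 0"
  using norm_eq_0[OF zero] by simp

lemma X_sum: "(\<And>i. i \<in> I \<Longrightarrow> f i \<in> X) \<Longrightarrow> (\<lambda>x. \<Sum>i\<in>I. f i x) \<in> X"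
  by (induction I rule: infinite_finite_induct) (auto simp: zero add)

lemma N_sum: "(\<And>i. i \<in> I \<Longrightarrow> f i \<in> X) \<Longrightarrow> N (\<lambda>x. \<Sum>i\<in>I. f i x) \<le> (\<Sum>i\<in>I. N (f i))"
proof (induction I rule: infinite_finite_induct)
  case (insert i I)
  have "N (\<lambda>x. f i x + (\<Sum>i\<in>I. f i x)) \<le> N (f i) + N (\<lambda>x. \<Sum>i\<in>I. f i x)"
    using insert.prems by (intro norm_triangle X_sum) auto
  with insert show ?case by fastforce
qed (auto simp: N_zero)

lemma X_bounded_mult:
  assumes "f \<in> X" "c \<in> borel_measurable (lebesgue_on \<Omega>)" "\<And>x. x \<in> \<Omega> \<Longrightarrow> \<bar>c x\<bar> \<le> M"
  shows "(\<lambda>x. c x * f x) \<in> X"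
proof -
  have "(\<lambda>x. \<bar>M\<bar> * \<bar>f x\<bar>) \<in> X" using assms X_abs scale by blast
  then show ?thesis
  proof (rule X_dominated)
    show "(\<lambda>x. c x * f x) \<in> borel_measurable (lebesgue_on \<Omega>)" using assms(1,2) by measurable
    show "AE x in lebesgue_on \<Omega>. \<bar>c x * f x\<bar> \<le> \<bar>M\<bar> * \<bar>f x\<bar>"
      using assms(3) by (intro AE_I2) (fastforce simp: abs_mult intro: mult_right_mono)
  qed
qed

text \<open>The Euclidean length lies between the absolute value of each component and the sum of
  all of them. This lets the gradient be treated one component at a time.\<close>

lemma X_norm_vec:
  assumes "\<And>j. (\<lambda>x. G x $ j) \<in> X"
  shows "(\<lambda>x. norm (G x :: real^'m)) \<in> X" "N (\<lambda>x. norm (G x)) \<le> (\<Sum>j\<in>UNIV. N (\<lambda>x. G x $ j))"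
    "N (\<lambda>x. G x $ j) \<le> N (\<lambda>x. norm (G x))"
proof -
  have s: "(\<lambda>x. \<Sum>j\<in>UNIV. \<bar>G x $ j\<bar>) \<in> X" using assms by (intro X_sum X_abs)
  have m: "(\<lambda>x. norm (G x)) \<in> borel_measurable (lebesgue_on \<Omega>)"
    unfolding norm_vec_def L2_set_def using assms[THEN X_measurable] by measurable
  have ae: "AE x in lebesgue_on \<Omega>. \<bar>norm (G x)\<bar> \<le> (\<Sum>j\<in>UNIV. \<bar>G x $ j\<bar>)"
    by (simp add: norm_le_l1_cart)
  show n: "(\<lambda>x. norm (G x)) \<in> X" by (rule X_dominated[OF s m ae])
  have "N (\<lambda>x. norm (G x)) \<le> N (\<lambda>x. \<Sum>j\<in>UNIV. \<bar>G x $ j\<bar>)" by (rule X_dominated[OF s m ae])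
  also have "\<dots> \<le> (\<Sum>j\<in>UNIV. N (\<lambda>x. \<bar>G x $ j\<bar>))" using assms by (intro N_sum X_abs)
  finally show "N (\<lambda>x. norm (G x)) \<le> (\<Sum>j\<in>UNIV. N (\<lambda>x. G x $ j))" using assms by (simp add: X_abs)
  show "N (\<lambda>x. G x $ j) \<le> N (\<lambda>x. norm (G x))"
    by (rule X_dominated[OF n X_measurable[OF assms]]) (simp add: component_le_norm_cart)
qed

text \<open>Where all later \<open>\<bar>h j x\<bar>\<close> stay below \<open>e * w x\<close> the
  contribution to the norm is small. The exceptional sets decrease to a null set, and there the
  absolute continuity of the norm, applied to w, takes over.\<close>

lemma dominated_convergence_X:
  fixes h :: "nat \<Rightarrow> real^'n \<Rightarrow> real"
  assumes w: "w \<in> X" and h: "\<And>k. h k \<in> borel_measurable (lebesgue_on \<Omega>)"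
    and dom: "\<And>k. AE x in lebesgue_on \<Omega>. \<bar>h k x\<bar> \<le> w x"
    and lim: "AE x in lebesgue_on \<Omega>. (\<lambda>k. h k x) \<longlonglongrightarrow> 0"
  shows "(\<lambda>k. N (h k)) \<longlonglongrightarrow> 0"
proof (rule LIMSEQ_I)
  fix r :: real assume r: "r > 0"
  have hX: "h k \<in> X" for k by (rule X_dominated(1)[OF w h dom])
  \<comment> \<open>The summand 1 keeps e positive when \<open>N w = 0\<close>.\<close>
  define e where "e = r / (2 * (N w + 1))"
  have Nw: "N w \<ge> 0" using w norm_nonneg by blast
  have e: "e > 0" "e * N w < r / 2" using r Nw
    by (simp_all add: e_def field_simps)
  \<comment> \<open>The threshold is relative to w: a constant need not belong to X, while
    \<open>e * w x\<close> does, with norm \<open>e * N w\<close>.\<close>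
  define E where "E k = {x \<in> \<Omega>. \<exists>j\<ge>k. e * w x < \<bar>h j x\<bar>}" for k
  \<comment> \<open>Absolute continuity asks for an empty intersection, but the sets
    \<open>E k\<close> shrink only to the null set Z, so Z is removed from each of them.\<close>
  define Z where "Z = (\<Inter>k. E k)"
  have mE: "E k \<in> sets lebesgue" for k
  proof -
    have "{x \<in> space (lebesgue_on \<Omega>). \<exists>j\<in>{k..}. e * w x < \<bar>h j x\<bar>} \<in> sets (lebesgue_on \<Omega>)"
      using h w by measurable
    moreover have "{x \<in> space (lebesgue_on \<Omega>). \<exists>j\<in>{k..}. e * w x < \<bar>h j x\<bar>} = E k"
      by (auto simp: E_def)
    ultimately show ?thesis by (simp add: sets_restrict_space_iff)
  qed
  have EO: "E k \<subseteq> \<Omega>" for k by (auto simp: E_def)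
  have mZ: "Z \<in> sets lebesgue" unfolding Z_def using mE by auto
  have decE: "decseq E" by (rule decseq_SucI) (auto simp: E_def Suc_le_eq intro: less_imp_le)
  have aeZ: "AE x in lebesgue_on \<Omega>. x \<notin> Z"
  proof -
    have "AE x in lebesgue_on \<Omega>. \<forall>k. \<bar>h k x\<bar> \<le> w x" using dom by (simp add: AE_all_countable)
    with lim show ?thesis
    proof eventually_elim
      case (elim x)
      show "x \<notin> Z"
      proof (cases "w x > 0")
        case True
        then have "e * w x > 0" using e by simp
        with elim(1) obtain k where "\<forall>j\<ge>k. \<bar>h j x\<bar> < e * w x"
          using LIMSEQ_D[of "\<lambda>k. h k x" 0 "e * w x"] by auto
        then have "x \<notin> E k" by (force simp: E_def)
        then show ?thesis by (auto simp: Z_def)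
      next
        case False
        \<comment> \<open>Where w vanishes so do all \<open>h j\<close>, and the strict inequality
          in E excludes the point.\<close>
        with elim(2) have "w x = 0" "\<And>j. h j x = 0"
          by (metis abs_ge_zero less_le order_trans, metis abs_le_zero_iff linorder_not_less order_trans)
        then have "x \<notin> E 0" by (auto simp: E_def)
        then show ?thesis by (auto simp: Z_def)
      qed
    qed
  qed
  have "(\<lambda>k. N (\<lambda>x. w x * indicat_real (E k - Z) x)) \<longlonglongrightarrow> 0"
  proof -
    have "decseq (\<lambda>k. E k - Z)" using decE unfolding decseq_def by blast
    moreover have "\<forall>k. E k - Z \<in> sets lebesgue \<and> E k - Z \<subseteq> \<Omega>"
      using sets.Diff[OF mE mZ] EO by blast
    moreover have "(\<Inter>k. E k - Z) = {}" by (auto simp: Z_def)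
    ultimately show ?thesis
      using abs_cont[unfolded absolutely_continuous_norm_def, rule_format, OF w, of "\<lambda>k. E k - Z"] by simp
  qed
  then obtain k0 where k0: "\<And>k. k \<ge> k0 \<Longrightarrow> N (\<lambda>x. w x * indicat_real (E k - Z) x) < r / 2"
    using LIMSEQ_D[of "\<lambda>k. N (\<lambda>x. w x * indicat_real (E k - Z) x)" 0 "r/2"] r by fastforce
  have "norm (N (h k) - 0) < r" if "k \<ge> k0" for k
  proof -
    have m: "indicat_real (E k - Z) \<in> borel_measurable (lebesgue_on \<Omega>)"
      using sets.Diff[OF mE mZ] EO by (intro borel_measurable_indicator) (auto simp: sets_restrict_space_iff)
    have wX: "(\<lambda>x. w x * indicat_real (E k - Z) x) \<in> X"
      using X_bounded_mult[OF w m, of 1] by (simp add: mult.commute indicator_def)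
    have "AE x in lebesgue_on \<Omega>. \<bar>h k x\<bar> \<le> e * w x + w x * indicat_real (E k - Z) x"
      using dom[of k] aeZ AE_space
    proof eventually_elim
      case (elim x)
      then have "w x \<ge> 0" using abs_ge_zero order_trans by blast
      show ?case
      proof (cases "x \<in> E k")
        case True
        moreover have "0 \<le> e * w x" using e \<open>w x \<ge> 0\<close> by simp
        ultimately show ?thesis using elim by simp
      next
        case False
        then show ?thesis using elim by (auto simp: E_def not_less indicator_def)
      qed
    qed
    then have "N (h k) \<le> N (\<lambda>x. e * w x + w x * indicat_real (E k - Z) x)"
      by (intro X_dominated[OF add[OF scale[OF w] wX] h])
    also have "\<dots> \<le> N (\<lambda>x. e * w x) + N (\<lambda>x. w x * indicat_real (E k - Z) x)"
      by (intro norm_triangle scale w wX)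
    also have "\<dots> < r / 2 + r / 2"
      using norm_scale[OF w, of e] e k0[OF that] by simp
    finally show ?thesis using norm_nonneg[OF hX] by simp
  qed
  then show "\<exists>no. \<forall>n\<ge>no. norm (N (h n) - 0) < r" by blast
qed

section \<open>Boundedness of averages and local integrability of members of X\<close>

definition "averaging_bound = enn2real (strong_Muckenhoupt_constant \<Omega> X N)"

lemma averaging_bound_nonneg: "averaging_bound \<ge> 0" by (simp add: averaging_bound_def)

lemma averaging_operator_bounded:
  assumes F: "\<Q> \<in> disjoint_cube_families \<Omega>" and f: "f \<in> X"
  shows "averaging_operator \<Q> f \<in> X" "N (averaging_operator \<Q> f) \<le> averaging_bound * N f"
proof -
  have fin: "strong_Muckenhoupt_constant \<Omega> X N < \<infinity>" using muckenhoupt by (simp add: strong_Muckenhoupt_def)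
  have *: "averaging_operator \<Q> g \<in> X \<and> N (averaging_operator \<Q> g) \<le> averaging_bound" if "g \<in> X" "N g \<le> 1" for g
  proof -
    have "extended_norm X N (averaging_operator \<Q> g) \<le> operator_norm X N (averaging_operator \<Q>)"
      unfolding operator_norm_def by (rule SUP_upper) (use that in auto)
    also have "\<dots> \<le> strong_Muckenhoupt_constant \<Omega> X N"
      unfolding strong_Muckenhoupt_constant_def by (rule SUP_upper) (rule F)
    \<comment> \<open>Finiteness matters: \<open>enn2real\<close> would send an infinite constant to
      0. As \<open>extended_norm\<close> is infinite outside X, the bound also contains the
      membership in X.\<close>
    also have "\<dots> = ennreal averaging_bound" using fin by (simp add: averaging_bound_def)
    finally show ?thesis using averaging_bound_nonneg
      by (auto simp: extended_norm_def top_unique split: if_splits)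
  qed
  have Nf: "N f \<ge> 0" using norm_nonneg f by blast
  \<comment> \<open>Normalising by \<open>N f + d\<close> with d > 0 covers the case
    \<open>N f = 0\<close> too; d tends to 0 at the end.\<close>
  have main: "averaging_operator \<Q> f \<in> X \<and> N (averaging_operator \<Q> f) \<le> averaging_bound * (N f + d)" if "d > 0" for d
  proof -
    let ?c = "N f + d"
    have c: "?c > 0" using Nf that by simp
    have "N (\<lambda>x. (1 / ?c) * f x) \<le> 1" unfolding norm_scale[OF f] using Nf that by simp
    from *[OF scale[OF f] this] have A: "(\<lambda>x. (1 / ?c) * averaging_operator \<Q> f x) \<in> X"
      "N (\<lambda>x. (1 / ?c) * averaging_operator \<Q> f x) \<le> averaging_bound"
      by (simp_all only: averaging_operator_scale)
    from scale[OF A(1), of ?c] have X: "averaging_operator \<Q> f \<in> X" using c by simp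
    from A(2) norm_scale[OF X, of "1 / ?c"] have "1 / ?c * N (averaging_operator \<Q> f) \<le> averaging_bound" using c by simp
    then show ?thesis using X c by (simp add: field_simps)
  qed
  show "averaging_operator \<Q> f \<in> X" using main[of 1] by simp
  have "((\<lambda>d. averaging_bound * (N f + d)) \<longlongrightarrow> averaging_bound * (N f + 0)) (at_right 0)" by (intro tendsto_intros)
  moreover have "\<forall>\<^sub>F d in at_right 0. N (averaging_operator \<Q> f) \<le> averaging_bound * (N f + d)"
    using main by (intro eventually_mono[OF eventually_at_right_less]) blast
  ultimately show "N (averaging_operator \<Q> f) \<le> averaging_bound * N f"
    using tendsto_lowerbound[of "\<lambda>d. averaging_bound * (N f + d)" "averaging_bound * N f" "at_right 0"] by simp
qed

lemma cube_indicator: "is_cube Q \<Longrightarrow> Q \<subseteq> \<Omega> \<Longrightarrow> indicat_real Q \<in> X"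
  using muckenhoupt by (simp add: strong_Muckenhoupt_def)

lemma cube_integrable:
  assumes "is_cube Q" "Q \<subseteq> \<Omega>" "f \<in> X"
  shows "integrable lebesgue (\<lambda>x. indicat_real Q x * f x)"
proof -
  have "integrable (lebesgue_on \<Omega>) (\<lambda>x. f x * indicat_real Q x)"
    using assms muckenhoupt by (auto simp: strong_Muckenhoupt_def associate_space_def)
  then have "integrable lebesgue (\<lambda>x. indicat_real \<Omega> x * (f x * indicat_real Q x))"
    by (simp add: integrable_restrict_space)
  also have "(\<lambda>x. indicat_real \<Omega> x * (f x * indicat_real Q x)) = (\<lambda>x. indicat_real Q x * f x)"
    using assms by (auto simp: indicator_def fun_eq_iff)
  finally show ?thesis .
qed

text \<open>On the family \<open>{Q}\<close> the operator returns the mean of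
  \<open>\<bar>f x\<bar>\<close> over Q times \<open>indicat_real Q\<close>, so by homogeneity its
  norm displays the integral; solving for the integral gives the constant.\<close>

lemma cube_bound:
  assumes Q: "is_cube Q" "Q \<subseteq> \<Omega>"
  obtains C where "C \<ge> 0" "\<And>f. f \<in> X \<Longrightarrow> (LINT x|lebesgue. indicat_real Q x * \<bar>f x\<bar>) \<le> C * N f"
proof -
  have F: "{Q} \<in> disjoint_cube_families \<Omega>" using Q by (simp add: disjoint_cube_families_def)
  note X = cube_indicator[OF Q]
  \<comment> \<open>The constant divides by this norm, which could vanish only if Q were a null
    set.\<close>
  have "N (indicat_real Q) \<noteq> 0"
  proof
    assume "N (indicat_real Q) = 0"
    then have "AE x in lebesgue_on \<Omega>. indicat_real Q x = 0" using norm_eq_0[OF X] by simp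
    then have "AE x in lebesgue. x \<notin> Q"
      using Q by (auto simp: AE_restrict_space_iff indicator_def elim!: AE_mp)
    then have "emeasure lebesgue Q = 0"
      using is_cube_lebesgue[OF Q(1)] by (simp add: AE_iff_measurable[of Q])
    then show False using is_cube_measure_pos[OF Q(1)] by (simp add: measure_def)
  qed
  then have NQ: "N (indicat_real Q) > 0" using norm_nonneg[OF X] by simp
  have mQ: "measure lebesgue Q > 0" using is_cube_measure_pos Q by blast
  show thesis
  proof (rule that[of "measure lebesgue Q * averaging_bound / N (indicat_real Q)"])
    show "measure lebesgue Q * averaging_bound / N (indicat_real Q) \<ge> 0" using NQ averaging_bound_nonneg by simp
    fix f assume f: "f \<in> X"
    let ?I = "LINT x|lebesgue. indicat_real Q x * \<bar>f x\<bar>"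
    have I: "(LINT y|lebesgue_on Q. \<bar>f y\<bar>) = ?I"
      using is_cube_lebesgue[OF Q(1)] by (subst integral_restrict_space) auto
    have "averaging_operator {Q} (\<lambda>x. \<bar>f x\<bar>) = (\<lambda>x. (?I / measure lebesgue Q) * indicat_real Q x)"
      using averaging_operator_at[of "{Q}" Q _ "\<lambda>x. \<bar>f x\<bar>"] averaging_operator_outside[of _ "{Q}"]
      by (auto simp: fun_eq_iff I indicator_def)
    then have "N (\<lambda>x. (?I / measure lebesgue Q) * indicat_real Q x) \<le> averaging_bound * N f"
      using averaging_operator_bounded[OF F X_abs(1)[OF f]] X_abs[OF f] by simp
    then have "\<bar>?I / measure lebesgue Q\<bar> * N (indicat_real Q) \<le> averaging_bound * N f"
      using norm_scale[OF X, of "?I / measure lebesgue Q"] by simp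
    moreover have "?I \<ge> 0" by simp
    ultimately show "?I \<le> measure lebesgue Q * averaging_bound / N (indicat_real Q) * N f"
      using NQ mQ by (simp add: field_simps)
  qed
qed

text \<open>These indicators become the dominating functions in X for bounded functions supported in
  a compact subset of \<Omega>.\<close>

lemma compact_indicator:
  assumes "compact K" "K \<subseteq> \<Omega>"
  shows "indicat_real K \<in> X"
proof -
  obtain \<Q> where Q: "finite \<Q>" "\<And>Q. Q \<in> \<Q> \<Longrightarrow> is_cube Q \<and> Q \<subseteq> \<Omega>" "K \<subseteq> \<Union>\<Q>"
    using compact_cube_cover[OF assms(1) open_domain assms(2)] by metis
  have "(\<lambda>x. \<Sum>Q\<in>\<Q>. indicat_real Q x) \<in> X" using Q cube_indicator by (intro X_sum) auto
  then show ?thesis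
  proof (rule X_dominated(1))
    show "indicat_real K \<in> borel_measurable (lebesgue_on \<Omega>)"
      using assms by (intro borel_measurable_indicator) (auto simp: sets_restrict_space_iff intro: lmeasurable_compact fmeasurableD)
    show "AE x in lebesgue_on \<Omega>. \<bar>indicat_real K x\<bar> \<le> (\<Sum>Q\<in>\<Q>. indicat_real Q x)"
    proof (rule AE_I2)
      fix x
      show "\<bar>indicat_real K x\<bar> \<le> (\<Sum>Q\<in>\<Q>. indicat_real Q x)"
      proof (cases "x \<in> K")
        case True
        then obtain Q where "Q \<in> \<Q>" "x \<in> Q" using Q by blast
        then show ?thesis using member_le_sum[of Q \<Q> "\<lambda>Q. indicat_real Q x"] Q(1) True by simp
      qed (simp add: sum_nonneg)
    qed
  qed
qed

text \<open>Summing \<open>cube_bound\<close> over a finite cover embeds X continuously into the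
  integrable functions on K, which lets integrals against test functions pass to limits in
  norm.\<close>

lemma compact_bound:
  assumes K: "compact K" "K \<subseteq> \<Omega>"
  obtains C where "C \<ge> 0" "\<And>f. f \<in> X \<Longrightarrow> integrable lebesgue (\<lambda>x. indicat_real K x * f x)"
    "\<And>f. f \<in> X \<Longrightarrow> (LINT x|lebesgue. indicat_real K x * \<bar>f x\<bar>) \<le> C * N f"
proof -
  obtain \<Q> where Q: "finite \<Q>" "\<And>Q. Q \<in> \<Q> \<Longrightarrow> is_cube Q \<and> Q \<subseteq> \<Omega>" "K \<subseteq> \<Union>\<Q>"
    using compact_cube_cover[OF assms(1) open_domain assms(2)] by metis
  have "\<exists>C\<ge>0. \<forall>f\<in>X. (LINT x|lebesgue. indicat_real Q x * \<bar>f x\<bar>) \<le> C * N f" if "Q \<in> \<Q>" for Q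
    using cube_bound[of Q] Q(2)[OF that] by metis
  then obtain C where C: "\<And>Q. Q \<in> \<Q> \<Longrightarrow> C Q \<ge> 0"
    "\<And>Q f. Q \<in> \<Q> \<Longrightarrow> f \<in> X \<Longrightarrow> (LINT x|lebesgue. indicat_real Q x * \<bar>f x\<bar>) \<le> C Q * N f" by metis
  have mK: "K \<in> sets lebesgue" using K by (auto intro: lmeasurable_compact fmeasurableD)
  have le: "indicat_real K x * \<bar>f x\<bar> \<le> (\<Sum>Q\<in>\<Q>. indicat_real Q x * \<bar>f x\<bar>)" for x and f :: "real^'n \<Rightarrow> real"
  proof (cases "x \<in> K")
    case True
    then obtain Q where "Q \<in> \<Q>" "x \<in> Q" using Q by blast
    then show ?thesis using member_le_sum[of Q \<Q> "\<lambda>Q. indicat_real Q x * \<bar>f x\<bar>"] Q(1) True by simp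
  qed (simp add: sum_nonneg)
  have int: "integrable lebesgue (\<lambda>x. \<Sum>Q\<in>\<Q>. indicat_real Q x * \<bar>f x\<bar>)" if "f \<in> X" for f
    using cube_integrable[OF _ _ X_abs(1)[OF that]] Q(2) by auto
  have intK: "integrable lebesgue (\<lambda>x. indicat_real K x * f x)" if f: "f \<in> X" for f
  proof (rule Bochner_Integration.integrable_bound[OF int[OF f]])
    \<comment> \<open>The values of f outside \<Omega> are arbitrary, so measurability on the whole
      space is taken from the extension by 0, which agrees with f on K.\<close>
    have "(\<lambda>x. indicat_real K x * f x) = (\<lambda>x. indicat_real K x * (if x \<in> \<Omega> then f x else 0))"
      using K by (auto simp: fun_eq_iff indicator_def)
    moreover have "(\<lambda>x. if x \<in> \<Omega> then f x else 0) \<in> borel_measurable lebesgue"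
      using X_measurable[OF f] by (simp add: borel_measurable_if)
    ultimately show "(\<lambda>x. indicat_real K x * f x) \<in> borel_measurable lebesgue" using mK by simp
    show "AE x in lebesgue. norm (indicat_real K x * f x) \<le> norm (\<Sum>Q\<in>\<Q>. indicat_real Q x * \<bar>f x\<bar>)"
      using le[of _ f] by (intro AE_I2) (simp add: abs_mult order_trans[OF _ abs_ge_self])
  qed
  show thesis
  proof (rule that[of "\<Sum>Q\<in>\<Q>. C Q"])
    show "0 \<le> (\<Sum>Q\<in>\<Q>. C Q)" using C by (intro sum_nonneg) auto
    fix f assume f: "f \<in> X"
    have "(LINT x|lebesgue. indicat_real K x * \<bar>f x\<bar>) \<le> (LINT x|lebesgue. (\<Sum>Q\<in>\<Q>. indicat_real Q x * \<bar>f x\<bar>))"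
      by (intro integral_mono intK X_abs f int le)
    also have "\<dots> = (\<Sum>Q\<in>\<Q>. (LINT x|lebesgue. indicat_real Q x * \<bar>f x\<bar>))"
      using cube_integrable[OF _ _ X_abs(1)[OF f]] Q(2) by (intro Bochner_Integration.integral_sum) auto
    also have "\<dots> \<le> (\<Sum>Q\<in>\<Q>. C Q * N f)" using C f by (intro sum_mono) auto
    finally show "(LINT x|lebesgue. indicat_real K x * \<bar>f x\<bar>) \<le> (\<Sum>Q\<in>\<Q>. C Q) * N f"
      by (simp add: sum_distrib_right)
  qed (rule intK)
qed

lemma X_subset_L1_loc: "X \<subseteq> L1_loc \<Omega>"
proof
  fix f assume f: "f \<in> X"
  have "integrable (lebesgue_on K) f" if K: "compact K" "K \<subseteq> \<Omega>" for K
  proof -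
    have "K \<in> sets lebesgue" using K by (auto intro: lmeasurable_compact fmeasurableD)
    then show ?thesis using compact_bound[OF K] f by (auto simp: integrable_lebesgue_on)
  qed
  then show "f \<in> L1_loc \<Omega>" using X_measurable[OF f] by (simp add: L1_loc_def)
qed

end

section \<open>Mollification by a tent function\<close>

text \<open>Inherited from \<open>lborel\<close>, since completion keeps the measure of Borel sets.
  It makes Fubini available for functions that are merely Lebesgue measurable.\<close>

lemma sigma_finite_lebesgue: "sigma_finite_measure (lebesgue :: 'a::euclidean_space measure)"
proof
  obtain A :: "'a set set" where A: "countable A" "A \<subseteq> sets lborel" "\<Union>A = space lborel" "\<forall>a\<in>A. emeasure lborel a \<noteq> \<infinity>"
    using lborel.sigma_finite_countable by blast
  then show "\<exists>A::'a set set. countable A \<and> A \<subseteq> sets lebesgue \<and> \<Union> A = space lebesgue \<and> (\<forall>a\<in>A. emeasure lebesgue a \<noteq> \<infinity>)"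
    by (intro exI[of _ A]) (auto simp: emeasure_completion)
qed

lemma pair_sigma_finite_lebesgue:
  "pair_sigma_finite (lebesgue :: 'a::euclidean_space measure) (lebesgue :: 'b::euclidean_space measure)"
  by (intro pair_sigma_finite.intro sigma_finite_lebesgue)

text \<open>Translation invariance is transported from \<open>lborel\<close>, hence Borel g. The
  integrands to which it is applied are continuous up to constant factors.\<close>

lemma integral_translate:
  fixes g :: "'a::euclidean_space \<Rightarrow> real"
  assumes [measurable]: "g \<in> borel_measurable borel"
  shows "(LINT x|lebesgue. g (x + a)) = (LINT x|lebesgue. g x)"
    and "integrable lebesgue (\<lambda>x. g (x + a)) \<longleftrightarrow> integrable lebesgue g"
proof -
  have eq: "distr lborel borel (\<lambda>x. x + a) = (lborel :: 'a measure)"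
    using lborel_distr_plus[of a] by (simp only: add.commute[of _ a])
  have "(LINT x|lborel. g (x + a)) = (LINT x|distr lborel borel (\<lambda>x. x + a). g x)"
    by (subst integral_distr) auto
  then show "(LINT x|lebesgue. g (x + a)) = (LINT x|lebesgue. g x)"
    by (simp add: eq integral_completion)
  have "integrable (distr lborel borel (\<lambda>x. x + a)) g \<longleftrightarrow> integrable lborel (\<lambda>x. g (x + a))"
    by (subst integrable_distr_eq) auto
  then show "integrable lebesgue (\<lambda>x. g (x + a)) \<longleftrightarrow> integrable lebesgue g"
    by (simp add: eq integrable_completion)
qed

lemma continuous_lebesgue_measurable:
  fixes g :: "'a::euclidean_space \<Rightarrow> real"
  shows "continuous_on UNIV g \<Longrightarrow> g \<in> borel_measurable lebesgue"
  using borel_measurable_continuous_onI by (intro measurable_completion) simp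

lemma integrable_bounded_mult:
  fixes f c :: "'a::euclidean_space \<Rightarrow> real"
  assumes "integrable lebesgue f" "c \<in> borel_measurable lebesgue" "\<And>x. \<bar>c x\<bar> \<le> M"
  shows "integrable lebesgue (\<lambda>x. c x * f x)"
proof (rule Bochner_Integration.integrable_bound)
  show "integrable lebesgue (\<lambda>x. M * f x)" using assms by simp
  have "M \<ge> 0" using assms(3)[of undefined] by linarith
  then show "AE x in lebesgue. norm (c x * f x) \<le> norm (M * f x)"
    using assms(3) by (intro AE_I2) (auto simp: abs_mult intro: mult_right_mono)
  show "(\<lambda>x. c x * f x) \<in> borel_measurable lebesgue" using assms by auto
qed

text \<open>Supplies the dominating functions for the two applications of Fubini in
  \<open>mollify_duality\<close>.\<close>

lemma integrable_lebesgue_product: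
  fixes a :: "'a::euclidean_space \<Rightarrow> real" and b :: "'b::euclidean_space \<Rightarrow> real"
  assumes a: "integrable lebesgue a" and b: "integrable lebesgue b"
  shows "integrable (lebesgue \<Otimes>\<^sub>M lebesgue) (\<lambda>(x, y). a x * b y)"
proof -
  interpret pair_sigma_finite "lebesgue :: 'a measure" "lebesgue :: 'b measure"
    by (rule pair_sigma_finite_lebesgue)
  have [measurable]: "a \<in> borel_measurable lebesgue" "b \<in> borel_measurable lebesgue" using a b by auto
  show ?thesis
  proof (rule Fubini_integrable)
    show "(\<lambda>(x, y). a x * b y) \<in> borel_measurable (lebesgue \<Otimes>\<^sub>M lebesgue)" by measurable
    show "integrable lebesgue (\<lambda>x. LINT y|lebesgue. norm (case (x, y) of (x, y) \<Rightarrow> a x * b y))"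
      using a by (simp add: abs_mult)
    show "AE x in lebesgue. integrable lebesgue (\<lambda>y. case (x, y) of (x, y) \<Rightarrow> a x * b y)"
      using b by simp
  qed
qed

section \<open>The tent kernel and its convolutions\<close>

definition tent :: "real \<Rightarrow> real^'n \<Rightarrow> real" where
  "tent e y = max 0 (1 - norm y / e)"

definition mollifier :: "real \<Rightarrow> real^'n \<Rightarrow> real" where
  "mollifier e y = tent e y / (LINT z|lebesgue. tent e (z :: real^'n))"

text \<open>The integral runs over the whole space. The functions mollified below in X vanish
  outside a compact subset of \<Omega>, so the arbitrary values of representatives outside \<Omega>
  do not enter.\<close>

definition mollify :: "real \<Rightarrow> (real^'n \<Rightarrow> real) \<Rightarrow> real^'n \<Rightarrow> real" where
  "mollify e f x = (LINT y|lebesgue. mollifier e (x - y) * f y)"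

lemma norm_le_card_mult:
  fixes y :: "real^'n"
  assumes "\<And>i. \<bar>y $ i\<bar> \<le> l"
  shows "norm y \<le> real CARD('n) * l"
proof -
  have "norm y \<le> (\<Sum>i\<in>UNIV. \<bar>y $ i\<bar>)" by (rule norm_le_l1_cart)
  also have "\<dots> \<le> (\<Sum>i\<in>(UNIV::'n set). l)" by (intro sum_mono assms)
  finally show ?thesis by simp
qed

lemma tent_nonneg: "tent e y \<ge> 0" by (simp add: tent_def)

context
  fixes e :: real
  assumes e: "e > 0"
begin

lemma tent_le: "tent e y \<le> indicat_real (cball 0 e) y"
  using e by (auto simp: tent_def indicator_def field_simps)

lemma tent_lipschitz: "\<bar>tent e x - tent e y\<bar> \<le> 1 / e * norm (x - y)"
proof -
  have "\<bar>tent e x - tent e y\<bar> \<le> \<bar>norm x / e - norm y / e\<bar>" by (auto simp: tent_def)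
  also have "\<dots> = \<bar>norm x - norm y\<bar> / e" using e by (simp flip: diff_divide_distrib)
  also have "\<dots> \<le> norm (x - y) / e" using e by (intro divide_right_mono norm_triangle_ineq3) auto
  finally show ?thesis by simp
qed

lemma tent_continuous: "continuous_on UNIV (tent e)"
  unfolding tent_def[abs_def] using e by (intro continuous_intros) auto

lemma tent_integrable: "integrable lebesgue (tent e :: real^'n \<Rightarrow> real)"
proof (rule Bochner_Integration.integrable_bound)
  show "integrable lebesgue (indicat_real (cball (0::real^'n) e))"
    by (intro integrable_real_indicator) (auto intro: emeasure_bounded_finite[unfolded infinity_ennreal_def])
  show "tent e \<in> borel_measurable lebesgue" by (intro continuous_lebesgue_measurable tent_continuous)
  show "AE x in lebesgue. norm (tent e x) \<le> norm (indicat_real (cball 0 e) x)"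
    by (intro AE_I2) (simp add: tent_le tent_nonneg)
qed

text \<open>On the cube of half-side e / (2n), which lies in the ball of radius e / 2, the tent is
  at least 1 / 2. What matters is the order e^n of the bound.\<close>

lemma tent_integral_ge: "(e / real CARD('n)) ^ CARD('n) / 2 \<le> (LINT z|lebesgue. tent e (z :: real^'n))"
proof -
  define l where "l = e / (2 * real CARD('n))"
  have l: "l > 0" using e by (simp add: l_def)
  let ?Q = "cbox (- (\<chi> i. l)) (- (\<chi> i. l) + (\<chi> i. 2 * l)) :: (real^'n) set"
  have "(e / real CARD('n)) ^ CARD('n) / 2 = measure lebesgue ?Q * (1 / 2)"
    using l by (subst measure_lebesgue_cube) (auto simp: l_def)
  also have "\<dots> = (LINT z|lebesgue. indicat_real ?Q z * (1 / 2))"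
    by (subst integral_mult_left_zero) simp
  also have "\<dots> \<le> (LINT z|lebesgue. tent e (z :: real^'n))"
  proof (rule Bochner_Integration.integral_mono[OF _ tent_integrable])
    show "integrable lebesgue (\<lambda>z. indicat_real ?Q z * (1 / 2))"
      by (intro integrable_mult_left integrable_real_indicator) (auto simp: emeasure_lborel_cbox_eq)
    fix z :: "real^'n"
    show "indicat_real ?Q z * (1 / 2) \<le> tent e z"
    proof (cases "z \<in> ?Q")
      case True
      have "norm z \<le> real CARD('n) * l"
        using True by (intro norm_le_card_mult abs_leI) (auto simp: mem_box_cart minus_le_iff)
      also have "\<dots> = e / 2" by (simp add: l_def)
      finally show ?thesis using e by (simp add: tent_def field_simps indicator_def)
    qed (simp add: tent_nonneg)
  qed
  finally show ?thesis .
qed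

lemma tent_integral_pos: "0 < (LINT z|lebesgue. tent e (z :: real^'n))"
  using tent_integral_ge e by (smt (verit) divide_pos_pos of_nat_0_less_iff zero_less_card_finite zero_less_power)

lemma mollifier_nonneg: "mollifier e y \<ge> 0"
  by (simp add: mollifier_def tent_nonneg less_imp_le[OF tent_integral_pos])

text \<open>The tent is at most 1 and its integral is at least of order e^n. The resulting order
  e^(-n) is the reciprocal volume of a cube of side comparable to e, so averages over such cubes can
  dominate the mollification.\<close>

lemma mollifier_le: "mollifier e (y :: real^'n) \<le> 2 * (real CARD('n) / e) ^ CARD('n)"
proof -
  have "mollifier e y \<le> 1 / (LINT z|lebesgue. tent e (z :: real^'n))"
    using tent_integral_pos[where 'n='n] e unfolding mollifier_def by (intro divide_right_mono) (auto simp: tent_def less_imp_le)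
  also have "\<dots> \<le> 1 / ((e / real CARD('n)) ^ CARD('n) / 2)"
    using e by (intro divide_left_mono tent_integral_ge mult_pos_pos tent_integral_pos) auto
  finally show ?thesis using e by (simp add: power_divide field_simps)
qed

lemma mollifier_outside: "norm y \<ge> e \<Longrightarrow> mollifier e y = 0"
  using e by (simp add: mollifier_def tent_def max_def)

lemma mollifier_minus: "mollifier e (- y) = mollifier e y"
  by (simp add: mollifier_def tent_def)

lemma mollifier_continuous: "continuous_on UNIV (mollifier e)"
  unfolding mollifier_def[abs_def]
  by (intro continuous_intros tent_continuous) (simp add: less_imp_neq[OF tent_integral_pos, symmetric])

lemma mollifier_borel [measurable]: "mollifier e \<in> borel_measurable borel"
  using mollifier_continuous by (rule borel_measurable_continuous_onI)

lemma mollifier_integrable: "integrable lebesgue (mollifier e :: real^'n \<Rightarrow> real)"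
  unfolding mollifier_def[abs_def] by (intro integrable_divide_zero tent_integrable)

lemma mollifier_integral: "(LINT y|lebesgue. mollifier e (y :: real^'n)) = 1"
  unfolding mollifier_def[abs_def] using tent_integral_pos[where 'n='n] by simp

text \<open>Evenness turns the reflected kernel into a translate, to which translation invariance
  applies.\<close>

lemma mollifier_shift_integrable: "integrable lebesgue (\<lambda>y. mollifier e (x - y :: real^'n))"
  and mollifier_shift_integral: "(LINT y|lebesgue. mollifier e (x - y :: real^'n)) = 1"
proof -
  have *: "mollifier e (x - y) = mollifier e (y + (- x))" for y using mollifier_minus[of "y - x"] by simp
  show "integrable lebesgue (\<lambda>y. mollifier e (x - y :: real^'n))"
    unfolding * by (subst integral_translate(2)) (auto simp: mollifier_integrable)
  show "(LINT y|lebesgue. mollifier e (x - y :: real^'n)) = 1"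
    unfolding * by (subst integral_translate(1)) (auto simp: mollifier_integral)
qed

lemma mollifier_shift_measurable: "(\<lambda>y. mollifier e (x - y :: real^'n)) \<in> borel_measurable lebesgue"
  using mollifier_shift_integrable by auto

lemma mollifier_abs: "\<bar>mollifier e y\<bar> = mollifier e y"
  by (simp add: mollifier_nonneg)

lemma mollify_integrable:
  assumes "integrable lebesgue f"
  shows "integrable lebesgue (\<lambda>y. mollifier e (x - y :: real^'n) * f y)"
  by (rule integrable_bounded_mult[OF assms mollifier_shift_measurable]) (unfold mollifier_abs, rule mollifier_le)

text \<open>The Lipschitz constant of the kernel passes to the convolution, with the L^1 norm of f
  as a factor. It may blow up as e tends to 0, which is harmless: each approximant only has to be
  Lipschitz by itself.\<close>

lemma mollify_lipschitz:
  assumes f: "integrable lebesgue (f :: real^'n \<Rightarrow> real)"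
  obtains L where "L-lipschitz_on UNIV (mollify e f)"
proof
  define c where "c = (LINT z|lebesgue. tent e (z :: real^'n))"
  have c: "c > 0" unfolding c_def by (rule tent_integral_pos)
  define I where "I = (LINT y|lebesgue. \<bar>f y\<bar>)"
  have lip: "\<bar>mollifier e x - mollifier e y\<bar> \<le> 1 / (e * c) * norm (x - y)" for x y :: "real^'n"
  proof -
    have "\<bar>mollifier e x - mollifier e y\<bar> = \<bar>tent e x - tent e y\<bar> / c"
      using c by (simp add: mollifier_def flip: c_def diff_divide_distrib)
    also have "\<dots> \<le> (1 / e * norm (x - y)) / c" using c by (intro divide_right_mono tent_lipschitz) auto
    finally show ?thesis by simp
  qed
  show "(1 / (e * c) * I)-lipschitz_on UNIV (mollify e f)"
  proof (rule lipschitz_onI)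
    show "0 \<le> 1 / (e * c) * I" using e c by (simp add: I_def)
    fix x x' :: "real^'n"
    have "mollify e f x - mollify e f x' = (LINT y|lebesgue. mollifier e (x - y) * f y - mollifier e (x' - y) * f y)"
      unfolding mollify_def using f by (intro Bochner_Integration.integral_diff[symmetric] mollify_integrable)
    also have "\<dots> = (LINT y|lebesgue. (mollifier e (x - y) - mollifier e (x' - y)) * f y)" by (simp add: algebra_simps)
    also have "norm \<dots> \<le> (LINT y|lebesgue. (1 / (e * c) * norm (x - x')) * \<bar>f y\<bar>)"
    proof (rule Bochner_Integration.integral_norm_bound_integral)
      have "integrable lebesgue (\<lambda>y. mollifier e (x - y) * f y - mollifier e (x' - y) * f y)"
        using f by (intro Bochner_Integration.integrable_diff mollify_integrable)
      then show "integrable lebesgue (\<lambda>y. (mollifier e (x - y) - mollifier e (x' - y)) * f y)" by (simp add: algebra_simps)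
      show "integrable lebesgue (\<lambda>y. (1 / (e * c) * norm (x - x')) * \<bar>f y\<bar>)" using f by simp
      fix y
      show "norm ((mollifier e (x - y) - mollifier e (x' - y)) * f y) \<le> (1 / (e * c) * norm (x - x')) * \<bar>f y\<bar>"
        unfolding real_norm_def abs_mult using lip[of "x - y" "x' - y"] by (intro mult_right_mono) auto
    qed
    finally show "dist (mollify e f x) (mollify e f x') \<le> 1 / (e * c) * I * dist x x'"
      by (simp add: dist_norm I_def mult_ac)
  qed
qed

lemma mollify_eq_0:
  assumes "\<And>y. dist x y < e \<Longrightarrow> f y = 0"
  shows "mollify e f x = 0"
proof -
  have "mollifier e (x - y) * f y = 0" for y
    using assms[of y] mollifier_outside[of "x - y"] by (cases "dist x y < e") (auto simp: dist_norm)
  then show ?thesis by (simp only: mollify_def) simp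
qed

lemma mollify_diff:
  assumes "integrable lebesgue f" "integrable lebesgue g"
  shows "mollify e (\<lambda>y. f y - g y) x = mollify e f x - mollify e g x"
  unfolding mollify_def
  using mollify_integrable[OF assms(1)] mollify_integrable[OF assms(2)]
  by (simp add: right_diff_distrib)

text \<open>The kernel vanishes outside Q and is at most the constant of \<open>mollifier_le\<close>
  inside, so an unweighted integral over Q remains.\<close>

lemma mollify_bound:
  fixes f :: "real^'n \<Rightarrow> real"
  assumes f: "integrable lebesgue f" and Q: "Q \<in> sets lebesgue" "cball x e \<subseteq> Q"
  shows "\<bar>mollify e f x\<bar> \<le> 2 * (real CARD('n) / e) ^ CARD('n) * (LINT y|lebesgue. indicat_real Q y * \<bar>f y\<bar>)"
proof -
  let ?M = "2 * (real CARD('n) / e) ^ CARD('n)"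
  have "norm (mollify e f x) \<le> (LINT y|lebesgue. ?M * (indicat_real Q y * \<bar>f y\<bar>))"
    unfolding mollify_def
  proof (rule Bochner_Integration.integral_norm_bound_integral)
    show "integrable lebesgue (\<lambda>y. mollifier e (x - y) * f y)" using f by (rule mollify_integrable)
    show "integrable lebesgue (\<lambda>y. ?M * (indicat_real Q y * \<bar>f y\<bar>))"
      using f Q by (intro integrable_mult_right integrable_bounded_mult[of _ _ 1]) (auto simp: indicator_def)
    fix y
    show "norm (mollifier e (x - y) * f y) \<le> ?M * (indicat_real Q y * \<bar>f y\<bar>)"
    proof (cases "y \<in> Q")
      case True
      then show ?thesis using mollifier_le[of "x - y"] by (auto simp: abs_mult mollifier_abs intro: mult_right_mono)
    next
      case False
      then have "norm (x - y) \<ge> e" using Q(2) by (force simp: dist_norm)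
      then show ?thesis using e by (simp add: mollifier_outside)
    qed
  qed
  then show ?thesis by simp
qed

text \<open>The kernel is a probability density, so \<open>h x\<close> equals its own mollified
  constant and only the oscillation of h within distance e of x remains.\<close>

lemma mollify_close:
  fixes h :: "real^'n \<Rightarrow> real"
  assumes h: "integrable lebesgue h" and d: "\<And>y. dist x y < e \<Longrightarrow> \<bar>h y - h x\<bar> \<le> d"
  shows "\<bar>mollify e h x - h x\<bar> \<le> d"
proof -
  have i: "integrable lebesgue (\<lambda>y. mollifier e (x - y) * h x)"
    by (intro integrable_mult_left mollifier_shift_integrable)
  have "mollify e h x - h x = mollify e h x - (LINT y|lebesgue. mollifier e (x - y) * h x)"
    using mollifier_shift_integral[of x] by simp
  also have "\<dots> = (LINT y|lebesgue. mollifier e (x - y) * h y - mollifier e (x - y) * h x)"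
    unfolding mollify_def by (intro Bochner_Integration.integral_diff[symmetric] mollify_integrable h i)
  also have "norm \<dots> \<le> (LINT y|lebesgue. mollifier e (x - y) * d)"
  proof (rule Bochner_Integration.integral_norm_bound_integral)
    show "integrable lebesgue (\<lambda>y. mollifier e (x - y) * h y - mollifier e (x - y) * h x)"
      by (intro Bochner_Integration.integrable_diff mollify_integrable h i)
    show "integrable lebesgue (\<lambda>y. mollifier e (x - y) * d)" by (intro integrable_mult_left mollifier_shift_integrable)
    fix y
    show "norm (mollifier e (x - y) * h y - mollifier e (x - y) * h x) \<le> mollifier e (x - y) * d"
    proof (cases "dist x y < e")
      case True
      then show ?thesis
        by (simp add: abs_mult mollifier_abs mult_left_mono[OF d mollifier_nonneg] flip: right_diff_distrib)
    next
      case False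
      then show ?thesis by (simp add: mollifier_outside dist_norm)
    qed
  qed
  also have "\<dots> = d" using mollifier_shift_integral[of x] by simp
  finally show ?thesis by simp
qed

text \<open>After Fubini the substitution x = y + z takes the mollifier off f: the right side tests
  f itself against translates of \<psi> and averages the results over z.\<close>

lemma mollify_duality:
  fixes f \<psi> :: "real^'n \<Rightarrow> real"
  assumes f: "integrable lebesgue f" and \<psi>: "continuous_on UNIV \<psi>" "integrable lebesgue \<psi>" and b: "\<And>x. \<bar>\<psi> x\<bar> \<le> B"
  shows "(LINT x|lebesgue. mollify e f x * \<psi> x) =
    (LINT z|lebesgue. mollifier e z * (LINT y|lebesgue. f y * \<psi> (y + z)))"
proof -
  interpret pair_sigma_finite "lebesgue :: (real^'n) measure" "lebesgue :: (real^'n) measure"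
    by (rule pair_sigma_finite_lebesgue)
  have [measurable]: "\<psi> \<in> borel_measurable borel" using \<psi>(1) by (rule borel_measurable_continuous_onI)
  have [measurable]: "f \<in> borel_measurable lebesgue" using f by auto
  \<comment> \<open>Every Borel set is Lebesgue measurable, so the identity is measurable in this
    direction. It makes the kernel and \<psi>, evaluated at sums and differences, measurable on the
    product of the Lebesgue measures.\<close>
  have idm: "(\<lambda>x. x) \<in> lebesgue \<rightarrow>\<^sub>M (borel :: (real^'n) measure)"
    by (intro measurable_completion) simp
  have [measurable]: "fst \<in> lebesgue \<Otimes>\<^sub>M lebesgue \<rightarrow>\<^sub>M (borel :: (real^'n) measure)"
    "snd \<in> lebesgue \<Otimes>\<^sub>M lebesgue \<rightarrow>\<^sub>M (borel :: (real^'n) measure)"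
    by (rule measurable_compose[OF measurable_fst idm]) (rule measurable_compose[OF measurable_snd idm])
  let ?M = "2 * (real CARD('n) / e) ^ CARD('n)"
  have F1: "integrable (lebesgue \<Otimes>\<^sub>M lebesgue) (\<lambda>(x, y). mollifier e (x - y) * f y * \<psi> x)"
  proof (rule Bochner_Integration.integrable_bound)
    show "integrable (lebesgue \<Otimes>\<^sub>M lebesgue) (\<lambda>p. ?M * (case p of (x, y) \<Rightarrow> \<psi> x * f y))"
      by (intro integrable_mult_right integrable_lebesgue_product f \<psi>)
    have "(\<lambda>p. mollifier e (fst p - snd p) * f (snd p) * \<psi> (fst p)) \<in> borel_measurable (lebesgue \<Otimes>\<^sub>M lebesgue)"
      by measurable
    then show "(\<lambda>(x, y). mollifier e (x - y) * f y * \<psi> x) \<in> borel_measurable (lebesgue \<Otimes>\<^sub>M lebesgue)"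
      by (simp add: case_prod_beta')
    have "\<bar>mollifier e (x - y) * f y * \<psi> x\<bar> \<le> \<bar>?M * (\<psi> x * f y)\<bar>" for x y
    proof -
      have "mollifier e (x - y) * (\<bar>f y\<bar> * \<bar>\<psi> x\<bar>) \<le> ?M * (\<bar>f y\<bar> * \<bar>\<psi> x\<bar>)"
        by (intro mult_right_mono mollifier_le) auto
      then show ?thesis using e by (simp add: abs_mult mollifier_abs mult_ac)
    qed
    then show "AE p in lebesgue \<Otimes>\<^sub>M lebesgue. norm (case p of (x, y) \<Rightarrow> mollifier e (x - y) * f y * \<psi> x)
        \<le> norm (?M * (case p of (x, y) \<Rightarrow> \<psi> x * f y))"
      by (intro AE_I2) auto
  qed
  have F2: "integrable (lebesgue \<Otimes>\<^sub>M lebesgue) (\<lambda>(z, y). mollifier e z * (f y * \<psi> (y + z)))"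
  proof (rule Bochner_Integration.integrable_bound)
    show "integrable (lebesgue \<Otimes>\<^sub>M lebesgue) (\<lambda>p. B * (case p of (z, y) \<Rightarrow> mollifier e z * f y))"
      by (intro integrable_mult_right integrable_lebesgue_product f mollifier_integrable)
    have "(\<lambda>p. mollifier e (fst p) * (f (snd p) * \<psi> (snd p + fst p))) \<in> borel_measurable (lebesgue \<Otimes>\<^sub>M lebesgue)"
      by measurable
    then show "(\<lambda>(z, y). mollifier e z * (f y * \<psi> (y + z))) \<in> borel_measurable (lebesgue \<Otimes>\<^sub>M lebesgue)"
      by (simp add: case_prod_beta')
    have "B \<ge> 0" using b[of 0] by linarith
    have "\<bar>mollifier e z * (f y * \<psi> (y + z))\<bar> \<le> \<bar>B * (mollifier e z * f y)\<bar>" for z y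
    proof -
      have "\<bar>\<psi> (y + z)\<bar> * (mollifier e z * \<bar>f y\<bar>) \<le> B * (mollifier e z * \<bar>f y\<bar>)"
        by (intro mult_right_mono b mult_nonneg_nonneg mollifier_nonneg) auto
      then show ?thesis using \<open>B \<ge> 0\<close> by (simp add: abs_mult mollifier_abs mult_ac)
    qed
    then show "AE p in lebesgue \<Otimes>\<^sub>M lebesgue. norm (case p of (z, y) \<Rightarrow> mollifier e z * (f y * \<psi> (y + z)))
        \<le> norm (B * (case p of (z, y) \<Rightarrow> mollifier e z * f y))"
      by (intro AE_I2) auto
  qed
  have "(LINT x|lebesgue. mollify e f x * \<psi> x) = (LINT x|lebesgue. (LINT y|lebesgue. mollifier e (x - y) * f y * \<psi> x))"
    unfolding mollify_def by simp
  also have "\<dots> = (LINT y|lebesgue. (LINT x|lebesgue. mollifier e (x - y) * f y * \<psi> x))"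
    by (rule Fubini_integral[OF F1, symmetric])
  also have "\<dots> = (LINT y|lebesgue. (LINT z|lebesgue. mollifier e z * (f y * \<psi> (y + z))))"
  proof (rule Bochner_Integration.integral_cong[OF refl])
    fix y :: "real^'n"
    have "(LINT z|lebesgue. mollifier e z * (f y * \<psi> (y + z))) = (LINT z|lebesgue. mollifier e (z + - y) * (f y * \<psi> (y + (z + - y))))"
      by (rule integral_translate(1)[symmetric]) measurable
    then show "(LINT x|lebesgue. mollifier e (x - y) * f y * \<psi> x) = (LINT z|lebesgue. mollifier e z * (f y * \<psi> (y + z)))"
      by (simp add: mult_ac)
  qed
  also have "\<dots> = (LINT z|lebesgue. (LINT y|lebesgue. mollifier e z * (f y * \<psi> (y + z))))"
    by (rule Fubini_integral[OF F2])
  finally show ?thesis by simp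
qed

end

section \<open>Test functions and weak derivatives of mollifications\<close>

lemma test_functions_continuous: "\<phi> \<in> test_functions U \<Longrightarrow> continuous_on UNIV \<phi>"
  using continuously_differentiable_imp_continuous by (auto simp: test_functions_def)

lemma test_function_bounded:
  assumes "\<phi> \<in> test_functions U"
  obtains B where "\<And>x. \<bar>\<phi> x\<bar> \<le> B"
proof -
  let ?K = "closure {x. \<phi> x \<noteq> 0}"
  have K: "compact ?K" and c: "continuous_on UNIV \<phi>"
    using assms test_functions_continuous by (auto simp: test_functions_def)
  have "bounded (\<phi> ` ?K)"
    using K c by (intro compact_imp_bounded compact_continuous_image) (auto intro: continuous_on_subset)
  then obtain B where B: "\<And>x. x \<in> ?K \<Longrightarrow> \<bar>\<phi> x\<bar> \<le> B" unfolding bounded_iff by auto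
  \<comment> \<open>B is a bound on the support only, which may be empty; 0 covers the other
    points.\<close>
  have "\<bar>\<phi> x\<bar> \<le> max B 0" for x
    using B[of x] closure_subset[of "{x. \<phi> x \<noteq> 0}"] by (cases "\<phi> x = 0") auto
  then show thesis using that by blast
qed

lemma test_function_integrable:
  assumes "\<phi> \<in> test_functions U"
  shows "integrable lebesgue \<phi>"
proof -
  let ?K = "closure {x. \<phi> x \<noteq> 0}"
  have K: "compact ?K" and c: "continuous_on UNIV \<phi>"
    using assms test_functions_continuous by (auto simp: test_functions_def)
  obtain B where B: "\<And>x. \<bar>\<phi> x\<bar> \<le> B" using test_function_bounded[OF assms] by blast
  have "integrable lebesgue (indicat_real ?K)"
    using lmeasurable_compact[OF K] by (simp add: fmeasurable_def)
  from integrable_bounded_mult[OF this continuous_lebesgue_measurable[OF c] B]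
  have "integrable lebesgue (\<lambda>x. \<phi> x * indicat_real ?K x)" .
  also have "(\<lambda>x. \<phi> x * indicat_real ?K x) = \<phi>"
    using closure_subset[of "{x. \<phi> x \<noteq> 0}"] by (fastforce simp: indicator_def)
  finally show ?thesis .
qed

lemma partial_derivative_test_function:
  assumes "\<phi> \<in> test_functions U"
  shows "partial_derivative j \<phi> \<in> test_functions U"
proof -
  let ?K = "closure {x. \<phi> x \<noteq> 0}"
  have "{x. partial_derivative j \<phi> x \<noteq> 0} \<subseteq> ?K"
    using partial_derivative_outside_support by blast
  then have *: "closure {x. partial_derivative j \<phi> x \<noteq> 0} \<subseteq> ?K" by (simp add: closure_minimal)
  moreover have "compact (closure {x. partial_derivative j \<phi> x \<noteq> 0})"
    using assms * unfolding test_functions_def mem_Collect_eq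
    by (meson bounded_subset closed_closure compact_eq_bounded_closed)
  ultimately show ?thesis using assms partial_derivative_smooth[of \<phi>] by (auto simp: test_functions_def)
qed

text \<open>By duality both sides are averages over z of the hypothesis tested with the translate of
  \<psi> by z. The hypothesis ranges over test functions on the whole space because translates may
  leave any smaller domain.\<close>

lemma mollify_weak_derivative:
  fixes f g :: "real^'n \<Rightarrow> real"
  assumes e: "e > 0" and f: "integrable lebesgue f" and g: "integrable lebesgue g"
    and w: "\<And>\<psi>. \<psi> \<in> test_functions UNIV \<Longrightarrow>
      (LINT x|lebesgue. f x * partial_derivative j \<psi> x) = - (LINT x|lebesgue. g x * \<psi> x)"
    and \<psi>: "\<psi> \<in> test_functions UNIV"
  shows "(LINT x|lebesgue. mollify e f x * partial_derivative j \<psi> x) =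
    - (LINT x|lebesgue. mollify e g x * \<psi> x)"
proof -
  have s: "smooth \<psi>" using \<psi> by (simp add: test_functions_def)
  have p: "partial_derivative j \<psi> \<in> test_functions UNIV" using \<psi> by (rule partial_derivative_test_function)
  have c: "continuous_on UNIV \<psi>" "continuous_on UNIV (partial_derivative j \<psi>)"
    using \<psi> p test_functions_continuous by blast+
  have inner: "(LINT y|lebesgue. f y * partial_derivative j \<psi> (y + z)) = - (LINT y|lebesgue. g y * \<psi> (y + z))" for z
  proof -
    have "{x. \<psi> (x + z) \<noteq> 0} = (\<lambda>x. x - z) ` {x. \<psi> x \<noteq> 0}"
      by (auto simp: image_iff) (metis add_diff_cancel_right')
    then have "compact (closure {x. \<psi> (x + z) \<noteq> 0})"
      using \<psi> bounded_translation_minus[of "{x. \<psi> x \<noteq> 0}" z] by (simp add: test_functions_def)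
    then have "(\<lambda>x. \<psi> (x + z)) \<in> test_functions UNIV"
      using s continuously_differentiable_translate by (auto simp: test_functions_def)
    from w[OF this] show ?thesis
      using partial_derivative_translate(1)[OF smooth_imp_differentiable[OF s]] by simp
  qed
  obtain B1 where B1: "\<And>x. \<bar>\<psi> x\<bar> \<le> B1" using test_function_bounded[OF \<psi>] by blast
  obtain B2 where B2: "\<And>x. \<bar>partial_derivative j \<psi> x\<bar> \<le> B2" using test_function_bounded[OF p] by blast
  show ?thesis
    using mollify_duality[OF e f c(2) test_function_integrable[OF p] B2]
      mollify_duality[OF e g c(1) test_function_integrable[OF \<psi>] B1]
    by (simp add: inner)
qed

section \<open>Mollification in the function space\<close>

text \<open>The mesh cell with lower corner e m, widened by e in every coordinate direction; it
  contains the closed ball of radius e around each point of the cell.\<close>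

definition grid_cube :: "real \<Rightarrow> ('n \<Rightarrow> int) \<Rightarrow> (real^'n) set" where
  "grid_cube e m = cbox (\<chi> i. e * (of_int (m i) - 1)) ((\<chi> i. e * (of_int (m i) - 1)) + (\<chi> i. 3 * e))"

text \<open>Keeping only cubes inside \<Omega> makes each family admissible in the strong
  Muckenhoupt condition. That the relevant cubes are among them is a matter of small e.\<close>

definition grid_family :: "(real^'n) set \<Rightarrow> real \<Rightarrow> ('n \<Rightarrow> int) \<Rightarrow> (real^'n) set set" where
  "grid_family \<Omega> e r = {grid_cube e m | m. (\<forall>i. m i mod 4 = r i) \<and> grid_cube e m \<subseteq> \<Omega>}"

definition residues4 :: "('n \<Rightarrow> int) set" where
  "residues4 = (UNIV \<rightarrow> {0..<4})"

lemma finite_residues4: "finite (residues4 :: ('n::finite \<Rightarrow> int) set)"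
  unfolding residues4_def PiE_UNIV_domain[symmetric] by (intro finite_PiE) auto

lemma mem_grid_cube:
  "z \<in> grid_cube e m \<longleftrightarrow> (\<forall>i. e * (of_int (m i) - 1) \<le> z $ i \<and> z $ i \<le> e * (of_int (m i) + 2))"
  by (simp add: grid_cube_def mem_box_cart algebra_simps)

lemma grid_family_disjoint_cubes:
  fixes \<Omega> :: "(real^'n) set"
  assumes e: "e > 0"
  shows "grid_family \<Omega> e r \<in> disjoint_cube_families \<Omega>"
proof -
  have "grid_cube e m = grid_cube e m'"
    if "\<forall>i. m i mod 4 = r i" "\<forall>i. m' i mod 4 = r i" "z \<in> grid_cube e m" "z \<in> grid_cube e m'" for m m' z
  proof -
    have "m i = m' i" for i
    proof -
      have "e * (of_int (m i) - 1) \<le> e * (of_int (m' i) + 2)" "e * (of_int (m' i) - 1) \<le> e * (of_int (m i) + 2)"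
        using that(3,4) unfolding mem_grid_cube by (meson order_trans)+
      then have "real_of_int (m i) - 1 \<le> of_int (m' i) + 2" "real_of_int (m' i) - 1 \<le> of_int (m i) + 2"
        using e by simp_all
      \<comment> \<open>Intersecting cubes have indices at distance at most 3 in each coordinate,
        whereas equal residues force a multiple of 4.\<close>
      then have "m i \<le> m' i + 3" "m' i \<le> m i + 3" by linarith+
      moreover have "m i mod 4 = m' i mod 4" using that(1,2) by simp
      ultimately show ?thesis by presburger
    qed
    then have "m = m'" by blast
    then show ?thesis by simp
  qed
  moreover have "is_cube (grid_cube e m :: (real^'n) set)" for m :: "'n \<Rightarrow> int"
    using e unfolding is_cube_def grid_cube_def by (intro exI[of _ "(\<chi> i. e * (of_int (m i) - 1))"] exI[of _ "3*e"]) simp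
  ultimately show ?thesis
    unfolding disjoint_cube_families_def disjoint_def grid_family_def by blast
qed

lemma averaging_operator_nonneg: "averaging_operator \<Q> (\<lambda>y. \<bar>f y\<bar>) x \<ge> 0"
  unfolding averaging_operator_def by (intro infsum_nonneg) simp

text \<open>
  The cubes of side \<open>3e\<close> centred at the cells of the grid of mesh \<open>e\<close> split into finitely many
  disjoint families according to the residues of their positions modulo 4. Residues modulo 3
  would not do, since closed neighbours would then share a face.
\<close>

lemma mollify_le_averages:
  fixes f :: "real^'n \<Rightarrow> real"
  assumes e: "e > 0" and f: "integrable lebesgue f" "\<And>x. x \<notin> K \<Longrightarrow> f x = 0"
    and d: "(\<Union>y\<in>K. ball y d) \<subseteq> \<Omega>" "(2 * real CARD('n) + 1) * e < d"
  shows "\<bar>mollify e f x\<bar> \<le> 2 * (3 * real CARD('n)) ^ CARD('n) *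
    (\<Sum>r\<in>residues4. averaging_operator (grid_family \<Omega> e r) (\<lambda>y. \<bar>f y\<bar>) x)"
proof (cases "mollify e f x = 0")
  case True
  then show ?thesis by (simp add: sum_nonneg averaging_operator_nonneg)
next
  case False
  \<comment> \<open>Only points x within distance e of K matter, so the cube belonging to the cell
    of x can be shown to lie in \<Omega>.\<close>
  then obtain y where "dist x y < e" "f y \<noteq> 0" using mollify_eq_0[OF e, of x f] by blast
  then have y: "dist x y < e" "y \<in> K" using f(2) by blast+
  define m where "m i = \<lfloor>x $ i / e\<rfloor>" for i
  define r where "r i = m i mod 4" for i
  let ?Q = "grid_cube e m"
  have m: "e * of_int (m i) \<le> x $ i" "x $ i \<le> e * (of_int (m i) + 1)" for i
  proof -
    have "of_int (m i) \<le> x $ i / e" "x $ i / e \<le> of_int (m i) + 1" unfolding m_def by linarith+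
    then show "e * of_int (m i) \<le> x $ i" "x $ i \<le> e * (of_int (m i) + 1)"
      using e by (simp_all add: field_simps)
  qed
  have ball: "cball x e \<subseteq> ?Q"
  proof
    fix z assume z: "z \<in> cball x e"
    have "\<bar>x $ i - z $ i\<bar> \<le> e" for i
      using z component_le_norm_cart[of "x - z" i] by (simp add: dist_norm)
    then have "e * of_int (m i) - e \<le> z $ i \<and> z $ i \<le> e * (of_int (m i) + 1) + e" for i
      using m[of i] by (smt (verit))
    then show "z \<in> ?Q" by (simp add: mem_grid_cube algebra_simps)
  qed
  have "?Q \<subseteq> ball y d"
  proof
    fix z assume "z \<in> ?Q"
    then have z: "e * of_int (m i) - e \<le> z $ i" "z $ i \<le> e * (of_int (m i) + 1) + e" for i
      by (auto simp: mem_grid_cube algebra_simps)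
    \<comment> \<open>A point of the cube differs from x by at most 2e in each coordinate, so its
      distance is at most 2ne from x and less than (2n + 1)e from y. This is the origin of the
      factor in \<open>d(2)\<close>.\<close>
    have "\<bar>(z - x) $ i\<bar> \<le> 2 * e" for i
      using m[of i] z[of i] by (simp add: abs_le_iff algebra_simps)
    then have "dist z x \<le> real CARD('n) * (2 * e)" unfolding dist_norm by (rule norm_le_card_mult)
    then have "dist z y < d" using y(1) d(2) dist_triangle[of z y x] by (simp add: algebra_simps)
    then show "z \<in> ball y d" by (simp add: dist_commute)
  qed
  then have "?Q \<subseteq> \<Omega>" using y(2) d(1) by blast
  then have Q: "?Q \<in> grid_family \<Omega> e r" by (auto simp: grid_family_def r_def)
  have mQ: "?Q \<in> sets lebesgue" by (simp add: grid_cube_def)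
  have vol: "measure lebesgue ?Q = (3 * e) ^ CARD('n)"
    using e unfolding grid_cube_def by (subst measure_lebesgue_cube) auto
  let ?I = "LINT y|lebesgue. indicat_real ?Q y * \<bar>f y\<bar>"
  have "x \<in> ?Q" using ball e by auto
  moreover have "disjoint (grid_family \<Omega> e r)"
    using grid_family_disjoint_cubes[OF e, of \<Omega> r] by (simp add: disjoint_cube_families_def)
  ultimately have A: "averaging_operator (grid_family \<Omega> e r) (\<lambda>y. \<bar>f y\<bar>) x = 1 / (3 * e) ^ CARD('n) * ?I"
    using averaging_operator_at[OF _ Q] by (simp add: vol integral_lebesgue_on[OF mQ])
  have "\<bar>mollify e f x\<bar> \<le> 2 * (real CARD('n) / e) ^ CARD('n) * ?I"
    by (rule mollify_bound[OF e f(1) mQ ball])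
  \<comment> \<open>The powers of e cancel: (n / e)^n times the volume (3e)^n is (3n)^n.\<close>
  also have "\<dots> = 2 * (3 * real CARD('n)) ^ CARD('n) * averaging_operator (grid_family \<Omega> e r) (\<lambda>y. \<bar>f y\<bar>) x"
    unfolding A using e by (simp add: power_divide power_mult_distrib)
  also have "\<dots> \<le> 2 * (3 * real CARD('n)) ^ CARD('n) *
      (\<Sum>r\<in>residues4. averaging_operator (grid_family \<Omega> e r) (\<lambda>y. \<bar>f y\<bar>) x)"
  proof (intro mult_left_mono member_le_sum)
    show "r \<in> residues4" by (auto simp: residues4_def r_def)
  qed (auto simp: finite_residues4 averaging_operator_nonneg)
  finally show ?thesis .
qed

text \<open>The support of a smooth cutoff serves, since the cutoff is nonzero on an open set
  containing K.\<close>

lemma compact_neighbourhood: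
  fixes K :: "(real^'n) set"
  assumes "compact K" "open U" "K \<subseteq> U"
  obtains K' where "compact K'" "K \<subseteq> interior K'" "K' \<subseteq> U"
proof -
  obtain \<theta> where \<theta>: "\<theta> \<in> test_functions U" "\<And>x. x \<in> K \<Longrightarrow> \<theta> x = 1"
    using smooth_cutoff[OF assms] by metis
  have "{x. \<theta> x \<noteq> 0} = \<theta> -` (- {0})" by auto
  then have "open {x. \<theta> x \<noteq> 0}"
    using open_vimage[OF _ test_functions_continuous[OF \<theta>(1)], of "- {0}"] by auto
  then have "{x. \<theta> x \<noteq> 0} \<subseteq> interior (closure {x. \<theta> x \<noteq> 0})"
    by (simp add: interior_maximal closure_subset)
  moreover have "K \<subseteq> {x. \<theta> x \<noteq> 0}" using \<theta>(2) by force
  ultimately have "K \<subseteq> interior (closure {x. \<theta> x \<noteq> 0})" by (rule order_trans[rotated])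
  then show thesis
    using \<theta>(1) that[of "closure {x. \<theta> x \<noteq> 0}"] by (auto simp: test_functions_def)
qed

context muckenhoupt_space
begin

section \<open>Boundedness and convergence of mollification in X\<close>

lemma X_compact_support_integrable:
  assumes "compact K" "K \<subseteq> \<Omega>" "f \<in> X" "\<And>x. x \<notin> K \<Longrightarrow> f x = 0"
  shows "integrable lebesgue f"
proof -
  have "(\<lambda>x. indicat_real K x * f x) = f" using assms(4) by (auto simp: fun_eq_iff indicator_def)
  then show ?thesis using compact_bound[OF assms(1,2)] assms(3) by metis
qed

lemma lebesgue_measurable_on_domain:
  "f \<in> borel_measurable lebesgue \<Longrightarrow> f \<in> borel_measurable (lebesgue_on \<Omega>)"
  by (rule measurable_restrict_space1)

lemma mollify_measurable:
  assumes "e > 0" "integrable lebesgue f"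
  shows "mollify e f \<in> borel_measurable (lebesgue_on \<Omega>)"
  by (rule mollify_lipschitz[OF assms])
     (intro lebesgue_measurable_on_domain continuous_lebesgue_measurable, rule lipschitz_on_continuous_on)

text \<open>The number of disjoint families does not depend on e, and each family costs one factor
  \<open>averaging_bound\<close>. C is fixed before f, so the accuracy of a later approximation may
  depend on C.\<close>

lemma mollify_bounded:
  assumes K: "compact K" "K \<subseteq> \<Omega>"
  obtains C where "C \<ge> 0" "\<forall>\<^sub>F e in at_right 0. \<forall>f\<in>X. (\<forall>x. x \<notin> K \<longrightarrow> f x = 0) \<longrightarrow>
    mollify e f \<in> X \<and> N (mollify e f) \<le> C * N f"
proof
  let ?n = "real CARD('n)"
  define D where "D = 2 * (3 * ?n) ^ CARD('n)"
  have D: "D \<ge> 0" by (simp add: D_def)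
  let ?R = "residues4 :: ('n \<Rightarrow> int) set"
  show "D * (real (card ?R) * averaging_bound) \<ge> 0" using D averaging_bound_nonneg by simp
  obtain d where d: "d > 0" "(\<Union>y\<in>K. ball y d) \<subseteq> \<Omega>"
    using compact_subset_open_imp_ball_epsilon_subset[OF K(1) open_domain K(2)] by metis
  show "\<forall>\<^sub>F e in at_right 0. \<forall>f\<in>X. (\<forall>x. x \<notin> K \<longrightarrow> f x = 0) \<longrightarrow>
    mollify e f \<in> X \<and> N (mollify e f) \<le> D * (real (card ?R) * averaging_bound) * N f"
  proof (rule eventually_at_rightI[of 0 "d / (2 * ?n + 1)"], intro ballI impI)
    fix e f assume "e \<in> {0<..<d / (2 * ?n + 1)}" and f: "f \<in> X" "\<forall>x. x \<notin> K \<longrightarrow> f x = 0"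
    then have e: "e > 0" "(2 * ?n + 1) * e < d" by (auto simp: field_simps)
    have int: "integrable lebesgue f" using X_compact_support_integrable[OF K f(1)] f(2) by blast
    let ?A = "\<lambda>r. averaging_operator (grid_family \<Omega> e r) (\<lambda>y. \<bar>f y\<bar>)"
    have A: "?A r \<in> X" "N (?A r) \<le> averaging_bound * N f" for r
      using averaging_operator_bounded[OF grid_family_disjoint_cubes[OF e(1)] X_abs(1)[OF f(1)]] X_abs(2)[OF f(1)]
      by simp_all
    have S: "(\<lambda>x. \<Sum>r\<in>?R. ?A r x) \<in> X" using A(1) by (rule X_sum)
    have DS: "(\<lambda>x. D * (\<Sum>r\<in>?R. ?A r x)) \<in> X" using S by (rule scale)
    have "AE x in lebesgue_on \<Omega>. \<bar>mollify e f x\<bar> \<le> D * (\<Sum>r\<in>?R. ?A r x)"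
      using mollify_le_averages[OF e(1) int _ d(2) e(2)] f(2) by (intro AE_I2) (simp add: D_def)
    from X_dominated[OF DS mollify_measurable[OF e(1) int] this]
    have *: "mollify e f \<in> X" "N (mollify e f) \<le> N (\<lambda>x. D * (\<Sum>r\<in>?R. ?A r x))" .
    note *(2)
    also have "N (\<lambda>x. D * (\<Sum>r\<in>?R. ?A r x)) = D * N (\<lambda>x. \<Sum>r\<in>?R. ?A r x)"
      using norm_scale[OF S, of D] D by simp
    also have "\<dots> \<le> D * (\<Sum>r\<in>?R. averaging_bound * N f)"
      using D A by (intro mult_left_mono order_trans[OF N_sum] sum_mono) auto
    also have "\<dots> = D * (real (card ?R) * averaging_bound) * N f" by simp
    finally show "mollify e f \<in> X \<and> N (mollify e f) \<le> D * (real (card ?R) * averaging_bound) * N f"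
      using *(1) by simp
  qed (use d in \<open>simp add: add_pos_nonneg add_nonneg_pos\<close>)
qed

text \<open>Truncation makes g bounded, after which multiples of \<open>indicat_real K'\<close>
  dominate. The truncated function is then approximated almost everywhere by continuous ones, and
  both steps converge by dominated convergence in X.\<close>

lemma continuous_dense:
  assumes K: "compact K" "K \<subseteq> interior K'" and K': "compact K'" "K' \<subseteq> \<Omega>"
    and g: "g \<in> X" "\<And>x. x \<notin> K \<Longrightarrow> g x = 0" and \<delta>: "\<delta> > 0"
  obtains h where "continuous_on UNIV h" "\<And>x. x \<notin> K' \<Longrightarrow> h x = 0" "h \<in> X" "N (\<lambda>x. g x - h x) < \<delta>"
proof -
  have K\<Omega>: "K \<subseteq> \<Omega>" using K(2) K'(2) interior_subset by blast
  have gint: "integrable lebesgue g" using X_compact_support_integrable[OF K(1) K\<Omega> g] .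
  then have gm [measurable]: "g \<in> borel_measurable lebesgue" by auto
  obtain \<theta> where \<theta>: "\<theta> \<in> test_functions (interior K')" "\<And>x. 0 \<le> \<theta> x" "\<And>x. \<theta> x \<le> 1" "\<And>x. x \<in> K \<Longrightarrow> \<theta> x = 1"
    using smooth_cutoff[OF K(1) open_interior K(2)] by metis
  have \<theta>0: "\<theta> x = 0" if "x \<notin> K'" for x
    using \<theta>(1) that closure_subset[of "{x. \<theta> x \<noteq> 0}"] interior_subset[of K']
    by (auto simp: test_functions_def)
  define T where "T m t = max (- m) (min m t)" for m t :: real
  have Tc: "continuous_on UNIV (T m)" for m
    unfolding T_def[abs_def] by (intro continuous_intros)
  have Tm [measurable]: "T m \<in> borel_measurable borel" for m
    using Tc by (rule borel_measurable_continuous_onI)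
  have "(\<lambda>m. N (\<lambda>x. g x - T (real m) (g x))) \<longlonglongrightarrow> 0"
  proof (rule dominated_convergence_X[OF X_abs(1)[OF g(1)]])
    show "(\<lambda>x. g x - T (real m) (g x)) \<in> borel_measurable (lebesgue_on \<Omega>)" for m
      by (rule lebesgue_measurable_on_domain) measurable
    show "AE x in lebesgue_on \<Omega>. \<bar>g x - T (real m) (g x)\<bar> \<le> \<bar>g x\<bar>" for m
      by (intro AE_I2) (auto simp: T_def)
    show "AE x in lebesgue_on \<Omega>. (\<lambda>m. g x - T (real m) (g x)) \<longlonglongrightarrow> 0"
    proof (rule AE_I2, rule tendsto_eventually)
      fix x
      obtain m0 :: nat where "\<bar>g x\<bar> \<le> real m0" using real_arch_simple by blast
      then show "\<forall>\<^sub>F m in sequentially. g x - T (real m) (g x) = 0"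
        by (intro eventually_sequentiallyI[of m0]) (auto simp: T_def)
    qed
  qed
  from eventually_happens'[OF sequentially_bot order_tendstoD(2)[OF this, of "\<delta> / 2"]] \<delta>
  obtain m0 where m0: "N (\<lambda>x. g x - T (real m0) (g x)) < \<delta> / 2" by auto
  define m where "m = real m0"
  have m: "m \<ge> 0" by (simp add: m_def)
  let ?b = "\<lambda>x. T m (g x)"
  have Tb: "\<bar>T m t\<bar> \<le> m" for t using m by (auto simp: T_def)
  have TT: "T m (T m t) = T m t" for t using m by (auto simp: T_def)
  have bm: "?b \<in> borel_measurable lebesgue" by measurable
  \<comment> \<open>Measurability in this form is approximability by continuous functions outside a
    negligible set.\<close>
  have "?b measurable_on UNIV" using lebesgue_measurable_imp_measurable_on_real[OF bm] by simp
  then obtain Z u where Z: "negligible Z" and u: "\<And>k. continuous_on UNIV (u k)"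
    "\<And>x. x \<notin> Z \<Longrightarrow> (\<lambda>k. u k x) \<longlonglongrightarrow> ?b x"
    unfolding measurable_on_def by auto
  \<comment> \<open>The functions \<open>u k\<close> may be unbounded and supported anywhere:
    \<open>T m\<close> bounds them uniformly and \<theta> confines them to \<open>K'\<close>.
    Neither changes the limit, as \<open>T m\<close> fixes \<open>?b x\<close> and \<theta> is 1 on
    K, off which \<open>?b\<close> vanishes.\<close>
  define h where "h k x = \<theta> x * T m (u k x)" for k :: nat and x
  have hc: "continuous_on UNIV (h k)" for k
    unfolding h_def[abs_def]
    by (intro continuous_intros test_functions_continuous[OF \<theta>(1)] continuous_on_compose2[OF Tc u(1)]) auto
  have hm: "h k \<in> borel_measurable lebesgue" for k using hc by (rule continuous_lebesgue_measurable)
  have h0: "h k x = 0" if "x \<notin> K'" for k x using \<theta>0[OF that] by (simp add: h_def)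
  have hb: "\<bar>h k x\<bar> \<le> m" for k x
    using mult_mono[OF \<theta>(3) Tb[of "u k x"], of x] \<theta>(2) by (simp add: h_def abs_mult)
  note IK = compact_indicator[OF K']
  have hX: "h k \<in> X" for k
    by (rule X_dominated(1)[OF scale[OF IK, of m] lebesgue_measurable_on_domain[OF hm]])
       (intro AE_I2, use hb h0 in \<open>auto simp: indicator_def\<close>)
  have bX: "?b \<in> X"
    by (rule X_dominated(1)[OF X_abs(1)[OF g(1)] lebesgue_measurable_on_domain[OF bm]])
       (intro AE_I2, use m in \<open>auto simp: T_def\<close>)
  have b0: "?b x = 0" if "x \<notin> K" for x using g(2)[OF that] m by (simp add: T_def)
  have "(\<lambda>k. N (\<lambda>x. ?b x - h k x)) \<longlonglongrightarrow> 0"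
  proof (rule dominated_convergence_X[OF scale[OF IK, of "2 * m"]])
    show "(\<lambda>x. ?b x - h k x) \<in> borel_measurable (lebesgue_on \<Omega>)" for k
      using X_diff[OF bX hX] by (rule X_measurable)
    show "AE x in lebesgue_on \<Omega>. \<bar>?b x - h k x\<bar> \<le> 2 * m * indicat_real K' x" for k
    proof (rule AE_I2)
      fix x
      show "\<bar>?b x - h k x\<bar> \<le> 2 * m * indicat_real K' x"
      proof (cases "x \<in> K'")
        case True
        then show ?thesis using abs_triangle_ineq4[of "?b x" "h k x"] Tb[of "g x"] hb[of k x] by simp
      next
        case False
        then have "x \<notin> K" using K(2) interior_subset by blast
        then show ?thesis using False b0 h0 by simp
      qed
    qed
    have "AE x in lebesgue. x \<notin> Z"
      using Z by (intro AE_not_in) (simp add: negligible_iff_null_sets)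
    then have "AE x in lebesgue_on \<Omega>. x \<notin> Z"
      using sets_domain by (subst AE_restrict_space_iff) (auto elim: AE_mp)
    then show "AE x in lebesgue_on \<Omega>. (\<lambda>k. ?b x - h k x) \<longlonglongrightarrow> 0"
    proof eventually_elim
      case (elim x)
      have "(\<lambda>k. T m (u k x)) \<longlonglongrightarrow> T m (?b x)"
        using Tc by (intro continuous_on_tendsto_compose[OF _ u(2)[OF elim], of UNIV]) auto
      then have "(\<lambda>k. h k x) \<longlonglongrightarrow> \<theta> x * ?b x"
        unfolding h_def TT by (intro tendsto_intros)
      also have "\<theta> x * ?b x = ?b x" using \<theta>(4)[of x] b0[of x] by (cases "x \<in> K") auto
      finally show ?case using tendsto_diff[OF tendsto_const[of "?b x"]] by fastforce
    qed
  qed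
  from eventually_happens'[OF sequentially_bot order_tendstoD(2)[OF this, of "\<delta> / 2"]] \<delta>
  obtain k where k: "N (\<lambda>x. ?b x - h k x) < \<delta> / 2" by auto
  have "N (\<lambda>x. g x - h k x) \<le> N (\<lambda>x. g x - ?b x) + N (\<lambda>x. ?b x - h k x)"
    by (rule N_diff_triangle[OF g(1) bX hX])
  then have "N (\<lambda>x. g x - h k x) < \<delta>" using k m0 by (simp add: m_def)
  then show thesis using that hc h0 hX by blast
qed

text \<open>The error splits into the mollification of g - h, the mollification error of a
  continuous h, and h - g. Boundedness controls the first, uniform continuity the second, density
  the third.\<close>

lemma mollify_tendsto:
  assumes K: "compact K" "K \<subseteq> \<Omega>" and g: "g \<in> X" "\<And>x. x \<notin> K \<Longrightarrow> g x = 0" and \<delta>: "\<delta> > 0"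
  shows "\<forall>\<^sub>F e in at_right 0. mollify e g \<in> X \<and> N (\<lambda>x. mollify e g x - g x) < \<delta>"
proof -
  \<comment> \<open>K1 carries the approximant h and K2 its mollifications, so both stay within
    compact subsets of \<Omega>.\<close>
  obtain K1 where K1: "compact K1" "K \<subseteq> interior K1" "K1 \<subseteq> \<Omega>"
    using compact_neighbourhood[OF K(1) open_domain K(2)] .
  obtain K2 where K2: "compact K2" "K1 \<subseteq> interior K2" "K2 \<subseteq> \<Omega>"
    using compact_neighbourhood[OF K1(1) open_domain K1(3)] .
  obtain C where C: "C \<ge> 0" "\<forall>\<^sub>F e in at_right 0. \<forall>f\<in>X. (\<forall>x. x \<notin> K1 \<longrightarrow> f x = 0) \<longrightarrow>
    mollify e f \<in> X \<and> N (mollify e f) \<le> C * N f" using mollify_bounded[OF K1(1,3)] .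
  \<comment> \<open>Chosen so that \<open>C * \<delta>' + \<delta>'\<close> is half of \<delta>; the
    other half is left for the mollification error of h. The summand 1 covers C = 0.\<close>
  define \<delta>' where "\<delta>' = \<delta> / 2 / (C + 1)"
  have "(C + 1) * \<delta>' = \<delta> / 2"
    using C(1) unfolding \<delta>'_def times_divide_eq_right[of "C + 1" "\<delta> / 2"]
    by (subst nonzero_mult_div_cancel_left) auto
  then have \<delta>': "C * \<delta>' + \<delta>' = \<delta> / 2" by (simp add: distrib_right)
  have \<delta>'0: "\<delta>' > 0" using \<delta> C(1) by (simp add: \<delta>'_def)
  obtain h where h: "continuous_on UNIV h" "\<And>x. x \<notin> K1 \<Longrightarrow> h x = 0" "h \<in> X" "N (\<lambda>x. g x - h x) < \<delta>'"
    using continuous_dense[OF K(1) K1(2,1,3) g \<delta>'0] by blast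
  note IK = compact_indicator[OF K2(1,3)]
  let ?I = "N (indicat_real K2)"
  have I: "?I \<ge> 0" using norm_nonneg[OF IK] .
  define \<eta> where "\<eta> = \<delta> / (2 * (?I + 1))"
  have \<eta>: "\<eta> > 0" using \<delta> I by (simp add: \<eta>_def)
  have \<eta>I: "\<eta> * ?I < \<delta> / 2" using \<delta> I by (simp add: \<eta>_def field_simps)
  obtain \<rho>0 where \<rho>0: "\<rho>0 > 0" "(\<Union>x\<in>K1. ball x \<rho>0) \<subseteq> interior K2"
    using compact_subset_open_imp_ball_epsilon_subset[OF K1(1) open_interior K2(2)] by metis
  have "uniformly_continuous_on K2 h"
    using h(1) K2(1) continuous_on_subset by (intro compact_uniformly_continuous) blast+
  then obtain \<rho>1 where \<rho>1: "\<rho>1 > 0" "\<And>x y. x \<in> K2 \<Longrightarrow> y \<in> K2 \<Longrightarrow> dist y x < \<rho>1 \<Longrightarrow> dist (h y) (h x) < \<eta>"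
    unfolding uniformly_continuous_on_def using \<eta> by metis
  have near: "y \<in> K2" if "x \<in> K1" "dist x y < \<rho>0" for x y
    using \<rho>0(2) interior_subset[of K2] that by (force simp: subset_iff)
  \<comment> \<open>Uniform continuity is available on K2 only. If one of two close points lies in
    K1 then both lie in K2, and otherwise h vanishes at both.\<close>
  have uc: "\<bar>h y - h x\<bar> \<le> \<eta>" if "dist x y < min \<rho>0 \<rho>1" for x y
  proof (cases "x \<in> K1 \<or> y \<in> K1")
    case True
    then have "x \<in> K2" "y \<in> K2"
      using near[of x y] near[of y x] that K2(2) interior_subset[of K2] by (auto simp: dist_commute)
    then show ?thesis using \<rho>1(2)[of x y] that by (simp add: dist_real_def dist_commute)
  next
    case False
    then show ?thesis using h(2) \<eta> by simp
  qed
  have hint: "integrable lebesgue h" using X_compact_support_integrable[OF K1(1,3) h(3,2)] .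
  have gint: "integrable lebesgue g" using X_compact_support_integrable[OF K g] .
  have dX: "(\<lambda>x. g x - h x) \<in> X" using X_diff g h by blast
  have d0: "\<forall>x. x \<notin> K1 \<longrightarrow> g x - h x = 0" using g(2) h(2) K1(2) interior_subset by fastforce
  have "\<forall>\<^sub>F e in at_right 0. e \<in> {0<..<min \<rho>0 \<rho>1}"
    using \<rho>0 \<rho>1 by (intro eventually_at_rightI[of 0 "min \<rho>0 \<rho>1"]) auto
  with C(2) show ?thesis
  proof eventually_elim
    case (elim e)
    then have e: "e > 0" "e < \<rho>0" "e < \<rho>1" by auto
    have 1: "mollify e (\<lambda>x. g x - h x) \<in> X" "N (mollify e (\<lambda>x. g x - h x)) \<le> C * N (\<lambda>x. g x - h x)"
      using elim(1)[rule_format, OF dX] d0 by simp_all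
    have ae: "AE x in lebesgue_on \<Omega>. \<bar>mollify e h x - h x\<bar> \<le> \<eta> * indicat_real K2 x"
    proof (rule AE_I2)
      fix x
      show "\<bar>mollify e h x - h x\<bar> \<le> \<eta> * indicat_real K2 x"
      proof (cases "x \<in> K2")
        case True
        then show ?thesis using mollify_close[OF e(1) hint, of x \<eta>] uc[of x] e by simp
      next
        case False
        then have "y \<notin> K1" if "dist x y < e" for y using near[of y x] that e by (auto simp: dist_commute)
        then have "mollify e h x = 0" by (intro mollify_eq_0[OF e(1)] h(2))
        moreover have "h x = 0" using False K2(2) interior_subset by (intro h(2)) blast
        ultimately show ?thesis using False by simp
      qed
    qed
    have mm: "(\<lambda>x. mollify e h x - h x) \<in> borel_measurable (lebesgue_on \<Omega>)"
      using mollify_measurable[OF e(1) hint] X_measurable[OF h(3)] by measurable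
    have 2: "(\<lambda>x. mollify e h x - h x) \<in> X" "N (\<lambda>x. mollify e h x - h x) < \<delta> / 2"
      using X_dominated[OF scale[OF IK] mm ae] norm_scale[OF IK, of \<eta>] \<eta> \<eta>I by auto
    have 3: "(\<lambda>x. h x - g x) \<in> X" "N (\<lambda>x. h x - g x) < \<delta>'"
      using X_diff[OF h(3) g(1)] N_diff_commute[OF h(3) g(1)] h(4) by simp_all
    have eq: "mollify e g x = mollify e (\<lambda>x. g x - h x) x + mollify e h x" for x
      using mollify_diff[OF e(1) gint hint] by simp
    have hX: "mollify e h \<in> X" using add[OF 2(1) h(3)] by simp
    have gX: "mollify e g \<in> X" using add[OF 1(1) hX] by (simp add: eq[abs_def])
    have "N (\<lambda>x. mollify e g x - g x) =
        N (\<lambda>x. mollify e (\<lambda>x. g x - h x) x + ((mollify e h x - h x) + (h x - g x)))"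
      by (simp add: eq add_diff_eq)
    also have "\<dots> \<le> N (mollify e (\<lambda>x. g x - h x)) + (N (\<lambda>x. mollify e h x - h x) + N (\<lambda>x. h x - g x))"
      using norm_triangle[OF 1(1) add[OF 2(1) 3(1)]] norm_triangle[OF 2(1) 3(1)] by simp
    also have "\<dots> < C * \<delta>' + (\<delta> / 2 + \<delta>')"
      using 1(2) 2(2) 3(2) mult_left_mono[OF less_imp_le[OF h(4)] C(1)] by linarith
    also have "\<dots> = \<delta>" using \<delta>' by simp
    finally show ?case using gX by simp
  qed
qed

text \<open>A single scale e serves f and all components of G, so that the mollified G is the weak
  gradient of the mollified f. Taking e so small that the e-balls around K stay in V keeps both
  supported in V.\<close>

lemma local_approximation:
  fixes G :: "real^'n \<Rightarrow> real^'n"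
  assumes K: "compact K" "K \<subseteq> V" and V: "open V" "V \<subseteq> \<Omega>" and \<delta>: "\<delta> > 0"
    and f: "f \<in> X" "\<And>x. x \<notin> K \<Longrightarrow> f x = 0"
    and G: "\<And>j. (\<lambda>x. G x $ j) \<in> X" "\<And>x. x \<notin> K \<Longrightarrow> G x = 0"
    and w: "\<And>j \<psi>. \<psi> \<in> test_functions UNIV \<Longrightarrow>
      (LINT x|lebesgue. f x * partial_derivative j \<psi> x) = - (LINT x|lebesgue. G x $ j * \<psi> x)"
  obtains L u H where "L-lipschitz_on UNIV u" "u \<in> X" "\<And>j. (\<lambda>x. H x $ j) \<in> X"
    "\<And>x. x \<notin> V \<Longrightarrow> u x = 0" "\<And>x. x \<notin> V \<Longrightarrow> H x = 0"
    "\<And>j \<psi>. \<psi> \<in> test_functions UNIV \<Longrightarrow>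
      (LINT x|lebesgue. u x * partial_derivative j \<psi> x) = - (LINT x|lebesgue. H x $ j * \<psi> x)"
    "N (\<lambda>x. u x - f x) < \<delta>" "N (\<lambda>x. norm (H x - G x)) < \<delta>"
proof -
  have K\<Omega>: "K \<subseteq> \<Omega>" using K V by blast
  obtain \<rho> where \<rho>: "\<rho> > 0" "(\<Union>x\<in>K. ball x \<rho>) \<subseteq> V"
    using compact_subset_open_imp_ball_epsilon_subset[OF K(1) V(1) K(2)] by metis
  have G0: "G x $ j = 0" if "x \<notin> K" for x j using G(2)[OF that] by simp
  \<comment> \<open>The error of H is estimated by the sum of its n component errors.\<close>
  define \<delta>' where "\<delta>' = \<delta> / real CARD('n)"
  have \<delta>': "\<delta>' > 0" using \<delta> by (simp add: \<delta>'_def)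
  have "\<forall>\<^sub>F e in at_right 0. e \<in> {0<..<\<rho>}"
    using \<rho> by (intro eventually_at_rightI[of 0 \<rho>]) auto
  moreover have "\<forall>\<^sub>F e in at_right 0. mollify e f \<in> X \<and> N (\<lambda>x. mollify e f x - f x) < \<delta>"
    by (rule mollify_tendsto[OF K(1) K\<Omega> f \<delta>])
  moreover have "\<forall>\<^sub>F e in at_right 0. \<forall>j. mollify e (\<lambda>x. G x $ j) \<in> X \<and>
      N (\<lambda>x. mollify e (\<lambda>x. G x $ j) x - G x $ j) < \<delta>'"
    by (intro eventually_all_finite mollify_tendsto[OF K(1) K\<Omega> G(1) G0 \<delta>'])
  ultimately have "\<forall>\<^sub>F e in at_right 0. e \<in> {0<..<\<rho>} \<and> (mollify e f \<in> X \<and> N (\<lambda>x. mollify e f x - f x) < \<delta>) \<and>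
      (\<forall>j. mollify e (\<lambda>x. G x $ j) \<in> X \<and> N (\<lambda>x. mollify e (\<lambda>x. G x $ j) x - G x $ j) < \<delta>')"
    by eventually_elim blast
  from eventually_happens'[OF trivial_limit_at_right_real this]
  obtain e where e: "e > 0" "e < \<rho>" and ef: "mollify e f \<in> X" "N (\<lambda>x. mollify e f x - f x) < \<delta>"
    and eG: "\<And>j. mollify e (\<lambda>x. G x $ j) \<in> X" "\<And>j. N (\<lambda>x. mollify e (\<lambda>x. G x $ j) x - G x $ j) < \<delta>'"
    by auto
  have int: "integrable lebesgue f" "integrable lebesgue (\<lambda>x. G x $ j)" for j
    by (rule X_compact_support_integrable[OF K(1) K\<Omega> f], assumption)
      (rule X_compact_support_integrable[OF K(1) K\<Omega> G(1) G0], assumption)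
  define H where "H x = (\<chi> j. mollify e (\<lambda>x. G x $ j) x)" for x
  have far: "y \<notin> K" if "x \<notin> V" "dist x y < e" for x y
    using \<rho>(2) that e by (force simp: subset_iff dist_commute)
  obtain L where L: "L-lipschitz_on UNIV (mollify e f)" using mollify_lipschitz[OF e(1) int(1)] .
  show thesis
  proof (rule that[of L "mollify e f" H])
    show "(\<lambda>x. H x $ j) \<in> X" for j using eG(1)[of j] by (simp add: H_def)
    show "mollify e f x = 0" if "x \<notin> V" for x
      using far[OF that] f(2) by (intro mollify_eq_0[OF e(1)]) blast
    show "H x = 0" if "x \<notin> V" for x
      using far[OF that] G0 by (auto simp: H_def vec_eq_iff intro!: mollify_eq_0[OF e(1)])
    show "(LINT x|lebesgue. mollify e f x * partial_derivative j \<psi> x) = - (LINT x|lebesgue. H x $ j * \<psi> x)"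
      if "\<psi> \<in> test_functions UNIV" for j \<psi>
      using mollify_weak_derivative[OF e(1) int(1) int(2)[of j] w that] by (simp add: H_def)
    have "N (\<lambda>x. norm (H x - G x)) \<le> (\<Sum>j\<in>UNIV. N (\<lambda>x. (H x - G x) $ j))"
      by (rule X_norm_vec) (use X_diff[OF eG(1) G(1)] in \<open>simp add: H_def\<close>)
    also have "\<dots> < (\<Sum>j\<in>(UNIV :: 'n set). \<delta>')"
      using eG(2) by (intro sum_strict_mono) (auto simp: H_def)
    also have "\<dots> = \<delta>" by (simp add: \<delta>'_def)
    finally show "N (\<lambda>x. norm (H x - G x)) < \<delta>" .
  qed (rule L, rule ef, rule ef)
qed

end

section \<open>Density of locally Lipschitz functions\<close>

lemma test_functions_mono: "U \<subseteq> V \<Longrightarrow> test_functions U \<subseteq> test_functions V"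
  by (auto simp: test_functions_def)

lemma test_functions_zero: "\<phi> \<in> test_functions U \<Longrightarrow> x \<notin> closure {x. \<phi> x \<noteq> 0} \<Longrightarrow> \<phi> x = 0"
  using closure_subset[of "{x. \<phi> x \<noteq> 0}"] by blast

text \<open>The support of \<phi> is a compact subset of \<Omega>, so the product does not see f
  elsewhere, and integrals over \<Omega> become the whole-space integrals in which mollification is
  phrased.\<close>

lemma L1_loc_test_integral:
  assumes f: "f \<in> L1_loc \<Omega>" and \<phi>: "\<phi> \<in> test_functions \<Omega>" and \<Omega>: "\<Omega> \<in> sets lebesgue"
  shows "integrable lebesgue (\<lambda>x. f x * \<phi> x)"
    and "(LINT x|lebesgue_on \<Omega>. f x * \<phi> x) = (LINT x|lebesgue. f x * \<phi> x)"
proof -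
  let ?K = "closure {x. \<phi> x \<noteq> 0}"
  have K: "compact ?K" "?K \<subseteq> \<Omega>" using \<phi> by (auto simp: test_functions_def)
  have z: "\<phi> x = 0" if "x \<notin> ?K" for x using test_functions_zero[OF \<phi> that] .
  obtain B where B: "\<And>x. \<bar>\<phi> x\<bar> \<le> B" using test_function_bounded[OF \<phi>] by blast
  have "integrable (lebesgue_on ?K) f" using f K by (simp add: L1_loc_def)
  then have "integrable lebesgue (\<lambda>x. indicat_real ?K x * f x)"
    by (simp add: integrable_lebesgue_on)
  from integrable_bounded_mult[OF this continuous_lebesgue_measurable[OF test_functions_continuous[OF \<phi>]] B]
  have "integrable lebesgue (\<lambda>x. \<phi> x * (indicat_real ?K x * f x))" .
  moreover have "\<phi> x * (indicat_real ?K x * f x) = f x * \<phi> x" for x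
    using z[of x] by (cases "x \<in> ?K") auto
  ultimately show "integrable lebesgue (\<lambda>x. f x * \<phi> x)" by simp
  have "(\<lambda>x. indicat_real \<Omega> x * (f x * \<phi> x)) = (\<lambda>x. f x * \<phi> x)"
  proof
    fix x
    show "indicat_real \<Omega> x * (f x * \<phi> x) = f x * \<phi> x"
      using z[of x] K(2) by (cases "x \<in> \<Omega>") auto
  qed
  then show "(LINT x|lebesgue_on \<Omega>. f x * \<phi> x) = (LINT x|lebesgue. f x * \<phi> x)"
    by (simp only: integral_lebesgue_on[OF \<Omega>])
qed

text \<open>Testing with \<open>\<theta> x * \<psi> x\<close> moves the cutoff from the test
  function to f by the product rule. As \<theta> is supported in \<Omega>, \<psi> may range over the
  whole space, the form used by \<open>mollify_weak_derivative\<close>.\<close>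

lemma weak_gradient_localize:
  assumes w: "weak_gradient \<Omega> f G" and \<theta>: "\<theta> \<in> test_functions \<Omega>" and \<psi>: "\<psi> \<in> test_functions UNIV"
    and \<Omega>: "\<Omega> \<in> sets lebesgue"
  shows "(LINT x|lebesgue. \<theta> x * f x * partial_derivative j \<psi> x) =
    - (LINT x|lebesgue. (\<theta> x * G x $ j + f x * partial_derivative j \<theta> x) * \<psi> x)"
proof -
  have s: "smooth \<theta>" "smooth \<psi>" using \<theta> \<psi> by (auto simp: test_functions_def)
  have f: "f \<in> L1_loc \<Omega>" and G: "(\<lambda>x. G x $ j) \<in> L1_loc \<Omega>" using w by (auto simp: weak_gradient_def)
  note \<theta>\<psi> = test_functions_mult[OF \<theta> s(2)]
  note \<theta>d = test_functions_mult[OF \<theta> partial_derivative_smooth[OF s(2), of j]]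
  note d\<theta> = test_functions_mult[OF partial_derivative_test_function[OF \<theta>, of j] s(2)]
  have pd: "partial_derivative j (\<lambda>x. \<theta> x * \<psi> x) = (\<lambda>x. \<theta> x * partial_derivative j \<psi> x + partial_derivative j \<theta> x * \<psi> x)"
    by (rule partial_derivative_mult[OF smooth_imp_differentiable[OF s(1)] smooth_imp_differentiable[OF s(2)]])
  have "(LINT x|lebesgue. f x * partial_derivative j (\<lambda>x. \<theta> x * \<psi> x) x) = - (LINT x|lebesgue. G x $ j * (\<theta> x * \<psi> x))"
    using w \<theta>\<psi> L1_loc_test_integral(2)[OF f partial_derivative_test_function[OF \<theta>\<psi>, of j] \<Omega>]
      L1_loc_test_integral(2)[OF G \<theta>\<psi> \<Omega>] by (simp add: weak_gradient_def)
  moreover have "(LINT x|lebesgue. f x * partial_derivative j (\<lambda>x. \<theta> x * \<psi> x) x) =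
      (LINT x|lebesgue. f x * (\<theta> x * partial_derivative j \<psi> x)) + (LINT x|lebesgue. f x * (partial_derivative j \<theta> x * \<psi> x))"
    unfolding pd distrib_left
    by (rule Bochner_Integration.integral_add[OF L1_loc_test_integral(1)[OF f \<theta>d \<Omega>] L1_loc_test_integral(1)[OF f d\<theta> \<Omega>]])
  moreover have "(LINT x|lebesgue. (\<theta> x * G x $ j + f x * partial_derivative j \<theta> x) * \<psi> x) =
     (LINT x|lebesgue. G x $ j * (\<theta> x * \<psi> x)) + (LINT x|lebesgue. f x * (partial_derivative j \<theta> x * \<psi> x))"
    by (subst Bochner_Integration.integral_add[OF L1_loc_test_integral(1)[OF G \<theta>\<psi> \<Omega>] L1_loc_test_integral(1)[OF f d\<theta> \<Omega>], symmetric])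
      (simp add: algebra_simps)
  ultimately show ?thesis by (simp add: mult_ac)
qed

lemma lipschitz_on_sum:
  fixes u :: "nat \<Rightarrow> 'a::metric_space \<Rightarrow> real"
  assumes "\<And>k. \<exists>L. L-lipschitz_on S (u k)"
  shows "\<exists>L. L-lipschitz_on S (\<lambda>x. \<Sum>k<n. u k x)"
proof (induction n)
  case 0
  have "0-lipschitz_on S (\<lambda>x. \<Sum>k<0. u k x)" by (rule lipschitz_onI) auto
  then show ?case by blast
next
  case (Suc n)
  then obtain L where "L-lipschitz_on S (\<lambda>x. \<Sum>k<n. u k x)" by blast
  moreover obtain L' where "L'-lipschitz_on S (u n)" using assms by blast
  ultimately have "(L + L')-lipschitz_on S (\<lambda>x. (\<Sum>k<n. u k x) + u n x)" by (rule lipschitz_on_add)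
  then show ?case by auto
qed

text \<open>
  The functions \<open>\<theta> k\<close> are differences of consecutive cutoffs along an exhaustion of \<open>\<Omega>\<close> by the
  compact sets \<open>C k\<close>.
\<close>

lemma locally_finite_partition_of_unity:
  fixes \<Omega> :: "(real^'n) set"
  assumes "open \<Omega>"
  obtains C V :: "nat \<Rightarrow> (real^'n) set" and \<theta> :: "nat \<Rightarrow> real^'n \<Rightarrow> real"
  where "\<And>m. C m \<subseteq> interior (C (Suc m))" "(\<Union>m. C m) = \<Omega>"
    "\<And>K. compact K \<Longrightarrow> K \<subseteq> \<Omega> \<Longrightarrow> \<exists>m. K \<subseteq> C m"
    "\<And>k. open (V k)" "\<And>k. V k \<subseteq> \<Omega>" "\<And>k m. m + 2 \<le> k \<Longrightarrow> V k \<inter> C m = {}"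
    "\<And>k. \<theta> k \<in> test_functions (V k)"
    "\<And>m n x. m + 2 \<le> n \<Longrightarrow> x \<in> C m \<Longrightarrow> (\<Sum>k<n. \<theta> k x) = 1"
    "\<And>m n x j. m + 2 \<le> n \<Longrightarrow> x \<in> C m \<Longrightarrow> (\<Sum>k<n. partial_derivative j (\<theta> k) x) = 0"
proof -
  obtain C :: "nat \<Rightarrow> (real^'n) set" where C: "\<And>n. compact (C n)" "\<And>n. C n \<subseteq> \<Omega>" "\<And>n. C n \<subseteq> interior (C (Suc n))"
    "\<Union>(range C) = \<Omega>" "\<And>K. compact K \<Longrightarrow> K \<subseteq> \<Omega> \<Longrightarrow> \<exists>N. \<forall>n\<ge>N. K \<subseteq> C n"
    using open_Union_compact_subsets[OF assms] by metis
  have Cmono: "C m \<subseteq> C n" if "m \<le> n" for m n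
    using that by (rule lift_Suc_mono_le[rotated]) (use C(3) interior_subset in blast)
  have Cint: "C m \<subseteq> interior (C n)" if "Suc m \<le> n" for m n
    using C(3)[of m] interior_mono[OF Cmono[OF that]] by blast
  have "\<exists>\<eta>. \<eta> \<in> test_functions (interior (C (Suc k))) \<and> (\<forall>x\<in>C k. \<eta> x = 1)" for k
    by (rule smooth_cutoff[OF C(1) open_interior C(3)]) blast
  then obtain \<eta> where \<eta>: "\<And>k. \<eta> k \<in> test_functions (interior (C (Suc k)))" "\<And>k x. x \<in> C k \<Longrightarrow> \<eta> k x = 1"
    by metis
  have \<eta>s: "smooth (\<eta> k)" for k using \<eta>(1)[of k] by (simp add: test_functions_def)
  define \<theta> where "\<theta> k x = \<eta> k x - (if k = 0 then 0 else \<eta> (k - 1) x)" for k x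
  \<comment> \<open>\<open>\<theta> k\<close> vanishes on \<open>C (k - 1)\<close>, so its closed
    support misses the interior of that set, which contains \<open>C m\<close> once m + 2 \<le>
    k.\<close>
  define V where "V k = interior (C (Suc k)) - (\<Union>m\<in>{m. m + 2 \<le> k}. C m)" for k
  have \<theta>s: "smooth (\<theta> k)" for k
    using \<eta>s[of k] \<eta>s[of "k - 1"] unfolding \<theta>_def[abs_def]
    by (cases k) (auto intro: continuously_differentiable_diff)
  have V: "open (V k)" for k
  proof -
    have "finite {m. m + 2 \<le> k}" by (rule finite_subset[of _ "{..k}"]) auto
    then show ?thesis unfolding V_def using C(1) by (intro open_Diff closed_UN) (auto intro: compact_imp_closed)
  qed
  have \<theta>V: "\<theta> k \<in> test_functions (V k)" for k
  proof -
    let ?S = "closure {x. \<theta> k x \<noteq> 0}"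
    have ind: "closure {x. \<eta> l x \<noteq> 0} \<subseteq> interior (C (Suc k))" if "l \<le> k" for l
      using \<eta>(1)[of l] interior_mono[OF Cmono[of "Suc l" "Suc k"]] that by (auto simp: test_functions_def)
    have sub: "{x. \<theta> k x \<noteq> 0} \<subseteq> closure {x. \<eta> k x \<noteq> 0} \<union> closure {x. \<eta> (k - 1) x \<noteq> 0}"
    proof
      fix x assume "x \<in> {x. \<theta> k x \<noteq> 0}"
      then have "x \<in> {x. \<eta> k x \<noteq> 0} \<or> x \<in> {x. \<eta> (k - 1) x \<noteq> 0}"
        by (auto simp: \<theta>_def split: if_splits)
      then show "x \<in> closure {x. \<eta> k x \<noteq> 0} \<union> closure {x. \<eta> (k - 1) x \<noteq> 0}"
        using closure_subset[of "{x. \<eta> k x \<noteq> 0}"] closure_subset[of "{x. \<eta> (k - 1) x \<noteq> 0}"] by blast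
    qed
    have S1: "?S \<subseteq> closure {x. \<eta> k x \<noteq> 0} \<union> closure {x. \<eta> (k - 1) x \<noteq> 0}"
      using sub by (rule closure_minimal) auto
    then have S2: "?S \<subseteq> interior (C (Suc k))" using ind[of k] ind[of "k - 1"] by auto
    then have "?S \<subseteq> C (Suc k)" using interior_subset by blast
    then have comp: "compact ?S" using C(1)
      by (meson bounded_subset closed_closure compact_eq_bounded_closed)
    have "?S \<inter> C m = {}" if "m + 2 \<le> k" for m
    proof -
      have "\<theta> k x = 0" if x: "x \<in> C (k - 1)" for x
        using \<eta>(2)[OF x] \<eta>(2)[of x k] Cmono[of "k - 1" k] x \<open>m + 2 \<le> k\<close> by (auto simp: \<theta>_def)
      then have "{x. \<theta> k x \<noteq> 0} \<subseteq> - interior (C (k - 1))" using interior_subset by blast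
      then have "?S \<subseteq> - interior (C (k - 1))" by (rule closure_minimal) auto
      moreover have "C m \<subseteq> interior (C (k - 1))" using that by (intro Cint) simp
      ultimately show ?thesis by blast
    qed
    then show ?thesis using S2 comp \<theta>s by (auto simp: test_functions_def V_def)
  qed
  \<comment> \<open>The sum telescopes to the last cutoff.\<close>
  have sum\<theta>: "(\<Sum>k<Suc n. \<theta> k x) = \<eta> n x" for n x
    by (induction n) (auto simp: \<theta>_def)
  show thesis
  proof (rule that[of C V \<theta>])
    show "C m \<subseteq> interior (C (Suc m))" for m by (rule C(3))
    show "(\<Union>m. C m) = \<Omega>" by (rule C(4))
    show "\<exists>m. K \<subseteq> C m" if "compact K" "K \<subseteq> \<Omega>" for K using C(5)[OF that] by blast
    show "open (V k)" for k by (rule V)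
    show "V k \<subseteq> \<Omega>" for k using C(2)[of "Suc k"] interior_subset[of "C (Suc k)"] by (auto simp: V_def)
    show "V k \<inter> C m = {}" if "m + 2 \<le> k" for k m using that by (auto simp: V_def)
    show "\<theta> k \<in> test_functions (V k)" for k by (rule \<theta>V)
    fix m n :: nat and x :: "real^'n" assume n: "m + 2 \<le> n" and x: "x \<in> C m"
    obtain n' where n': "n = Suc n'" "Suc m \<le> n'" using n by (cases n) auto
    show "(\<Sum>k<n. \<theta> k x) = 1" unfolding n' sum\<theta> using \<eta>(2) Cmono[of m n'] n' x by auto
    fix j
    have "partial_derivative j (\<lambda>y. \<Sum>k<l. \<theta> k y) x = (\<Sum>k<l. partial_derivative j (\<theta> k) x)
      \<and> (\<lambda>y. \<Sum>k<l. \<theta> k y) differentiable_on UNIV" for l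
    proof (induction l)
      case 0
      have "continuously_differentiable 1 (\<lambda>y::real^'n. 0)" by (rule continuously_differentiable_const)
      moreover have "partial_derivative j (\<lambda>y. 0) x = 0"
        by (rule partial_derivative_locally_zero[of UNIV _ _ 0]) auto
      ultimately show ?case by simp
    next
      case (Suc l)
      then show ?case
        using partial_derivative_add[of "\<lambda>y. \<Sum>k<l. \<theta> k y" "\<theta> l" j] smooth_imp_differentiable[OF \<theta>s[of l]]
        by (simp add: differentiable_on_add)
    qed
    then have "(\<Sum>k<n. partial_derivative j (\<theta> k) x) = partial_derivative j (\<lambda>y. \<Sum>k<n. \<theta> k y) x" by simp
    also have "\<dots> = partial_derivative j (\<eta> n') x" unfolding n' sum\<theta> by simp
    \<comment> \<open>The derivative needs \<open>\<eta> n'\<close> to be 1 on an open set around x: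
      m + 2 \<le> n places x in the interior of \<open>C n'\<close>.\<close>
    also have "\<dots> = 0"
      using Cint[OF n'(2)] x \<eta>(2) interior_subset[of "C n'"]
      by (intro partial_derivative_locally_zero[of "interior (C n')" _ _ 1]) auto
    finally show "(\<Sum>k<n. partial_derivative j (\<theta> k) x) = 0" .
  qed
qed

context muckenhoupt_space
begin

section \<open>Limits of weak gradients: the inclusion of H in W\<close>

lemma X_test_integral:
  assumes "f \<in> X" "\<phi> \<in> test_functions \<Omega>"
  shows "integrable lebesgue (\<lambda>x. f x * \<phi> x)"
    and "(LINT x|lebesgue_on \<Omega>. f x * \<phi> x) = (LINT x|lebesgue. f x * \<phi> x)"
  using L1_loc_test_integral[OF _ assms(2) sets_domain] X_subset_L1_loc assms(1) by blast+

text \<open>The integrals differ by at most the supremum bound of \<phi>, times the constant of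
  \<open>compact_bound\<close> on its support, times the norm of the difference.\<close>

lemma test_integral_tendsto:
  assumes u: "\<And>k. u k \<in> X" and f: "f \<in> X" and lim: "(\<lambda>k. N (\<lambda>x. u k x - f x)) \<longlonglongrightarrow> 0"
    and \<phi>: "\<phi> \<in> test_functions \<Omega>"
  shows "(\<lambda>k. LINT x|lebesgue_on \<Omega>. u k x * \<phi> x) \<longlonglongrightarrow> (LINT x|lebesgue_on \<Omega>. f x * \<phi> x)"
proof -
  let ?K = "closure {x. \<phi> x \<noteq> 0}"
  have K: "compact ?K" "?K \<subseteq> \<Omega>" using \<phi> by (auto simp: test_functions_def)
  obtain B where B: "\<And>x. \<bar>\<phi> x\<bar> \<le> B" using test_function_bounded[OF \<phi>] by blast
  have B0: "B \<ge> 0" using B[of 0] by linarith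
  obtain C where C: "C \<ge> 0" "\<And>f. f \<in> X \<Longrightarrow> integrable lebesgue (\<lambda>x. indicat_real ?K x * f x)"
    "\<And>f. f \<in> X \<Longrightarrow> (LINT x|lebesgue. indicat_real ?K x * \<bar>f x\<bar>) \<le> C * N f"
    using compact_bound[OF K] by blast
  have d: "(\<lambda>x. u k x - f x) \<in> X" for k using X_diff u f by blast
  have bound: "\<bar>(LINT x|lebesgue_on \<Omega>. u k x * \<phi> x) - (LINT x|lebesgue_on \<Omega>. f x * \<phi> x)\<bar>
      \<le> B * C * N (\<lambda>x. u k x - f x)" for k
  proof -
    have "(LINT x|lebesgue_on \<Omega>. u k x * \<phi> x) - (LINT x|lebesgue_on \<Omega>. f x * \<phi> x) =
        (LINT x|lebesgue. u k x * \<phi> x - f x * \<phi> x)"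
      unfolding X_test_integral(2)[OF u \<phi>] X_test_integral(2)[OF f \<phi>]
      by (rule Bochner_Integration.integral_diff[OF X_test_integral(1)[OF u \<phi>] X_test_integral(1)[OF f \<phi>], symmetric])
    also have "\<dots> = (LINT x|lebesgue. (u k x - f x) * \<phi> x)" by (simp add: left_diff_distrib)
    also have "norm \<dots> \<le> (LINT x|lebesgue. B * (indicat_real ?K x * \<bar>u k x - f x\<bar>))"
    proof (rule Bochner_Integration.integral_norm_bound_integral)
      show "integrable lebesgue (\<lambda>x. (u k x - f x) * \<phi> x)" by (rule X_test_integral(1)[OF d \<phi>])
      show "integrable lebesgue (\<lambda>x. B * (indicat_real ?K x * \<bar>u k x - f x\<bar>))"
        by (intro integrable_mult_right C(2) X_abs(1) d)
      fix x
      show "norm ((u k x - f x) * \<phi> x) \<le> B * (indicat_real ?K x * \<bar>u k x - f x\<bar>)"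
      proof (cases "x \<in> ?K")
        case True
        then show ?thesis using mult_right_mono[OF B, of "\<bar>u k x - f x\<bar>" x] by (simp add: abs_mult mult.commute)
      next
        case False
        then show ?thesis using test_functions_zero[OF \<phi> False] by simp
      qed
    qed
    also have "\<dots> \<le> B * (C * N (\<lambda>x. u k x - f x))"
      using C(3)[OF d[of k]] B0 by (simp add: mult_left_mono)
    finally show ?thesis by (simp add: mult.assoc)
  qed
  have "(\<lambda>k. B * C * N (\<lambda>x. u k x - f x)) \<longlonglongrightarrow> 0"
    using tendsto_mult_left[OF lim, of "B * C"] by simp
  then have "(\<lambda>k. (LINT x|lebesgue_on \<Omega>. u k x * \<phi> x) - (LINT x|lebesgue_on \<Omega>. f x * \<phi> x)) \<longlonglongrightarrow> 0"
    by (rule Lim_null_comparison[rotated]) (intro always_eventually allI, unfold real_norm_def, rule bound)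
  then show ?thesis by (rule LIM_zero_cancel)
qed

lemma W1X_norm_tendsto:
  assumes "\<And>k. u k \<in> X" "f \<in> X" "\<And>k j. (\<lambda>x. V k x $ j) \<in> X" "\<And>j. (\<lambda>x. G x $ j) \<in> X"
    and lim: "(\<lambda>k. W1X_norm N (\<lambda>x. u k x - f x) (\<lambda>x. V k x - G x :: real^'n)) \<longlonglongrightarrow> 0"
  shows "(\<lambda>k. N (\<lambda>x. u k x - f x)) \<longlonglongrightarrow> 0" "(\<lambda>k. N (\<lambda>x. V k x $ j - G x $ j)) \<longlonglongrightarrow> 0"
proof -
  have d: "(\<lambda>x. u k x - f x) \<in> X" "(\<lambda>x. (V k x - G x) $ j) \<in> X" for k j
    using X_diff assms by simp_all
  have n0: "N (\<lambda>x. u k x - f x) \<ge> 0" "N (\<lambda>x. (V k x - G x) $ j) \<ge> 0" "N (\<lambda>x. norm (V k x - G x)) \<ge> 0" for k j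
    using norm_nonneg d X_norm_vec(1)[of "\<lambda>x. V k x - G x"] by auto
  have le: "N (\<lambda>x. (V k x - G x) $ j) \<le> N (\<lambda>x. norm (V k x - G x))" for k
    by (rule X_norm_vec(3)) (rule d)
  show "(\<lambda>k. N (\<lambda>x. u k x - f x)) \<longlonglongrightarrow> 0"
    by (rule tendsto_sandwich[OF _ _ tendsto_const lim]) (use n0 in \<open>auto simp: W1X_norm_def\<close>)
  have "N (\<lambda>x. (V k x - G x) $ j) \<le> W1X_norm N (\<lambda>x. u k x - f x) (\<lambda>x. V k x - G x)" for k
    using le[of k] n0(1)[of k] by (simp add: W1X_norm_def)
  then have "(\<lambda>k. N (\<lambda>x. (V k x - G x) $ j)) \<longlonglongrightarrow> 0"
    using n0(2) by (intro tendsto_sandwich[OF _ _ tendsto_const lim]) auto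
  then show "(\<lambda>k. N (\<lambda>x. V k x $ j - G x $ j)) \<longlonglongrightarrow> 0" by simp
qed

lemma H1X_subset_W1X: "H1X \<Omega> X N \<subseteq> W1X \<Omega> X"
proof (rule subrelI)
  fix f G assume "(f, G) \<in> H1X \<Omega> X N"
  then obtain u V where f: "f \<in> X" and G: "\<And>j. (\<lambda>x. G x $ j) \<in> X"
    and uV: "\<And>k. (u k, V k) \<in> W1X \<Omega> X"
    and lim: "(\<lambda>k. W1X_norm N (\<lambda>x. u k x - f x) (\<lambda>x. V k x - G x)) \<longlonglongrightarrow> 0"
    unfolding H1X_def by auto
  have u: "u k \<in> X" and V: "(\<lambda>x. V k x $ j) \<in> X" and w: "weak_gradient \<Omega> (u k) (V k)" for k j
    using uV[of k] by (auto simp: W1X_def)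
  note l = W1X_norm_tendsto[OF u f V G lim]
  have "(LINT x|lebesgue_on \<Omega>. f x * partial_derivative j \<phi> x) = - (LINT x|lebesgue_on \<Omega>. G x $ j * \<phi> x)"
    if \<phi>: "\<phi> \<in> test_functions \<Omega>" for j \<phi>
  proof (rule LIMSEQ_unique)
    show "(\<lambda>k. LINT x|lebesgue_on \<Omega>. u k x * partial_derivative j \<phi> x) \<longlonglongrightarrow> (LINT x|lebesgue_on \<Omega>. f x * partial_derivative j \<phi> x)"
      by (rule test_integral_tendsto[OF u f l(1) partial_derivative_test_function[OF \<phi>]])
    have "(LINT x|lebesgue_on \<Omega>. u k x * partial_derivative j \<phi> x) = - (LINT x|lebesgue_on \<Omega>. V k x $ j * \<phi> x)" for k
      using w[of k] \<phi> by (simp add: weak_gradient_def)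
    then show "(\<lambda>k. LINT x|lebesgue_on \<Omega>. u k x * partial_derivative j \<phi> x) \<longlonglongrightarrow> - (LINT x|lebesgue_on \<Omega>. G x $ j * \<phi> x)"
      using tendsto_minus[OF test_integral_tendsto[OF V G l(2) \<phi>]] by simp
  qed
  then show "(f, G) \<in> W1X \<Omega> X"
    using f G X_subset_L1_loc by (auto simp: W1X_def weak_gradient_def)
qed

section \<open>Gluing local approximants: the inclusion of W in H\<close>

lemma X_locally_finite_sum:
  assumes d: "\<And>k. d k \<in> X" "\<And>k. N (d k) \<le> \<delta> / 2 ^ Suc k"
    and D: "\<And>x. x \<in> \<Omega> \<Longrightarrow> \<exists>n0. \<forall>n\<ge>n0. D x = (\<Sum>k<n. d k x)"
  shows "D \<in> X" "N D \<le> \<delta>"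
proof -
  \<comment> \<open>The Fatou property asks for an increasing sequence, so it is applied to sums of
    absolute values, whose limit then dominates D.\<close>
  let ?S = "\<lambda>n x. \<Sum>k<n. \<bar>d k x\<bar>"
  have SX: "?S n \<in> X" for n by (intro X_sum X_abs d)
  have NS: "N (?S n) \<le> \<delta>" for n
  proof -
    have "\<delta> \<ge> 0" using d(2)[of 0] norm_nonneg[OF d(1)[of 0]] by simp
    have "N (?S n) \<le> (\<Sum>k<n. N (\<lambda>x. \<bar>d k x\<bar>))" by (intro N_sum X_abs d)
    also have "\<dots> \<le> (\<Sum>k<n. \<delta> / 2 ^ Suc k)" using d X_abs by (intro sum_mono) auto
    also have "\<dots> = \<delta> * (1 - 1 / 2 ^ n)" by (induction n) (auto simp: field_simps)
    also have "\<dots> \<le> \<delta>" using \<open>\<delta> \<ge> 0\<close> by (simp add: mult_left_le)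
    finally show ?thesis .
  qed
  define S where "S x = (\<Sum>k. \<bar>d k x\<bar>)" for x
  have conv: "(\<lambda>n. ?S n x) \<longlonglongrightarrow> S x" if x: "x \<in> \<Omega>" for x
  proof -
    obtain n0 where n0: "\<And>n. n \<ge> n0 \<Longrightarrow> D x = (\<Sum>k<n. d k x)" using D[OF x] by blast
    \<comment> \<open>Consecutive partial sums differ by \<open>d k x\<close> and are equal from
      \<open>n0\<close> on, so absolute convergence at x is a matter of finitely many terms.\<close>
    have "d k x = 0" if "k \<notin> {..<n0}" for k
      using n0[of k] n0[of "Suc k"] that by simp
    then have "summable (\<lambda>k. \<bar>d k x\<bar>)" by (intro summable_finite[of "{..<n0}"]) auto
    then show ?thesis unfolding S_def by (rule summable_LIMSEQ)
  qed
  have "S \<in> X \<and> (\<lambda>n. N (?S n)) \<longlonglongrightarrow> N S"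
  proof (rule fatou[unfolded fatou_property_def, rule_format], intro conjI allI)
    show "?S n \<in> X" for n by (rule SX)
    show "AE x in lebesgue_on \<Omega>. 0 \<le> ?S 0 x \<and> incseq (\<lambda>n. ?S n x)"
      by (intro AE_I2 conjI incseq_SucI) auto
    show "bdd_above (range (\<lambda>n. N (?S n)))" using NS by (intro bdd_aboveI2)
    show "AE x in lebesgue_on \<Omega>. (\<lambda>n. ?S n x) \<longlonglongrightarrow> S x" using conv by (intro AE_I2) simp
  qed
  then have S: "S \<in> X" "N S \<le> \<delta>" using NS LIMSEQ_le_const2[of "\<lambda>n. N (?S n)" "N S" \<delta>] by auto
  have lim: "(\<lambda>n. \<Sum>k<n. d k x) \<longlonglongrightarrow> D x" if "x \<in> \<Omega>" for x
  proof (rule tendsto_eventually)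
    show "\<forall>\<^sub>F n in sequentially. (\<Sum>k<n. d k x) = D x"
      using D[OF that] unfolding eventually_sequentially by metis
  qed
  have m: "D \<in> borel_measurable (lebesgue_on \<Omega>)"
    by (rule borel_measurable_LIMSEQ_real[where u="\<lambda>n x. \<Sum>k<n. d k x"])
       (use lim X_measurable[OF X_sum[OF d(1)]] in auto)
  have "\<bar>D x\<bar> \<le> S x" if "x \<in> \<Omega>" for x
    by (rule tendsto_le[OF sequentially_bot conv[OF that] tendsto_rabs[OF lim[OF that]]])
       (intro always_eventually allI sum_abs)
  then have "AE x in lebesgue_on \<Omega>. \<bar>D x\<bar> \<le> S x" by (intro AE_I2) simp
  from X_dominated[OF S(1) m this] S(2) show "D \<in> X" "N D \<le> \<delta>" by auto
qed

text \<open>The k-th piece is approximated within \<delta> / 2^(k+1), without leaving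
  \<open>V k\<close>, and the approximants are added up. The gradient errors are summed by
  components, hence the factor \<open>CARD('n)\<close>.\<close>

lemma Lipschitz_dense:
  fixes G :: "real^'n \<Rightarrow> real^'n"
  assumes fG: "(f, G) \<in> W1X \<Omega> X" and \<delta>: "\<delta> > 0"
  obtains u H where "u \<in> locally_Lipschitz \<Omega>" "(u, H) \<in> W1X \<Omega> X"
    "N (\<lambda>x. u x - f x) \<le> \<delta>" "N (\<lambda>x. norm (H x - G x)) \<le> real CARD('n) * \<delta>"
proof -
  have f: "f \<in> X" and G: "\<And>j. (\<lambda>x. G x $ j) \<in> X" and w: "weak_gradient \<Omega> f G"
    using fG by (auto simp: W1X_def)
  obtain C V :: "nat \<Rightarrow> (real^'n) set" and \<theta> :: "nat \<Rightarrow> real^'n \<Rightarrow> real"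
    where C: "\<And>m. C m \<subseteq> interior (C (Suc m))" "(\<Union>m. C m) = \<Omega>"
    "\<And>K. compact K \<Longrightarrow> K \<subseteq> \<Omega> \<Longrightarrow> \<exists>m. K \<subseteq> C m"
    and V: "\<And>k. open (V k)" "\<And>k. V k \<subseteq> \<Omega>" "\<And>k m. m + 2 \<le> k \<Longrightarrow> V k \<inter> C m = {}"
    and \<theta>: "\<And>k. \<theta> k \<in> test_functions (V k)"
    and \<theta>1: "\<And>m n x. m + 2 \<le> n \<Longrightarrow> x \<in> C m \<Longrightarrow> (\<Sum>k<n. \<theta> k x) = 1"
    and d\<theta>: "\<And>m n x j. m + 2 \<le> n \<Longrightarrow> x \<in> C m \<Longrightarrow> (\<Sum>k<n. partial_derivative j (\<theta> k) x) = 0"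
    by (rule locally_finite_partition_of_unity[OF open_domain]) blast
  define fk where "fk k x = \<theta> k x * f x" for k x
  \<comment> \<open>The weak gradient of \<open>fk k\<close> in the form delivered by
    \<open>weak_gradient_localize\<close>.\<close>
  define Gk where "Gk k x = (\<chi> j. \<theta> k x * G x $ j + f x * partial_derivative j (\<theta> k) x)" for k x
  define P where "P k u H \<longleftrightarrow> (\<exists>L. L-lipschitz_on UNIV u) \<and> u \<in> X \<and> (\<forall>j. (\<lambda>x. H x $ j) \<in> X) \<and>
    (\<forall>x. x \<notin> V k \<longrightarrow> u x = 0 \<and> H x = 0) \<and>
    (\<forall>j. \<forall>\<psi>\<in>test_functions UNIV.
      (LINT x|lebesgue. u x * partial_derivative j \<psi> x) = - (LINT x|lebesgue. H x $ j * \<psi> x)) \<and>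
    N (\<lambda>x. u x - fk k x) < \<delta> / 2 ^ Suc k \<and> N (\<lambda>x. norm (H x - Gk k x)) < \<delta> / 2 ^ Suc k"
    for k and u :: "real^'n \<Rightarrow> real" and H :: "real^'n \<Rightarrow> real^'n"
  have mult_X: "(\<lambda>x. \<phi> x * g x) \<in> X" if g: "g \<in> X" and \<phi>: "\<phi> \<in> test_functions U" for g \<phi> U
  proof -
    obtain B where "\<And>x. \<bar>\<phi> x\<bar> \<le> B" using test_function_bounded[OF \<phi>] by blast
    then show ?thesis
      by (intro X_bounded_mult[OF g] lebesgue_measurable_on_domain continuous_lebesgue_measurable
          test_functions_continuous[OF \<phi>])
  qed
  note d\<theta>_test = partial_derivative_test_function[OF \<theta>]
  have fkX: "fk k \<in> X" for k unfolding fk_def[abs_def] by (rule mult_X[OF f \<theta>])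
  have GkX: "(\<lambda>x. Gk k x $ j) \<in> X" for k j
    unfolding Gk_def using add[OF mult_X[OF G \<theta>] mult_X[OF f d\<theta>_test]] by (simp add: mult.commute)
  have "\<exists>u H. P k u H" for k
  proof -
    let ?K = "closure {x. \<theta> k x \<noteq> 0}"
    have K: "compact ?K" "?K \<subseteq> V k" using \<theta>[of k] by (auto simp: test_functions_def)
    have z: "\<theta> k x = 0" "partial_derivative j (\<theta> k) x = 0" if "x \<notin> ?K" for x j
    proof -
      show "\<theta> k x = 0" by (rule test_functions_zero[OF \<theta> that])
      show "partial_derivative j (\<theta> k) x = 0" by (rule partial_derivative_outside_support[OF that])
    qed
    have "\<theta> k \<in> test_functions \<Omega>" using \<theta> test_functions_mono[OF V(2)] by blast
    note wk = weak_gradient_localize[OF w this _ sets_domain]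
    obtain L u H where "L-lipschitz_on UNIV u" "u \<in> X" "\<And>j. (\<lambda>x. H x $ j) \<in> X"
      "\<And>x. x \<notin> V k \<Longrightarrow> u x = 0" "\<And>x. x \<notin> V k \<Longrightarrow> H x = 0"
      "\<And>j \<psi>. \<psi> \<in> test_functions UNIV \<Longrightarrow>
      (LINT x|lebesgue. u x * partial_derivative j \<psi> x) = - (LINT x|lebesgue. H x $ j * \<psi> x)"
      "N (\<lambda>x. u x - fk k x) < \<delta> / 2 ^ Suc k" "N (\<lambda>x. norm (H x - Gk k x)) < \<delta> / 2 ^ Suc k"
    proof (rule local_approximation[OF K V(1) V(2) _ fkX _ GkX])
      show "0 < \<delta> / 2 ^ Suc k" using \<delta> by simp
      show "fk k x = 0" if "x \<notin> ?K" for x using z[OF that] by (simp add: fk_def)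
      show "Gk k x = 0" if "x \<notin> ?K" for x using z[OF that] by (simp add: Gk_def vec_eq_iff)
      show "(LINT x|lebesgue. fk k x * partial_derivative j \<psi> x) = - (LINT x|lebesgue. Gk k x $ j * \<psi> x)"
        if "\<psi> \<in> test_functions UNIV" for j \<psi> using wk[OF that, of j] by (simp add: fk_def Gk_def)
    qed blast
    then show ?thesis unfolding P_def by blast
  qed
  then obtain uk Hk where "\<And>k. P k (uk k) (Hk k)" by metis
  then have lip: "\<And>k. \<exists>L. L-lipschitz_on UNIV (uk k)" and ukX: "\<And>k. uk k \<in> X"
    and HkX: "\<And>k j. (\<lambda>x. Hk k x $ j) \<in> X"
    and z: "\<And>k x. x \<notin> V k \<Longrightarrow> uk k x = 0" "\<And>k x. x \<notin> V k \<Longrightarrow> Hk k x = 0"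
    and wk: "\<And>k j \<psi>. \<psi> \<in> test_functions UNIV \<Longrightarrow>
      (LINT x|lebesgue. uk k x * partial_derivative j \<psi> x) = - (LINT x|lebesgue. Hk k x $ j * \<psi> x)"
    and Nu: "\<And>k. N (\<lambda>x. uk k x - fk k x) < \<delta> / 2 ^ Suc k"
    and NH: "\<And>k. N (\<lambda>x. norm (Hk k x - Gk k x)) < \<delta> / 2 ^ Suc k"
    unfolding P_def by blast+
  \<comment> \<open>At points of \<open>C m\<close> the terms with k \<ge> m + 2 vanish, so both
    series are locally finite sums.\<close>
  define u where "u x = (\<Sum>k. uk k x)" for x
  define H where "H x = (\<Sum>k. Hk k x)" for x
  have out: "x \<notin> V k" if "m + 2 \<le> k" "x \<in> C m" for x m k using V(3)[OF that(1)] that(2) by blast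
  have u_eq: "u x = (\<Sum>k<n. uk k x)" and H_eq: "H x = (\<Sum>k<n. Hk k x)"
    and f_eq: "f x = (\<Sum>k<n. fk k x)" and G_eq: "G x = (\<Sum>k<n. Gk k x)"
    if n: "m + 2 \<le> n" "x \<in> C m" for m n x
  proof -
    have far: "x \<notin> V k" if "k \<notin> {..<n}" for k using out[of m k x] n that by simp
    show "u x = (\<Sum>k<n. uk k x)" unfolding u_def by (rule suminf_finite) (use far z in auto)
    show "H x = (\<Sum>k<n. Hk k x)" unfolding H_def by (rule suminf_finite) (use far z in auto)
    show "f x = (\<Sum>k<n. fk k x)" unfolding fk_def by (simp add: \<theta>1[OF n] flip: sum_distrib_right)
    \<comment> \<open>The product-rule terms containing f cancel, because the derivatives of the
      partition of unity sum to 0.\<close>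
    show "G x = (\<Sum>k<n. Gk k x)"
      by (simp add: vec_eq_iff Gk_def sum.distrib \<theta>1[OF n] d\<theta>[OF n] flip: sum_distrib_right sum_distrib_left)
  qed
  have cover: "\<exists>m. x \<in> C m" if "x \<in> \<Omega>" for x using that C(2) by blast
  have dif: "(\<lambda>x. u x - f x) \<in> X" "N (\<lambda>x. u x - f x) \<le> \<delta>"
  proof -
    have *: "\<exists>n0. \<forall>n\<ge>n0. u x - f x = (\<Sum>k<n. uk k x - fk k x)" if "x \<in> \<Omega>" for x
    proof -
      obtain m where m: "x \<in> C m" using cover[OF \<open>x \<in> \<Omega>\<close>] by blast
      have "u x - f x = (\<Sum>k<n. uk k x - fk k x)" if "n \<ge> m + 2" for n
        using u_eq[OF that m] f_eq[OF that m] by (simp add: sum_subtractf)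
      then show ?thesis by blast
    qed
    show "(\<lambda>x. u x - f x) \<in> X" "N (\<lambda>x. u x - f x) \<le> \<delta>"
      using X_locally_finite_sum[OF X_diff[OF ukX fkX] less_imp_le[OF Nu] *] by blast+
  qed
  have dif': "(\<lambda>x. H x $ j - G x $ j) \<in> X" "N (\<lambda>x. H x $ j - G x $ j) \<le> \<delta>" for j
  proof -
    have *: "\<exists>n0. \<forall>n\<ge>n0. H x $ j - G x $ j = (\<Sum>k<n. Hk k x $ j - Gk k x $ j)" if "x \<in> \<Omega>" for x
    proof -
      obtain m where m: "x \<in> C m" using cover[OF \<open>x \<in> \<Omega>\<close>] by blast
      have "H x $ j - G x $ j = (\<Sum>k<n. Hk k x $ j - Gk k x $ j)" if "n \<ge> m + 2" for n
        using H_eq[OF that m] G_eq[OF that m] by (simp add: sum_subtractf)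
      then show ?thesis by blast
    qed
    have dX: "(\<lambda>x. (Hk k x - Gk k x) $ j) \<in> X" for k j using X_diff[OF HkX GkX] by simp
    have "N (\<lambda>x. Hk k x $ j - Gk k x $ j) \<le> \<delta> / 2 ^ Suc k" for k
      using X_norm_vec(3)[of "\<lambda>x. Hk k x - Gk k x" j, OF dX] NH[of k] by simp
    from X_locally_finite_sum[OF X_diff[OF HkX GkX] this *]
    show "(\<lambda>x. H x $ j - G x $ j) \<in> X" "N (\<lambda>x. H x $ j - G x $ j) \<le> \<delta>" by blast+
  qed
  \<comment> \<open>Only the errors are known to be summable in norm, so u and H enter X through
    their differences from f and G.\<close>
  have uX: "u \<in> X" using add[OF dif(1) f] by simp
  have HX: "(\<lambda>x. H x $ j) \<in> X" for j
    using add[OF dif'(1)[of j] G[of j]] by simp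
  have wu: "(LINT x|lebesgue_on \<Omega>. u x * partial_derivative j \<phi> x) = - (LINT x|lebesgue_on \<Omega>. H x $ j * \<phi> x)"
    if \<phi>: "\<phi> \<in> test_functions \<Omega>" for j \<phi>
  proof -
    let ?K = "closure {x. \<phi> x \<noteq> 0}"
    have \<phi>': "\<phi> \<in> test_functions UNIV" using \<phi> test_functions_mono[of \<Omega> UNIV] by blast
    note d\<phi> = partial_derivative_test_function[OF \<phi>, of j]
    obtain m where m: "?K \<subseteq> C m" using \<phi> C(3)[of ?K] by (auto simp: test_functions_def)
    have z: "\<phi> x = 0" "partial_derivative j \<phi> x = 0" if "x \<notin> C m" for x
    proof -
      have x: "x \<notin> ?K" using that m by blast
      show "\<phi> x = 0" by (rule test_functions_zero[OF \<phi> x])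
      show "partial_derivative j \<phi> x = 0" by (rule partial_derivative_outside_support[OF x])
    qed
    \<comment> \<open>On \<open>C m\<close>, which contains the support of \<phi>, this many pieces
      already give u and H exactly, so integral and sum can be exchanged.\<close>
    let ?n = "m + 2"
    have "(LINT x|lebesgue_on \<Omega>. u x * partial_derivative j \<phi> x) = (LINT x|lebesgue. u x * partial_derivative j \<phi> x)"
      by (rule X_test_integral(2)[OF uX d\<phi>])
    also have "\<dots> = (LINT x|lebesgue. (\<Sum>k<?n. uk k x * partial_derivative j \<phi> x))"
    proof (rule Bochner_Integration.integral_cong[OF refl])
      fix x
      show "u x * partial_derivative j \<phi> x = (\<Sum>k<?n. uk k x * partial_derivative j \<phi> x)"
        using z(2)[of x] u_eq[of m ?n x] by (cases "x \<in> C m") (auto simp: sum_distrib_right distrib_right)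
    qed
    also have "\<dots> = (\<Sum>k<?n. (LINT x|lebesgue. uk k x * partial_derivative j \<phi> x))"
      by (intro Bochner_Integration.integral_sum X_test_integral(1)[OF ukX d\<phi>])
    also have "\<dots> = - (\<Sum>k<?n. (LINT x|lebesgue. Hk k x $ j * \<phi> x))"
      by (simp add: wk[OF \<phi>'] sum_negf)
    also have "(\<Sum>k<?n. (LINT x|lebesgue. Hk k x $ j * \<phi> x)) = (LINT x|lebesgue. (\<Sum>k<?n. Hk k x $ j * \<phi> x))"
      by (intro Bochner_Integration.integral_sum[symmetric] X_test_integral(1)[OF HkX \<phi>])
    also have "\<dots> = (LINT x|lebesgue. H x $ j * \<phi> x)"
    proof (rule Bochner_Integration.integral_cong[OF refl])
      fix x
      show "(\<Sum>k<?n. Hk k x $ j * \<phi> x) = H x $ j * \<phi> x"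
        using z(1)[of x] H_eq[of m ?n x] by (cases "x \<in> C m") (auto simp: sum_distrib_right distrib_right)
    qed
    also have "\<dots> = (LINT x|lebesgue_on \<Omega>. H x $ j * \<phi> x)"
      by (rule X_test_integral(2)[OF HX \<phi>, symmetric])
    finally show ?thesis .
  qed
  show thesis
  proof (rule that[of u H])
    show "u \<in> locally_Lipschitz \<Omega>"
      unfolding locally_Lipschitz_def
    proof (intro CollectI ballI)
      fix x assume "x \<in> \<Omega>"
      then obtain m where "x \<in> C m" using cover by blast
      then have "x \<in> interior (C (Suc m))" using C(1) by blast
      then obtain r where r: "r > 0" "ball x r \<subseteq> C (Suc m)" unfolding mem_interior by blast
      \<comment> \<open>The ball lies in \<open>C (Suc m)\<close> rather than in \<open>C m\<close>,
        hence m + 3 pieces instead of m + 2.\<close>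
      obtain L where L: "L-lipschitz_on UNIV (\<lambda>x. \<Sum>k<m + 3. uk k x)" using lipschitz_on_sum[of UNIV uk "m + 3", OF lip] by blast
      have "u y = (\<Sum>k<m + 3. uk k y)" if "y \<in> ball x r \<inter> \<Omega>" for y
        using u_eq[of "Suc m" "m + 3" y] r(2) that by auto
      then have "L-lipschitz_on (ball x r \<inter> \<Omega>) u"
        using L by (simp add: lipschitz_on_def)
      then show "\<exists>r>0. \<exists>L. L-lipschitz_on (ball x r \<inter> \<Omega>) u" using r(1) by blast
    qed
    show "(u, H) \<in> W1X \<Omega> X"
      using uX HX wu X_subset_L1_loc by (auto simp: W1X_def weak_gradient_def)
    show "N (\<lambda>x. u x - f x) \<le> \<delta>" by (rule dif)
    have "N (\<lambda>x. norm (H x - G x)) \<le> (\<Sum>j\<in>UNIV. N (\<lambda>x. (H x - G x) $ j))"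
      by (rule X_norm_vec) (simp add: dif')
    also have "\<dots> \<le> (\<Sum>j\<in>(UNIV :: 'n set). \<delta>)" by (intro sum_mono) (simp add: dif')
    finally show "N (\<lambda>x. norm (H x - G x)) \<le> real CARD('n) * \<delta>" by simp
  qed
qed

text \<open>Yields the Cauchy condition in \<open>H1X\<close> from convergence to
  \<open>(f, G)\<close>.\<close>

lemma W1X_norm_triangle:
  fixes V W G :: "real^'n \<Rightarrow> real^'n"
  assumes u: "u \<in> X" "v \<in> X" "f \<in> X"
    and V: "\<And>j. (\<lambda>x. V x $ j) \<in> X" "\<And>j. (\<lambda>x. W x $ j) \<in> X" "\<And>j. (\<lambda>x. G x $ j) \<in> X"
  shows "W1X_norm N (\<lambda>x. u x - v x) (\<lambda>x. V x - W x) \<le>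
    W1X_norm N (\<lambda>x. u x - f x) (\<lambda>x. V x - G x) + W1X_norm N (\<lambda>x. v x - f x) (\<lambda>x. W x - G x)"
proof -
  have dX: "(\<lambda>x. norm (A x - B x)) \<in> X" if "\<And>j. (\<lambda>x. A x $ j) \<in> X" "\<And>j. (\<lambda>x. B x $ j) \<in> X"
    for A B :: "real^'n \<Rightarrow> real^'n"
    using X_norm_vec(1)[of "\<lambda>x. A x - B x"] X_diff[OF that] by simp
  have "norm (V x - W x) \<le> norm (V x - G x) + norm (W x - G x)" for x
    using norm_triangle_ineq4[of "V x - G x" "W x - G x"] by simp
  then have "N (\<lambda>x. norm (V x - W x)) \<le> N (\<lambda>x. norm (V x - G x) + norm (W x - G x))"
    by (intro X_dominated(2)[OF add[OF dX[OF V(1,3)] dX[OF V(2,3)]] X_measurable[OF dX[OF V(1,2)]]] AE_I2) simp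
  also have "\<dots> \<le> N (\<lambda>x. norm (V x - G x)) + N (\<lambda>x. norm (W x - G x))"
    by (rule norm_triangle[OF dX[OF V(1,3)] dX[OF V(2,3)]])
  finally show ?thesis
    using N_diff_triangle[OF u(1,3,2)] N_diff_commute[OF u(2,3)] by (simp add: W1X_norm_def)
qed

lemma W1X_subset_H1X: "W1X \<Omega> X \<subseteq> H1X \<Omega> X N"
proof (rule subrelI)
  fix f and G :: "real^'n \<Rightarrow> real^'n" assume fG: "(f, G) \<in> W1X \<Omega> X"
  then have f: "f \<in> X" and G: "\<And>j. (\<lambda>x. G x $ j) \<in> X" by (auto simp: W1X_def)
  \<comment> \<open>The factor \<open>1 + real CARD('n)\<close> adds the errors of function and
    gradient in \<open>Lipschitz_dense\<close> at accuracy 1 / (k + 1).\<close>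
  define P where "P k u H \<longleftrightarrow> u \<in> locally_Lipschitz \<Omega> \<and> (u, H) \<in> W1X \<Omega> X \<and>
    W1X_norm N (\<lambda>x. u x - f x) (\<lambda>x. H x - G x) \<le> (1 + real CARD('n)) * inverse (real (Suc k))" for k u H
  have "\<exists>u H. P k u H" for k
  proof -
    have "inverse (real (Suc k)) > 0" by simp
    then obtain u H where "u \<in> locally_Lipschitz \<Omega>" "(u, H) \<in> W1X \<Omega> X"
      "N (\<lambda>x. u x - f x) \<le> inverse (real (Suc k))"
      "N (\<lambda>x. norm (H x - G x)) \<le> real CARD('n) * inverse (real (Suc k))"
      by (rule Lipschitz_dense[OF fG])
    then have "P k u H" by (simp add: P_def W1X_norm_def distrib_right)
    then show ?thesis by blast
  qed
  then obtain u H where "\<And>k. P k (u k) (H k)" by metis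
  then have lip: "\<And>k. u k \<in> locally_Lipschitz \<Omega>" and W: "\<And>k. (u k, H k) \<in> W1X \<Omega> X"
    and le: "\<And>k. W1X_norm N (\<lambda>x. u k x - f x) (\<lambda>x. H k x - G x) \<le> (1 + real CARD('n)) * inverse (real (Suc k))"
    unfolding P_def by blast+
  have u: "u k \<in> X" and H: "(\<lambda>x. H k x $ j) \<in> X" for k j using W[of k] by (auto simp: W1X_def)
  have n0: "W1X_norm N (\<lambda>x. u k x - f x) (\<lambda>x. H k x - G x) \<ge> 0" for k
    using norm_nonneg[OF X_diff[OF u f]] norm_nonneg[OF X_norm_vec(1)[of "\<lambda>x. H k x - G x"]] X_diff[OF H G]
    by (simp add: W1X_norm_def)
  have lim: "(\<lambda>k. W1X_norm N (\<lambda>x. u k x - f x) (\<lambda>x. H k x - G x)) \<longlonglongrightarrow> 0"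
  proof (rule tendsto_sandwich)
    show "\<forall>\<^sub>F k in sequentially. 0 \<le> W1X_norm N (\<lambda>x. u k x - f x) (\<lambda>x. H k x - G x)"
      by (intro always_eventually allI n0)
    show "\<forall>\<^sub>F k in sequentially. W1X_norm N (\<lambda>x. u k x - f x) (\<lambda>x. H k x - G x)
        \<le> (1 + real CARD('n)) * inverse (real (Suc k))"
      by (intro always_eventually allI le)
    show "(\<lambda>k. (1 + real CARD('n)) * inverse (real (Suc k))) \<longlonglongrightarrow> 0"
      using tendsto_mult_left[OF LIMSEQ_inverse_real_of_nat] by simp
  qed simp
  have "\<exists>M. \<forall>k\<ge>M. \<forall>l\<ge>M. W1X_norm N (\<lambda>x. u k x - u l x) (\<lambda>x. H k x - H l x) < e" if "e > 0" for e
  proof -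
    have "\<forall>\<^sub>F k in sequentially. W1X_norm N (\<lambda>x. u k x - f x) (\<lambda>x. H k x - G x) < e / 2"
      using lim that by (intro order_tendstoD(2)) auto
    then obtain M where M: "\<And>k. k \<ge> M \<Longrightarrow> W1X_norm N (\<lambda>x. u k x - f x) (\<lambda>x. H k x - G x) < e / 2"
      unfolding eventually_sequentially by blast
    have "W1X_norm N (\<lambda>x. u k x - u l x) (\<lambda>x. H k x - H l x) < e" if "k \<ge> M" "l \<ge> M" for k l
      using W1X_norm_triangle[OF u u f H H G, of k l k l] M[OF that(1)] M[OF that(2)] by simp
    then show ?thesis by blast
  qed
  then show "(f, G) \<in> H1X \<Omega> X N"
    unfolding H1X_def using f G lip W lim by blast
qed

end

theorem theorem1p2:
  fixes \<Omega> :: "(real^'n) set"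
    and X :: "(real^'n \<Rightarrow> real) set"
    and N :: "(real^'n \<Rightarrow> real) \<Rightarrow> real"
  assumes "domain \<Omega>"
    and "banach_function_space \<Omega> X N"
    and "fatou_property \<Omega> X N"
    and "absolutely_continuous_norm \<Omega> X N"
    and "strong_Muckenhoupt \<Omega> X N"
  shows "H1X \<Omega> X N = W1X \<Omega> X"
proof -
  interpret muckenhoupt_space \<Omega> X N
    using assms by (intro muckenhoupt_space.intro muckenhoupt_space_axioms.intro) (auto simp: domain_def)
  show ?thesis using H1X_subset_W1X W1X_subset_H1X by (rule antisym)
qed

end
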